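(* Let $\Omega\subset\mathbb{C}$ be a domain and let $\tau$ be a positive measure on $\Omega$ such that $0<\int|P|\,d\tau<+\infty$ for every polynomial $P\not\equiv 0$ in $z$. Let $\mathcal{A}=\mathcal{A}(\Omega,\tau)$ be the (closed) subspace of $L^2(\Omega,\tau)$ consisting of analytic functions, and let $P(z,w)$ be the reproducing kernel of the orthogonal projection of $L^2(\Omega,\tau)$ onto $\mathcal{A}$. Let $F$ be a distribution with compact support in $\Omega$, and define the Toeplitz operator $T_F$ on $\mathcal{A}$ by $(T_Fu)(z)=\langle F,P(z,\cdot)u(\cdot)\rangle$, $z\in\Omega$. Suppose that $T_F$ has finite rank $m$. Then there exist finitely many points $z_q\in\Omega$, $q=1,\dots,m_0$, with $m_0\le m$, and linear differential operators $L_q=L_q(\partial_x,\partial_y)$ with constant coefficients, such that $F=\sum_{q=1}^{m_0}L_q\delta(z-z_q)$.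
   Context: $\langle F,\phi\rangle$ denotes the action of the distribution $F$ on a smooth function $\phi$. The kernel $P(z,w)$ is smooth, analytic in $z$ and anti-analytic in $w$, so $T_F$ is a bounded operator on $\mathcal{A}$ with $(T_Fu,v)=\langle F,u\bar v\rangle$. Here $z=x+iy$. *)

theory Defs
  imports "HOL-Analysis.Analysis" "HOL-Complex_Analysis.Complex_Analysis"
    "HOL-Computational_Algebra.Polynomial" "HOL-Library.Function_Algebras"
begin

definition dx :: "(complex \<Rightarrow> complex) \<Rightarrow> complex \<Rightarrow> complex" where
  "dx f = (\<lambda>z. vector_derivative (\<lambda>t::real. f (z + of_real t)) (at 0))"

definition dy :: "(complex \<Rightarrow> complex) \<Rightarrow> complex \<Rightarrow> complex" where
  "dy f = (\<lambda>z. vector_derivative (\<lambda>t::real. f (z + \<i> * of_real t)) (at 0))"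

definition pdiff :: "nat \<Rightarrow> nat \<Rightarrow> (complex \<Rightarrow> complex) \<Rightarrow> complex \<Rightarrow> complex" where
  "pdiff a b f = (dx ^^ a) ((dy ^^ b) f)"

definition smooth_on :: "complex set \<Rightarrow> (complex \<Rightarrow> complex) \<Rightarrow> bool" where
  "smooth_on \<Omega> f \<longleftrightarrow> (\<forall>a b. \<forall>z\<in>\<Omega>. pdiff a b f differentiable (at z))"

text \<open>Distributions with compact support in \<Omega>, i.e. continuous linear functionals on
  \<open>C^\<infinity>(\<Omega>)\<close> (the space \<open>\<E>'(\<Omega>)\<close>); continuity is expressed by the usual seminorm estimate
  over a compact set \<open>K \<subseteq> \<Omega>\<close>.\<close>
definition compact_distribution :: "complex set \<Rightarrow> ((complex \<Rightarrow> complex) \<Rightarrow> complex) \<Rightarrow> bool" where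
  "compact_distribution \<Omega> F \<longleftrightarrow>
     (\<forall>\<phi> \<psi> c. smooth_on \<Omega> \<phi> \<longrightarrow> smooth_on \<Omega> \<psi> \<longrightarrow>
        F (\<lambda>z. \<phi> z + \<psi> z) = F \<phi> + F \<psi> \<and> F (\<lambda>z. c * \<phi> z) = c * F \<phi>) \<and>
     (\<exists>K N C. compact K \<and> K \<subseteq> \<Omega> \<and>
        (\<forall>\<phi> M. smooth_on \<Omega> \<phi> \<longrightarrow>
           (\<forall>a\<le>N. \<forall>b\<le>N. \<forall>z\<in>K. norm (pdiff a b \<phi> z) \<le> M) \<longrightarrow> norm (F \<phi>) \<le> C * M))"

definition analytic_L2 :: "complex set \<Rightarrow> complex measure \<Rightarrow> (complex \<Rightarrow> complex) set" where
  "analytic_L2 \<Omega> \<tau> = {u. u holomorphic_on \<Omega> \<and> (\<integral>\<^sup>+ w. ennreal ((norm (u w))\<^sup>2) \<partial>\<tau>) < \<infinity>}"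

text \<open>\<open>P\<close> is the reproducing kernel of the orthogonal projection onto \<open>\<A>\<close>:
  \<open>P(z,w) = conj (K_z w)\<close> with \<open>K_z \<in> \<A>\<close> and \<open>u z = (u, K_z) = \<integral> u(w) P(z,w) d\<tau>(w)\<close>.\<close>
definition reproducing_kernel ::
  "complex set \<Rightarrow> complex measure \<Rightarrow> (complex \<Rightarrow> complex \<Rightarrow> complex) \<Rightarrow> bool" where
  "reproducing_kernel \<Omega> \<tau> P \<longleftrightarrow>
     (\<forall>z\<in>\<Omega>. (\<lambda>w. cnj (P z w)) \<in> analytic_L2 \<Omega> \<tau>) \<and>
     (\<forall>u\<in>analytic_L2 \<Omega> \<tau>. \<forall>z\<in>\<Omega>.
        integrable \<tau> (\<lambda>w. P z w * u w) \<and> u z = (\<integral> w. P z w * u w \<partial>\<tau>))"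

definition toeplitz ::
  "((complex \<Rightarrow> complex) \<Rightarrow> complex) \<Rightarrow> (complex \<Rightarrow> complex \<Rightarrow> complex) \<Rightarrow>
   (complex \<Rightarrow> complex) \<Rightarrow> complex \<Rightarrow> complex" where
  "toeplitz F P u = (\<lambda>z. F (\<lambda>w. P z w * u w))"

definition fscale :: "complex \<Rightarrow> (complex \<Rightarrow> complex) \<Rightarrow> complex \<Rightarrow> complex" where
  "fscale c f = (\<lambda>x. c * f x)"

definition span_dim_eq :: "(complex \<Rightarrow> complex) set \<Rightarrow> nat \<Rightarrow> bool" where
  "span_dim_eq R m \<longleftrightarrow>
     (\<exists>B. finite B \<and> card B = m \<and> \<not> module.dependent fscale B \<and>
          module.span fscale B = module.span fscale R)"

text \<open>\<open>T_F\<close> has finite rank m on \<open>\<A>\<close> (functions on \<Omega> compared on \<Omega> only).\<close>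
definition toeplitz_rank :: "complex set \<Rightarrow> complex measure \<Rightarrow> ((complex \<Rightarrow> complex) \<Rightarrow> complex) \<Rightarrow>
   (complex \<Rightarrow> complex \<Rightarrow> complex) \<Rightarrow> nat \<Rightarrow> bool" where
  "toeplitz_rank \<Omega> \<tau> F P m \<longleftrightarrow>
     span_dim_eq ((\<lambda>u. \<lambda>z. if z \<in> \<Omega> then toeplitz F P u z else 0) ` analytic_L2 \<Omega> \<tau>) m"

end

theory Submission
  imports Defs "Jordan_Normal_Form.Determinant"
begin

text \<open>
  Finite rank of the Toeplitz operator makes the sesquilinear form \<open>B p q = F (p * cnj q)\<close> on polynomials a
  form of rank \<open>r \<le> m\<close>: polynomials are pointwise limits, locally uniformly, of combinations of kernel
  functions, once the kernel is known to be locally bounded, which is Hartogs' theorem. Choose polynomials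
  \<open>f\<^sub>i\<close>, \<open>q\<^sub>j\<close> that realise the rank. The product of the determinants of \<open>F (f\<^sub>i * exp (c * z) * cnj q\<^sub>j)\<close>
  and of \<open>F (f\<^sub>i * cnj (q\<^sub>j * exp (- c * z)))\<close> is the determinant of
  \<open>F (f\<^sub>i * cnj q\<^sub>j * exp (c * z - cnj (c * z)))\<close>; the exponential is a phase, so this grows only polynomially
  in \<open>c\<close>. After conjugating the second determinant, the product is entire in \<open>c\<close> with the same modulus, hence a
  polynomial by Liouville's theorem, of a degree that does not change if one \<open>f\<^sub>i\<close> is replaced. This yields a
  polynomial \<open>g \<noteq> 0\<close> with \<open>B (g * p) q = 0\<close> for all \<open>p\<close>, \<open>q\<close>, hence \<open>F (g * \<phi>) = 0\<close> for smooth \<open>\<phi>\<close> by density. If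
  \<open>g\<close> has minimal degree, its roots lie in \<open>\<Omega>\<close>, there are at most \<open>m\<close> of them, and \<open>F\<close> vanishes on functions
  that are flat at these roots, so \<open>F\<close> is a combination of derivatives at the roots.
\<close>

subsection \<open>Calculus of iterated partial derivatives\<close>

text \<open>The obstacle is growth in \<open>c\<close>: with the weight \<open>exp (c * z)\<close>
  on one side only, the form is entire in \<open>c\<close> but may grow exponentially; with both
  weights it grows polynomially but is no longer holomorphic in \<open>c\<close>. Finite rank
  resolves the conflict: it factors the doubly weighted matrix into the two singly weighted ones,
  and determinants turn this into a product of a holomorphic and an antiholomorphic function. A
  second constraint is that \<open>F\<close> controls derivatives only up to a fixed order
  \<open>N\<close>. This is turned to advantage: quotients by \<open>g\<close> need only be of
  finite order, and cutoffs made from piecewise polynomials suffice. The count of the roots comes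
  from the cofactors \<open>g / (z - a)\<close>: by minimality each of them gives a nonzero
  functional of \<open>q\<close>, concentrated at \<open>a\<close>, and functionals concentrated at
  different points are independent. Hartogs' theorem enters because the kernel is given by its
  reproducing property alone, which makes it holomorphic in one variable at a time.\<close>

lemma has_derivative_dx_dy:
  assumes "(f has_derivative D) (at z)"
  shows "dx f z = D 1" "dy f z = D \<i>"
proof -
  have lin: "linear D" using assms has_derivative_linear by blast
  have *: "((\<lambda>t::real. f (z + v * of_real t)) has_vector_derivative D v) (at 0)" for v
  proof -
    have 1: "((\<lambda>t::real. z + v * of_real t) has_derivative (\<lambda>t. v * of_real t)) (at 0)"
      by (auto intro!: derivative_eq_intros)
    have 2: "(f has_derivative D) (at (z + v * of_real 0))" using assms by simp
    have "((\<lambda>t::real. f (z + v * of_real t)) has_derivative (\<lambda>t. D (v * of_real t))) (at 0)"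
      using diff_chain_at[OF 1 2] by (simp add: o_def)
    moreover have "(\<lambda>t. D (v * of_real t)) = (\<lambda>t. t *\<^sub>R D v)"
      by (metis (no_types) lin linear_scale mult.commute scaleR_conv_of_real)
    ultimately show ?thesis by (simp add: has_vector_derivative_def)
  qed
  show "dx f z = D 1" unfolding dx_def using *[of 1] by (simp add: vector_derivative_at)
  show "dy f z = D \<i>" unfolding dy_def using *[of \<i>] by (simp add: vector_derivative_at)
qed

lemma differentiable_has_derivative_dx_dy:
  assumes "f differentiable (at z)"
  shows "(f has_derivative (\<lambda>h. of_real (Re h) * dx f z + of_real (Im h) * dy f z)) (at z)"
proof -
  obtain D where D: "(f has_derivative D) (at z)" using assms by (auto simp: differentiable_def)
  have lin: "linear D" using D has_derivative_linear by blast
  have "D h = of_real (Re h) * D 1 + of_real (Im h) * D \<i>" for h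
  proof -
    have "h = Re h *\<^sub>R 1 + Im h *\<^sub>R \<i>" by (simp add: complex_eq_iff)
    then have "D h = D (Re h *\<^sub>R 1 + Im h *\<^sub>R \<i>)" by simp
    also have "\<dots> = Re h *\<^sub>R D 1 + Im h *\<^sub>R D \<i>"
      using lin by (simp add: linear_add linear_scale)
    finally show ?thesis by (simp add: scaleR_conv_of_real)
  qed
  then show ?thesis using D has_derivative_dx_dy[OF D] by (metis (no_types, lifting) ext)
qed

lemma dx_cong:
  assumes "open S" "z \<in> S" "\<And>w. w \<in> S \<Longrightarrow> f w = g w"
  shows "dx f z = dx g z" "dy f z = dy g z"
proof -
  have *: "vector_derivative (\<lambda>t::real. f (z + v * of_real t)) (at 0)
      = vector_derivative (\<lambda>t::real. g (z + v * of_real t)) (at 0)" for v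
  proof (rule vector_derivative_cong_eq)
    have "isCont (\<lambda>t::real. z + v * of_real t) 0"
      by (intro continuous_intros)
    then have "((\<lambda>t::real. z + v * of_real t) \<longlongrightarrow> z + v * of_real 0) (nhds 0)"
      unfolding isCont_def using tendsto_at_iff_tendsto_nhds by fast
    then have "eventually (\<lambda>t::real. z + v * of_real t \<in> S) (nhds 0)"
      using assms topological_tendstoD by fastforce
    then show "\<forall>\<^sub>F t in nhds 0. t \<in> UNIV \<longrightarrow> f (z + v * of_real t) = g (z + v * of_real t)"
      by (rule eventually_mono) (use assms in auto)
  qed (use assms in auto)
  show "dx f z = dx g z" unfolding dx_def using *[of 1] by simp
  show "dy f z = dy g z" unfolding dy_def using *[of \<i>] by simp
qed

lemma differentiable_cong_open:
  assumes "open S" "z \<in> S" "\<And>w. w \<in> S \<Longrightarrow> f w = g w" "f differentiable (at z)"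
  shows "g differentiable (at z)"
  using assms differentiable_def has_derivative_transform_within_open by metis

lemma pdiff_0 [simp]: "pdiff 0 0 f = f"
  by (simp add: pdiff_def)

lemma pdiff_Suc_left: "pdiff (Suc a) b f = dx (pdiff a b f)"
  by (simp add: pdiff_def)

lemma pdiff_Suc_right: "pdiff a (Suc b) f = pdiff a b (dy f)"
  by (simp add: pdiff_def funpow_swap1)

lemma pdiff_Suc_0: "pdiff (Suc a) 0 f = pdiff a 0 (dx f)"
  by (simp add: pdiff_def funpow_swap1)

lemma pdiff_0_Suc: "pdiff 0 (Suc b) f = dy (pdiff 0 b f)"
  by (simp add: pdiff_def)

lemma pdiff_cong:
  assumes "open S" "\<And>w. w \<in> S \<Longrightarrow> f w = g w" "z \<in> S"
  shows "pdiff a b f z = pdiff a b g z"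
proof -
  have "\<forall>w\<in>S. pdiff 0 b f w = pdiff 0 b g w"
    by (induction b) (auto simp: pdiff_0_Suc assms intro: dx_cong[OF \<open>open S\<close>])
  then have "\<forall>w\<in>S. pdiff a b f w = pdiff a b g w"
    by (induction a) (auto simp: pdiff_Suc_left assms intro: dx_cong[OF \<open>open S\<close>])
  then show ?thesis using assms by blast
qed

text \<open>Differentiability of finite order, counted separately in the two directions because
  \<open>pdiff\<close> fixes an order of differentiation and the seminorms of \<open>F\<close> run
  over squares \<open>a \<le> N\<close>, \<open>b \<le> N\<close>. Differentiability of the top
  derivative makes it continuous, as uniform approximation requires.\<close>

definition ck :: "nat \<Rightarrow> nat \<Rightarrow> complex set \<Rightarrow> (complex \<Rightarrow> complex) \<Rightarrow> bool" where
  "ck A B S f \<longleftrightarrow> (\<forall>a\<le>A. \<forall>b\<le>B. \<forall>z\<in>S. pdiff a b f differentiable (at z))"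

lemma smooth_on_iff_ck: "smooth_on S f \<longleftrightarrow> (\<forall>A B. ck A B S f)"
  unfolding smooth_on_def ck_def by blast

lemma smooth_on_imp_ck: "smooth_on S f \<Longrightarrow> ck A B S f"
  by (simp add: smooth_on_iff_ck)

lemma ck_mono: "ck A B S f \<Longrightarrow> A' \<le> A \<Longrightarrow> B' \<le> B \<Longrightarrow> T \<subseteq> S \<Longrightarrow> ck A' B' T f"
  unfolding ck_def by (meson order_trans subsetD)

lemma smooth_on_subset: "smooth_on S f \<Longrightarrow> T \<subseteq> S \<Longrightarrow> smooth_on T f"
  unfolding smooth_on_def by blast

lemma ck_imp_differentiable: "ck A B S f \<Longrightarrow> a \<le> A \<Longrightarrow> b \<le> B \<Longrightarrow> z \<in> S \<Longrightarrow> pdiff a b f differentiable (at z)"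
  unfolding ck_def by blast

lemma ck_differentiable: "ck A B S f \<Longrightarrow> z \<in> S \<Longrightarrow> f differentiable (at z)"
  unfolding ck_def using le0 pdiff_0 by metis

lemma ck_continuous_on: "ck A B S f \<Longrightarrow> a \<le> A \<Longrightarrow> b \<le> B \<Longrightarrow> continuous_on S (pdiff a b f)"
  by (meson ck_imp_differentiable continuous_at_imp_continuous_on differentiable_imp_continuous_within)

lemma ck_cong:
  assumes "open S" "\<And>w. w \<in> S \<Longrightarrow> f w = g w" "ck A B S f"
  shows "ck A B S g"
  unfolding ck_def
proof (intro allI impI ballI)
  fix a b z assume "a \<le> A" "b \<le> B" "z \<in> S"
  then show "pdiff a b g differentiable at z"
    using assms differentiable_cong_open[OF assms(1) \<open>z \<in> S\<close>, of "pdiff a b f"]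
      pdiff_cong[OF assms(1,2)] by (auto simp: ck_def)
qed

text \<open>\<open>pdiff\<close> applies \<open>dy\<close> first, so a \<open>dy\<close> can be
  peeled off at any order, but a \<open>dx\<close> only when no \<open>dy\<close> stands inside.
  This asymmetry dictates the inductions below: over \<open>A\<close> at \<open>B = 0\<close>, then
  over \<open>B\<close>.\<close>

lemma ck_Suc_right: "ck A (Suc B) S f \<longleftrightarrow> ck A 0 S f \<and> ck A B S (dy f)" (is "?l \<longleftrightarrow> ?r")
proof
  assume ?l
  then show ?r unfolding ck_def by (auto simp: pdiff_Suc_right[symmetric])
next
  assume r: ?r
  show ?l unfolding ck_def
  proof (intro allI impI ballI)
    fix a b z assume "a \<le> A" "b \<le> Suc B" "z \<in> S"
    then show "pdiff a b f differentiable at z"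
      using r by (cases b) (auto simp: ck_def pdiff_Suc_right)
  qed
qed

lemma ck_Suc_left: "ck (Suc A) 0 S f \<longleftrightarrow> ck 0 0 S f \<and> ck A 0 S (dx f)" (is "?l \<longleftrightarrow> ?r")
proof
  assume l: ?l
  have "pdiff (Suc a) 0 f differentiable at z" if "a \<le> A" "z \<in> S" for a z
    using l that by (simp add: ck_def)
  then show ?r using l by (auto simp: ck_def pdiff_Suc_0)
next
  assume r: ?r
  show ?l unfolding ck_def
  proof (intro allI impI ballI)
    fix a b z assume "a \<le> Suc A" "b \<le> (0::nat)" "z \<in> S"
    then show "pdiff a b f differentiable at z"
      using r by (cases a) (auto simp: ck_def pdiff_Suc_0)
  qed
qed

lemma ck_Suc_rightD: "ck A (Suc B) S f \<Longrightarrow> ck A B S (dy f)"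
  by (simp add: ck_Suc_right)

lemma ck_Suc_leftD: "ck (Suc A) 0 S f \<Longrightarrow> ck A 0 S (dx f)"
  by (simp add: ck_Suc_left)

lemma ck_00: "ck 0 0 S f \<longleftrightarrow> (\<forall>z\<in>S. f differentiable (at z))"
  by (simp add: ck_def)

lemma dx_dy_add:
  assumes "f differentiable (at z)" "g differentiable (at z)"
  shows "dx (\<lambda>z. f z + g z) z = dx f z + dx g z" "dy (\<lambda>z. f z + g z) z = dy f z + dy g z"
  using has_derivative_dx_dy[OF has_derivative_add[OF assms[THEN differentiable_has_derivative_dx_dy]]]
  by auto

lemma dx_dy_mult:
  assumes "f differentiable (at z)" "g differentiable (at z)"
  shows "dx (\<lambda>z. f z * g z) z = dx f z * g z + f z * dx g z"
    "dy (\<lambda>z. f z * g z) z = dy f z * g z + f z * dy g z"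
  using has_derivative_dx_dy[OF has_derivative_mult[OF assms[THEN differentiable_has_derivative_dx_dy]]]
  by auto

lemma ck_add_0:
  assumes "open S" "ck A 0 S f" "ck A 0 S g"
  shows "ck A 0 S (\<lambda>z. f z + g z)"
  using assms(2,3)
proof (induction A arbitrary: f g)
  case 0
  then show ?case by (auto simp: ck_00)
next
  case (Suc A)
  have "ck A 0 S (\<lambda>z. dx f z + dx g z)" by (intro Suc.IH ck_Suc_leftD Suc.prems)
  then have "ck A 0 S (dx (\<lambda>z. f z + g z))"
    by (rule ck_cong[OF assms(1), rotated])
      (use Suc.prems in \<open>auto simp: dx_dy_add ck_differentiable\<close>)
  then show ?case using Suc.prems by (auto simp: ck_Suc_left ck_00)
qed

lemma ck_add:
  assumes "open S" "ck A B S f" "ck A B S g"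
  shows "ck A B S (\<lambda>z. f z + g z)"
  using assms(2,3)
proof (induction B arbitrary: f g)
  case 0
  then show ?case by (intro ck_add_0 assms)
next
  case (Suc B)
  have "ck A B S (\<lambda>z. dy f z + dy g z)" by (intro Suc.IH ck_Suc_rightD Suc.prems)
  then have "ck A B S (dy (\<lambda>z. f z + g z))"
    by (rule ck_cong[OF assms(1), rotated])
      (use Suc.prems in \<open>auto simp: dx_dy_add ck_differentiable\<close>)
  then show ?case using Suc.prems ck_add_0[OF assms(1)] by (auto simp: ck_Suc_right)
qed

lemma ck_mult_0:
  assumes "open S" "ck A 0 S f" "ck A 0 S g"
  shows "ck A 0 S (\<lambda>z. f z * g z)"
  using assms(2,3)
proof (induction A arbitrary: f g)
  case 0
  then show ?case by (auto simp: ck_00)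
next
  case (Suc A)
  have "ck A 0 S f" "ck A 0 S g" using Suc.prems ck_mono by (meson le_SucI order_refl)+
  then have "ck A 0 S (\<lambda>z. dx f z * g z + f z * dx g z)"
    by (intro ck_add Suc.IH ck_Suc_leftD Suc.prems assms)
  then have "ck A 0 S (dx (\<lambda>z. f z * g z))"
    by (rule ck_cong[OF assms(1), rotated])
      (use Suc.prems in \<open>auto simp: dx_dy_mult ck_differentiable\<close>)
  then show ?case using Suc.prems by (auto simp: ck_Suc_left ck_00)
qed

lemma ck_mult:
  assumes "open S" "ck A B S f" "ck A B S g"
  shows "ck A B S (\<lambda>z. f z * g z)"
  using assms(2,3)
proof (induction B arbitrary: f g)
  case 0
  then show ?case by (intro ck_mult_0 assms)
next
  case (Suc B)
  have "ck A B S f" "ck A B S g" using Suc.prems ck_mono by (meson le_SucI order_refl)+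
  then have "ck A B S (\<lambda>z. dy f z * g z + f z * dy g z)"
    by (intro ck_add Suc.IH ck_Suc_rightD Suc.prems assms)
  then have "ck A B S (dy (\<lambda>z. f z * g z))"
    by (rule ck_cong[OF assms(1), rotated])
      (use Suc.prems in \<open>auto simp: dx_dy_mult ck_differentiable\<close>)
  then show ?case using Suc.prems ck_mult_0[OF assms(1)] by (auto simp: ck_Suc_right)
qed

lemma pdiff_add:
  assumes "open S" "ck a b S f" "ck a b S g" "z \<in> S"
  shows "pdiff a b (\<lambda>z. f z + g z) z = pdiff a b f z + pdiff a b g z"
proof -
  have ck0: "ck a' b' S f" "ck a' b' S g" if "a' \<le> a" "b' \<le> b" for a' b'
    using that assms ck_mono by blast+
  have 0: "\<forall>z\<in>S. pdiff 0 b' (\<lambda>z. f z + g z) z = pdiff 0 b' f z + pdiff 0 b' g z"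
    if "b' \<le> b" for b'
    using that
  proof (induction b')
    case (Suc b')
    have "pdiff 0 b' f differentiable (at z)" "pdiff 0 b' g differentiable (at z)" if "z \<in> S" for z
      using assms(2,3) that Suc.prems by (auto intro: ck_imp_differentiable)
    moreover have "dy (pdiff 0 b' (\<lambda>z. f z + g z)) z = dy (\<lambda>z. pdiff 0 b' f z + pdiff 0 b' g z) z"
      if "z \<in> S" for z
      using Suc by (intro dx_cong[OF assms(1) that]) auto
    ultimately show ?case by (simp add: pdiff_0_Suc dx_dy_add)
  qed auto
  have "\<forall>z\<in>S. pdiff a' b (\<lambda>z. f z + g z) z = pdiff a' b f z + pdiff a' b g z"
    if "a' \<le> a" for a'
    using that
  proof (induction a')
    case (Suc a')
    have "pdiff a' b f differentiable (at z)" "pdiff a' b g differentiable (at z)" if "z \<in> S" for z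
      using assms(2,3) that Suc.prems by (auto intro: ck_imp_differentiable)
    moreover have "dx (pdiff a' b (\<lambda>z. f z + g z)) z = dx (\<lambda>z. pdiff a' b f z + pdiff a' b g z) z"
      if "z \<in> S" for z
      using Suc by (intro dx_cong[OF assms(1) that]) auto
    ultimately show ?case by (simp add: pdiff_Suc_left dx_dy_add)
  qed (use 0 in auto)
  then show ?thesis using assms by blast
qed

text \<open>The Leibniz rule without binomial coefficients: every differentiation of a product
  doubles the number of terms, each of which is again a product obeying the same bounds.\<close>

lemma pdiff_mult_bound_0:
  assumes "open S" "ck a 0 S f" "ck a 0 S g" "z \<in> S"
    and "\<And>i. i \<le> a \<Longrightarrow> norm (pdiff i 0 f z) \<le> M1" "\<And>i. i \<le> a \<Longrightarrow> norm (pdiff i 0 g z) \<le> M2"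
  shows "norm (pdiff a 0 (\<lambda>z. f z * g z) z) \<le> 2 ^ a * M1 * M2"
  using assms(2,3,5,6)
proof (induction a arbitrary: f g)
  case 0
  then have "norm (f z) * norm (g z) \<le> M1 * M2"
    using "0.prems"(3)[of 0] by (intro mult_mono) (auto intro: order_trans[OF norm_ge_zero])
  then show ?case by (simp add: norm_mult)
next
  case (Suc a)
  have ck: "ck a 0 S f" "ck a 0 S g" "ck a 0 S (dx f)" "ck a 0 S (dx g)"
    using Suc.prems ck_mono ck_Suc_leftD by (meson le_SucI order_refl)+
  have dd: "norm (pdiff i 0 (dx f) z) \<le> M1" "norm (pdiff i 0 (dx g) z) \<le> M2" if "i \<le> a" for i
    using Suc.prems(3)[of "Suc i"] Suc.prems(4)[of "Suc i"] that by (auto simp: pdiff_Suc_0)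
  have "pdiff (Suc a) 0 (\<lambda>z. f z * g z) z = pdiff a 0 (\<lambda>z. dx f z * g z + f z * dx g z) z"
    unfolding pdiff_Suc_0 using Suc.prems
    by (intro pdiff_cong[OF assms(1)] assms) (auto simp: dx_dy_mult ck_differentiable)
  also have "\<dots> = pdiff a 0 (\<lambda>z. dx f z * g z) z + pdiff a 0 (\<lambda>z. f z * dx g z) z"
    using ck by (intro pdiff_add[OF assms(1)] ck_mult assms) auto
  also have "norm \<dots> \<le> 2 ^ a * M1 * M2 + 2 ^ a * M1 * M2"
    by (intro norm_triangle_mono Suc.IH ck dd) (use Suc.prems in auto)
  finally show ?case by (simp add: mult_ac)
qed

lemma pdiff_mult_bound:
  assumes "open S" "ck a b S f" "ck a b S g" "z \<in> S"
    and "\<And>i j. i \<le> a \<Longrightarrow> j \<le> b \<Longrightarrow> norm (pdiff i j f z) \<le> M1"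
    and "\<And>i j. i \<le> a \<Longrightarrow> j \<le> b \<Longrightarrow> norm (pdiff i j g z) \<le> M2"
  shows "norm (pdiff a b (\<lambda>z. f z * g z) z) \<le> 2 ^ (a + b) * M1 * M2"
  using assms(2,3,5,6)
proof (induction b arbitrary: f g)
  case 0
  then show ?case using pdiff_mult_bound_0[OF assms(1) 0(1,2) assms(4), of M1 M2] by simp
next
  case (Suc b)
  have ck: "ck a b S f" "ck a b S g" "ck a b S (dy f)" "ck a b S (dy g)"
    using Suc.prems ck_mono ck_Suc_rightD by (meson le_SucI order_refl)+
  have dd: "norm (pdiff i j (dy f) z) \<le> M1" "norm (pdiff i j (dy g) z) \<le> M2" if "i \<le> a" "j \<le> b" for i j
    using Suc.prems(3)[of i "Suc j"] Suc.prems(4)[of i "Suc j"] that by (auto simp: pdiff_Suc_right)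
  have "pdiff a (Suc b) (\<lambda>z. f z * g z) z = pdiff a b (\<lambda>z. dy f z * g z + f z * dy g z) z"
    unfolding pdiff_Suc_right using Suc.prems
    by (intro pdiff_cong[OF assms(1)] assms) (auto simp: dx_dy_mult ck_differentiable)
  also have "\<dots> = pdiff a b (\<lambda>z. dy f z * g z) z + pdiff a b (\<lambda>z. f z * dy g z) z"
    using ck by (intro pdiff_add[OF assms(1)] ck_mult assms) auto
  also have "norm \<dots> \<le> 2 ^ (a + b) * M1 * M2 + 2 ^ (a + b) * M1 * M2"
    by (intro norm_triangle_mono Suc.IH ck dd) (use Suc.prems in auto)
  finally show ?case by (simp add: mult_ac)
qed

text \<open>On holomorphic functions \<open>dx\<close> is the complex derivative and
  \<open>dy\<close> is \<open>\<i>\<close> times it; the free factor \<open>c\<close> collects the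
  powers of \<open>\<i>\<close> during the induction. For conjugates the factor becomes
  \<open>- \<i>\<close>.\<close>

lemma pdiff_holomorphic:
  assumes "open S" "f holomorphic_on S" "z \<in> S"
  shows "pdiff a b (\<lambda>z. c * f z) z = c * \<i> ^ b * (deriv ^^ (a + b)) f z"
proof -
  have hd: "((\<lambda>z. c * h z) has_derivative (\<lambda>t. c * (deriv h z * t))) (at z)"
    if "h holomorphic_on S" "z \<in> S" for h z c
    using holomorphic_derivI[OF that(1) assms(1) that(2)]
    by (auto simp: has_field_derivative_def intro!: derivative_eq_intros)
  have 0: "pdiff a 0 (\<lambda>z. c * h z) z = c * (deriv ^^ a) h z"
    if "h holomorphic_on S" "z \<in> S" for h z a c
    using that
  proof (induction a arbitrary: h z)
    case (Suc a)
    have "pdiff (Suc a) 0 (\<lambda>z. c * h z) z = pdiff a 0 (\<lambda>z. c * deriv h z) z"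
      unfolding pdiff_Suc_0
      by (rule pdiff_cong[OF assms(1)]) (use Suc.prems has_derivative_dx_dy(1)[OF hd] in auto)
    then show ?case using Suc holomorphic_deriv[OF _ assms(1)]
      by (simp add: funpow_swap1)
  qed auto
  show ?thesis using assms(2,3)
  proof (induction b arbitrary: f c z)
    case (Suc b)
    have "pdiff a (Suc b) (\<lambda>z. c * f z) z = pdiff a b (\<lambda>z. (c * \<i>) * deriv f z) z"
      unfolding pdiff_Suc_right
      by (rule pdiff_cong[OF assms(1)]) (use Suc.prems has_derivative_dx_dy(2)[OF hd] in auto)
    then show ?case using Suc holomorphic_deriv[OF _ assms(1)]
      by (simp add: funpow_swap1)
  qed (use 0 in auto)
qed

lemma pdiff_cnj_holomorphic:
  assumes "open S" "f holomorphic_on S" "z \<in> S"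
  shows "pdiff a b (\<lambda>z. c * cnj (f z)) z = c * (- \<i>) ^ b * cnj ((deriv ^^ (a + b)) f z)"
proof -
  have hd: "((\<lambda>z. c * cnj (h z)) has_derivative (\<lambda>t. c * cnj (deriv h z * t))) (at z)"
    if "h holomorphic_on S" "z \<in> S" for h z c
    using holomorphic_derivI[OF that(1) assms(1) that(2)]
    by (auto simp: has_field_derivative_def intro!: derivative_eq_intros)
  have 0: "pdiff a 0 (\<lambda>z. c * cnj (h z)) z = c * cnj ((deriv ^^ a) h z)"
    if "h holomorphic_on S" "z \<in> S" for h z a c
    using that
  proof (induction a arbitrary: h z)
    case (Suc a)
    have "pdiff (Suc a) 0 (\<lambda>z. c * cnj (h z)) z = pdiff a 0 (\<lambda>z. c * cnj (deriv h z)) z"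
      unfolding pdiff_Suc_0
      by (rule pdiff_cong[OF assms(1)]) (use Suc.prems has_derivative_dx_dy(1)[OF hd] in auto)
    then show ?case using Suc holomorphic_deriv[OF _ assms(1)]
      by (simp add: funpow_swap1)
  qed auto
  show ?thesis using assms(2,3)
  proof (induction b arbitrary: f c z)
    case (Suc b)
    have "pdiff a (Suc b) (\<lambda>z. c * cnj (f z)) z = pdiff a b (\<lambda>z. (c * (- \<i>)) * cnj (deriv f z)) z"
      unfolding pdiff_Suc_right
      by (rule pdiff_cong[OF assms(1)]) (use Suc.prems has_derivative_dx_dy(2)[OF hd] in auto)
    then show ?case using Suc.IH[of "deriv f" z "c * (- \<i>)"] Suc.prems holomorphic_deriv[OF _ assms(1)]
      by (simp add: funpow_swap1 mult.assoc)
  qed (use 0 in auto)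
qed

lemma smooth_on_holomorphic:
  assumes "open S" "f holomorphic_on S"
  shows "smooth_on S f"
  unfolding smooth_on_def
proof (intro allI ballI)
  fix a b z assume z: "z \<in> S"
  have "(\<lambda>z. \<i> ^ b * (deriv ^^ (a + b)) f z) differentiable (at z)"
    using holomorphic_higher_deriv[OF assms(2,1), of "a + b"] z assms(1)
    by (intro differentiable_mult differentiable_const)
       (auto simp: holomorphic_on_open field_differentiable_def[symmetric]
         intro: field_differentiable_imp_differentiable)
  then show "pdiff a b f differentiable at z"
    by (rule differentiable_cong_open[OF assms(1) z, rotated])
      (use pdiff_holomorphic[OF assms, of _ a b 1] in auto)
qed

lemma differentiable_cnj:
  "f differentiable (at z) \<Longrightarrow> (\<lambda>z. cnj (f z)) differentiable (at z)"
  unfolding differentiable_def by (metis has_derivative_cnj)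

lemma smooth_on_cnj_holomorphic:
  assumes "open S" "f holomorphic_on S"
  shows "smooth_on S (\<lambda>z. cnj (f z))"
  unfolding smooth_on_def
proof (intro allI ballI)
  fix a b z assume z: "z \<in> S"
  have "(\<lambda>z. (- \<i>) ^ b * cnj ((deriv ^^ (a + b)) f z)) differentiable (at z)"
    using holomorphic_higher_deriv[OF assms(2,1), of "a + b"] z assms(1)
    by (intro differentiable_mult differentiable_const differentiable_cnj)
       (auto simp: holomorphic_on_open field_differentiable_def[symmetric]
         intro: field_differentiable_imp_differentiable)
  then show "pdiff a b (\<lambda>z. cnj (f z)) differentiable at z"
    by (rule differentiable_cong_open[OF assms(1) z, rotated])
      (use pdiff_cnj_holomorphic[OF assms, of _ a b 1] in auto)
qed

lemma smooth_on_add: "open S \<Longrightarrow> smooth_on S f \<Longrightarrow> smooth_on S g \<Longrightarrow> smooth_on S (\<lambda>z. f z + g z)"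
  by (simp add: smooth_on_iff_ck ck_add)

lemma smooth_on_mult: "open S \<Longrightarrow> smooth_on S f \<Longrightarrow> smooth_on S g \<Longrightarrow> smooth_on S (\<lambda>z. f z * g z)"
  by (simp add: smooth_on_iff_ck ck_mult)

lemma smooth_on_const: "open S \<Longrightarrow> smooth_on S (\<lambda>z. c)"
  by (rule smooth_on_holomorphic) auto

lemma smooth_on_cmult: "open S \<Longrightarrow> smooth_on S f \<Longrightarrow> smooth_on S (\<lambda>z. c * f z)"
  by (intro smooth_on_mult smooth_on_const)

lemma smooth_on_minus: "open S \<Longrightarrow> smooth_on S f \<Longrightarrow> smooth_on S g \<Longrightarrow> smooth_on S (\<lambda>z. f z - g z)"
  using smooth_on_add[of S f "\<lambda>z. -1 * g z"] smooth_on_cmult[of S g "-1"] by simp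

lemma smooth_on_sum:
  "open S \<Longrightarrow> (\<And>i. i \<in> I \<Longrightarrow> smooth_on S (f i)) \<Longrightarrow> smooth_on S (\<lambda>z. \<Sum>i\<in>I. f i z)"
  by (induction I rule: infinite_finite_induct) (auto intro: smooth_on_add smooth_on_const)

lemma smooth_on_cong:
  "open S \<Longrightarrow> (\<And>w. w \<in> S \<Longrightarrow> f w = g w) \<Longrightarrow> smooth_on S f \<Longrightarrow> smooth_on S g"
  unfolding smooth_on_iff_ck using ck_cong by blast

lemma ck_const: "open S \<Longrightarrow> ck A B S (\<lambda>z. c)"
  by (simp add: smooth_on_const smooth_on_imp_ck)

lemma ck_minus:
  assumes "open S" "ck A B S f" "ck A B S g"
  shows "ck A B S (\<lambda>z. f z - g z)"
  using ck_add[OF assms(1,2) ck_mult[OF assms(1) ck_const[OF assms(1)] assms(3)], of "-1"] by simp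

lemma pdiff_cmult:
  assumes "open S" "ck a b S f" "z \<in> S"
  shows "pdiff a b (\<lambda>z. c * f z) z = c * pdiff a b f z"
proof -
  have dd: "dx (\<lambda>z. c * f z) z = c * dx f z" "dy (\<lambda>z. c * f z) z = c * dy f z"
    if "f differentiable (at z)" for f z
    using has_derivative_dx_dy[OF has_derivative_mult_right[OF that[THEN differentiable_has_derivative_dx_dy]]]
    by auto
  have 0: "pdiff a 0 (\<lambda>z. c * f z) z = c * pdiff a 0 f z" if "ck a 0 S f" "z \<in> S" for f z a
    using that
  proof (induction a arbitrary: f)
    case (Suc a)
    have "pdiff a 0 (dx (\<lambda>z. c * f z)) z = pdiff a 0 (\<lambda>z. c * dx f z) z"
      by (rule pdiff_cong[OF assms(1)]) (use Suc.prems dd ck_differentiable in auto)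
    then show ?case using Suc.IH[of "dx f"] ck_Suc_leftD Suc.prems by (simp add: pdiff_Suc_0)
  qed auto
  show ?thesis using assms(2,3)
  proof (induction b arbitrary: f)
    case (Suc b)
    have "pdiff a b (dy (\<lambda>z. c * f z)) z = pdiff a b (\<lambda>z. c * dy f z) z"
      by (rule pdiff_cong[OF assms(1)]) (use Suc.prems dd ck_differentiable in auto)
    then show ?case using Suc.IH[of "dy f"] ck_Suc_rightD Suc.prems by (simp add: pdiff_Suc_right)
  qed (use 0 in auto)
qed

lemma pdiff_minus:
  assumes "open S" "ck a b S f" "ck a b S g" "z \<in> S"
  shows "pdiff a b (\<lambda>z. f z - g z) z = pdiff a b f z - pdiff a b g z"
  using pdiff_add[OF assms(1,2), of "\<lambda>z. (-1) * g z" z] pdiff_cmult[OF assms(1,3,4), of "-1"]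
    ck_mult[OF assms(1) ck_const[OF assms(1)] assms(3), of "-1"] assms by simp

subsection \<open>Symmetry of second derivatives\<close>

text \<open>Young's version of the symmetry theorem, which asks for differentiability of the first
  partials at the one point \<open>z\<close>; this is what \<open>ck\<close> provides. Both mixed
  derivatives are limits of the same second difference \<open>\<Delta>\<close>, whose two increments
  may be exchanged.\<close>

lemma dx_dy_commute:
  assumes "open S" "\<And>w. w \<in> S \<Longrightarrow> f differentiable (at w)" "z \<in> S"
    and "dx f differentiable (at z)" "dy f differentiable (at z)"
  shows "dx (dy f) z = dy (dx f) z"
proof -
  define dv where "dv v w = of_real (Re v) * dx f w + of_real (Im v) * dy f w" for v w
  have dv_diff: "dv v differentiable (at z)" for v
    unfolding dv_def using assms by (intro differentiable_add differentiable_mult differentiable_const)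
  have fder: "(f has_derivative (\<lambda>h. dv h w)) (at w)" if "w \<in> S" for w
    unfolding dv_def using differentiable_has_derivative_dx_dy[OF assms(2)[OF that]] .
  define \<Delta> where "\<Delta> u v (t::real) = f (z + of_real t * u + of_real t * v) - f (z + of_real t * u)
      - f (z + of_real t * v) + f z" for u v t
  have key: "((\<lambda>t. \<Delta> u v t / of_real (t^2)) \<longlongrightarrow> L v) (at_right 0)"
    if L: "(dv u has_derivative L) (at z)" and n: "norm u = 1" "norm v = 1" for u v L
  proof (rule tendstoI)
    fix \<epsilon> :: real assume "\<epsilon> > 0"
    define e where "e = \<epsilon> / 4"
    have e: "e > 0" using \<open>\<epsilon> > 0\<close> by (simp add: e_def)
    have linL: "linear L" using L has_derivative_linear by blast
    obtain d where d: "d > 0" "\<And>w. norm (w - z) < d \<Longrightarrow>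
        norm (dv u w - dv u z - L (w - z)) \<le> e * norm (w - z)"
      using L e unfolding has_derivative_at_alt by blast
    obtain r where r: "r > 0" "ball z r \<subseteq> S" using assms(1,3) openE by blast
    have "norm (\<Delta> u v t / of_real (t^2) - L v) < \<epsilon>" if t: "0 < t" "t < min d r / 2" for t
    proof -
      \<comment> \<open>Subtracting the linear term leaves a function whose derivative is the error
        of linearising \<open>dv u\<close> at \<open>z\<close>, of size \<open>3 * e * t\<close>;
        over an interval of length \<open>t\<close> this amounts to
        \<open>3 * e * t^2\<close>.\<close>
      define g where "g s = f (z + of_real s * u + of_real t * v) - f (z + of_real s * u)
          - of_real s * L (of_real t * v)" for s :: real
      have inS: "z + of_real s * u + of_real t * v \<in> ball z (min d r)" "z + of_real s * u \<in> ball z (min d r)"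
        if "s \<in> {0..t}" for s
      proof -
        have n1: "norm (of_real s * u + of_real t * v) \<le> s + t" "norm (of_real s * u) \<le> s"
          using that t n norm_triangle_ineq[of "of_real s * u" "of_real t * v"] by (auto simp: norm_mult)
        have "dist z (z + of_real s * u + of_real t * v) = norm (of_real s * u + of_real t * v)"
          "dist z (z + of_real s * u) = norm (of_real s * u)"
          by (metis add.assoc add_diff_cancel_left' dist_commute dist_norm)+
        then show "z + of_real s * u + of_real t * v \<in> ball z (min d r)" "z + of_real s * u \<in> ball z (min d r)"
          using that t n1 by auto
      qed
      have gder: "(g has_vector_derivative (dv u (z + of_real s * u + of_real t * v) - dv u (z + of_real s * u)
          - L (of_real t * v))) (at s within {0..t})" if s: "s \<in> {0..t}" for s
      proof -
        have S1: "z + of_real s * u + of_real t * v \<in> S" "z + of_real s * u \<in> S"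
          using inS[OF s] r by auto
        have lin: "dv (of_real x * u) w = of_real x * dv u w" for x w
          by (simp add: dv_def algebra_simps)
        have a1: "((\<lambda>s::real. z + of_real s * u + of_real t * v) has_derivative (\<lambda>x. of_real x * u)) (at s within {0..t})"
          by (auto intro!: derivative_eq_intros)
        have a2: "((\<lambda>s::real. z + of_real s * u) has_derivative (\<lambda>x. of_real x * u)) (at s within {0..t})"
          by (auto intro!: derivative_eq_intros)
        have b1: "((\<lambda>s::real. f (z + of_real s * u + of_real t * v)) has_derivative
            (\<lambda>x. of_real x * dv u (z + of_real s * u + of_real t * v))) (at s within {0..t})"
          using has_derivative_compose[OF a1 fder[OF S1(1)]] by (simp add: lin)
        have b2: "((\<lambda>s::real. f (z + of_real s * u)) has_derivative
            (\<lambda>x. of_real x * dv u (z + of_real s * u))) (at s within {0..t})"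
          using has_derivative_compose[OF a2 fder[OF S1(2)]] by (simp add: lin)
        have b3: "((\<lambda>s::real. of_real s * L (of_real t * v)) has_derivative
            (\<lambda>x. of_real x * L (of_real t * v))) (at s within {0..t})"
          by (auto intro!: derivative_eq_intros)
        show ?thesis unfolding has_vector_derivative_def g_def
          by (rule has_derivative_eq_rhs[OF has_derivative_diff[OF has_derivative_diff[OF b1 b2] b3]])
            (auto simp: scaleR_conv_of_real algebra_simps)
      qed
      have bound: "norm (dv u (z + of_real s * u + of_real t * v) - dv u (z + of_real s * u)
          - L (of_real t * v)) \<le> 3 * e * t" if s: "s \<in> {0..t}" for s
      proof -
        let ?w1 = "z + of_real s * u + of_real t * v" and ?w2 = "z + of_real s * u"
        have n1: "norm (?w1 - z) \<le> s + t" "norm (?w2 - z) \<le> s"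
          using s t n norm_triangle_ineq[of "of_real s * u" "of_real t * v"]
          by (auto simp: norm_mult algebra_simps)
        have "norm (?w1 - z) < d" "norm (?w2 - z) < d"
          using inS[OF s] by (metis dist_commute dist_norm mem_ball min_less_iff_conj)+
        note this[THEN d(2)]
        then have *: "norm (dv u ?w1 - dv u z - L (?w1 - z)) \<le> e * (s + t)"
          "norm (dv u ?w2 - dv u z - L (?w2 - z)) \<le> e * s"
          using n1 e by (meson mult_left_mono less_imp_le order_trans)+
        have "L (?w1 - z) = L (?w2 - z) + L (of_real t * v)"
          using linear_add[OF linL, of "?w2 - z" "of_real t * v"] by (simp add: algebra_simps)
        then have eq: "dv u ?w1 - dv u ?w2 - L (of_real t * v)
          = (dv u ?w1 - dv u z - L (?w1 - z)) - (dv u ?w2 - dv u z - L (?w2 - z))" by simp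
        have "norm (dv u ?w1 - dv u ?w2 - L (of_real t * v)) \<le> e * (s + t) + e * s"
          unfolding eq by (rule order_trans[OF norm_triangle_ineq4 add_mono[OF *]])
        also have "\<dots> \<le> 3 * e * t" using s e by (auto simp: algebra_simps)
        finally show ?thesis .
      qed
      have "norm (g t - g 0) \<le> 3 * e * t * norm (t - 0)"
      proof (rule differentiable_bound[of "{0..t}" g])
        fix s assume s: "s \<in> {0..t}"
        show "(g has_derivative (\<lambda>x. x *\<^sub>R (dv u (z + of_real s * u + of_real t * v) - dv u (z + of_real s * u)
            - L (of_real t * v)))) (at s within {0..t})"
          using gder[OF s] by (simp add: has_vector_derivative_def)
        show "onorm (\<lambda>x. x *\<^sub>R (dv u (z + of_real s * u + of_real t * v) - dv u (z + of_real s * u)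
            - L (of_real t * v))) \<le> 3 * e * t"
        proof (rule onorm_bound)
          fix x :: real
          show "norm (x *\<^sub>R (dv u (z + of_real s * u + of_real t * v) - dv u (z + of_real s * u)
            - L (of_real t * v))) \<le> 3 * e * t * norm x"
            using mult_left_mono[OF bound[OF s], of "\<bar>x\<bar>"] by (simp add: mult.commute)
        qed (use e t in auto)
      qed (use t in auto)
      moreover have "g t - g 0 = \<Delta> u v t - of_real t * L (of_real t * v)"
        by (simp add: g_def \<Delta>_def)
      moreover have "L (of_real t * v) = of_real t * L v"
        using linear_scale[OF linL, of t v] by (simp add: scaleR_conv_of_real)
      ultimately have "norm (\<Delta> u v t - of_real (t^2) * L v) \<le> 3 * e * t^2"
        using t by (simp add: power2_eq_square mult.assoc)
      moreover have "\<Delta> u v t / of_real (t^2) - L v = (\<Delta> u v t - of_real (t^2) * L v) / of_real (t^2)"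
        using t by (simp add: field_simps)
      ultimately have "norm (\<Delta> u v t / of_real (t^2) - L v) \<le> 3 * e"
        using t by (simp add: norm_divide norm_power divide_le_eq)
      also have "\<dots> < \<epsilon>" using \<open>\<epsilon> > 0\<close> by (simp add: e_def)
      finally show ?thesis .
    qed
    then show "\<forall>\<^sub>F t in at_right 0. dist (\<Delta> u v t / of_real (t^2)) (L v) < \<epsilon>"
      unfolding eventually_at_right_field dist_norm
      using d(1) r(1) by (intro exI[of _ "min d r / 2"]) auto
  qed
  have dv1: "dv 1 = dx f" and dvi: "dv \<i> = dy f" by (auto simp: dv_def)
  note h1 = differentiable_has_derivative_dx_dy[OF assms(4)]
  note h2 = differentiable_has_derivative_dx_dy[OF assms(5)]
  have "((\<lambda>t. \<Delta> 1 \<i> t / of_real (t^2)) \<longlongrightarrow> dy (dx f) z) (at_right 0)"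
    using key[of 1 _ \<i>, unfolded dv1, OF h1] by simp
  moreover have "((\<lambda>t. \<Delta> \<i> 1 t / of_real (t^2)) \<longlongrightarrow> dx (dy f) z) (at_right 0)"
    using key[of \<i> _ 1, unfolded dvi, OF h2] by simp
  moreover have "\<Delta> 1 \<i> = \<Delta> \<i> 1" by (auto simp: \<Delta>_def fun_eq_iff algebra_simps)
  ultimately show ?thesis using tendsto_unique trivial_limit_at_right_real by metis
qed

text \<open>\<open>dy\<close> has to pass all the \<open>dx\<close> that \<open>pdiff\<close> keeps
  outside, with one use of symmetry for each.\<close>

lemma dy_pdiff:
  assumes "open S" "ck A B S f" "a \<le> A" "b < B" "z \<in> S"
  shows "dy (pdiff a b f) z = pdiff a (Suc b) f z"
proof -
  have "\<forall>z\<in>S. dy (pdiff a b f) z = pdiff a (Suc b) f z" using assms(3)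
  proof (induction a)
    case 0
    then show ?case by (simp add: pdiff_0_Suc)
  next
    case (Suc a)
    show ?case
    proof
      fix z assume z: "z \<in> S"
      have IH: "\<And>w. w \<in> S \<Longrightarrow> dy (pdiff a b f) w = pdiff a (Suc b) f w" using Suc by auto
      have "dx (dy (pdiff a b f)) z = dy (dx (pdiff a b f)) z"
      proof (rule dx_dy_commute[OF assms(1) _ z])
        show "pdiff a b f differentiable at w" if "w \<in> S" for w
          using assms Suc.prems that by (auto intro: ck_imp_differentiable)
        show "dx (pdiff a b f) differentiable at z"
          using assms Suc.prems z by (auto simp: pdiff_Suc_left[symmetric] intro: ck_imp_differentiable)
        have "pdiff a (Suc b) f differentiable at z"
          using assms Suc.prems z by (auto intro: ck_imp_differentiable)
        then show "dy (pdiff a b f) differentiable at z"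
          by (rule differentiable_cong_open[OF assms(1) z, rotated]) (simp add: IH)
      qed
      moreover have "dx (dy (pdiff a b f)) z = dx (pdiff a (Suc b) f) z"
        by (rule dx_cong[OF assms(1) z IH])
      ultimately show "dy (pdiff (Suc a) b f) z = pdiff (Suc a) (Suc b) f z"
        by (simp add: pdiff_Suc_left)
    qed
  qed
  then show ?thesis using assms(5) by blast
qed

subsection \<open>Separately holomorphic functions are locally bounded\<close>

text \<open>On the unit circle \<open>cnj z * z = 1\<close>, so \<open>z ^ m * cnj z ^ n\<close> is
  a monomial or the conjugate of one, and conjugation is invisible under \<open>Re\<close>.\<close>

lemma Re_poly_mult_cnj_circle:
  "\<exists>H. \<forall>z. norm z = 1 \<longrightarrow> Re (poly A z * cnj (poly B z)) = Re (poly H z)"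
proof -
  define R where "R = {u::complex \<Rightarrow> real. \<exists>H. \<forall>z. norm z = 1 \<longrightarrow> u z = Re (poly H z)}"
  have add: "(\<lambda>z. u z + v z) \<in> R" if uv: "u \<in> R" "v \<in> R" for u v
  proof -
    obtain H1 H2 where "\<forall>z. norm z = 1 \<longrightarrow> u z = Re (poly H1 z)" "\<forall>z. norm z = 1 \<longrightarrow> v z = Re (poly H2 z)"
      using uv unfolding R_def by blast
    then show ?thesis unfolding R_def by (auto intro!: exI[of _ "H1 + H2"])
  qed
  have inv: "cnj z * z = 1" if "norm z = 1" for z :: complex
    using complex_norm_square[of z] that by (simp add: mult.commute)
  have mono: "(\<lambda>z. Re (c * z ^ m * cnj (d * z ^ n))) \<in> R" for c d m n
  proof (cases "n \<le> m")
    case True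
    have "c * z ^ m * cnj (d * z ^ n) = poly (monom (c * cnj d) (m - n)) z" if "norm z = 1" for z
    proof -
      have "z ^ m = z ^ n * z ^ (m - n)" using True by (simp flip: power_add)
      then have "c * z ^ m * cnj (d * z ^ n) = c * cnj d * z ^ (m - n) * (cnj z * z) ^ n"
        by (simp add: power_mult_distrib mult_ac)
      then show ?thesis using inv[OF that] by (simp add: poly_monom)
    qed
    then show ?thesis unfolding R_def mem_Collect_eq by metis
  next
    case False
    have "cnj (c * z ^ m * cnj (d * z ^ n)) = poly (monom (cnj c * d) (n - m)) z" if "norm z = 1" for z
    proof -
      have "z ^ n = z ^ m * z ^ (n - m)" using False by (simp flip: power_add)
      then have "cnj (c * z ^ m * cnj (d * z ^ n)) = cnj c * d * z ^ (n - m) * (cnj z * z) ^ m"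
        by (simp add: power_mult_distrib mult_ac)
      then show ?thesis using inv[OF that] by (simp add: poly_monom)
    qed
    then have "Re (c * z ^ m * cnj (d * z ^ n)) = Re (poly (monom (cnj c * d) (n - m)) z)" if "norm z = 1" for z
      using that complex_cnj_cancel_iff by (metis complex_cnj_cnj cnj.simps(1))
    then show ?thesis unfolding R_def by blast
  qed
  have sum: "(\<lambda>z. \<Sum>i\<in>I. u i z) \<in> R" if "\<And>i. i \<in> I \<Longrightarrow> u i \<in> R" for I :: "nat set" and u
    using that
  proof (induction I rule: infinite_finite_induct)
    case (insert x F)
    then show ?case using add[of "u x" "\<lambda>z. \<Sum>i\<in>F. u i z"] by simp
  qed (auto simp: R_def intro: exI[of _ 0])
  have "(\<lambda>z. \<Sum>i\<le>degree A. \<Sum>j\<le>degree B. Re (coeff A i * z ^ i * cnj (coeff B j * z ^ j))) \<in> R"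
    by (rule sum, rule sum, rule mono)
  moreover have "Re (poly A z * cnj (poly B z))
      = (\<Sum>i\<le>degree A. \<Sum>j\<le>degree B. Re (coeff A i * z ^ i * cnj (coeff B j * z ^ j)))" for z
    unfolding poly_altdef cnj_sum sum_product Re_sum ..
  ultimately show ?thesis by (simp add: R_def)
qed

text \<open>By \<open>Re a * Re b = Re (a * b + a * cnj b) / 2\<close>, the real parts of
  polynomials in \<open>z\<close> form an algebra on the circle; linear functions belong to
  it.\<close>

lemma real_polynomial_function_circle:
  assumes "real_polynomial_function (u :: complex \<Rightarrow> real)"
  shows "\<exists>H. \<forall>z. norm z = 1 \<longrightarrow> u z = Re (poly H z)"
  using assms
proof (induction rule: real_polynomial_function.induct)
  case (linear u)
  interpret bounded_linear u by fact
  have "u z = Re (poly [:0, complex_of_real (u 1) - \<i> * u \<i>:] z)" for z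
  proof -
    have "u z = u (Re z *\<^sub>R 1 + Im z *\<^sub>R \<i>)"
      by (rule arg_cong[of _ _ u]) (simp add: complex_eq_iff)
    also have "\<dots> = Re z * u 1 + Im z * u \<i>" by (simp only: add scaleR) simp
    finally show ?thesis by simp
  qed
  then show ?case by blast
next
  case (const c)
  show ?case by (rule exI[of _ "[:complex_of_real c:]"]) simp
next
  case (add u v)
  then obtain H1 H2 where "\<forall>z. norm z = 1 \<longrightarrow> u z = Re (poly H1 z)" "\<forall>z. norm z = 1 \<longrightarrow> v z = Re (poly H2 z)"
    by blast
  then show ?case by (auto intro!: exI[of _ "H1 + H2"])
next
  case (mult u v)
  then obtain A B where AB: "\<forall>z. norm z = 1 \<longrightarrow> u z = Re (poly A z)" "\<forall>z. norm z = 1 \<longrightarrow> v z = Re (poly B z)"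
    by blast
  obtain H where H: "\<forall>z. norm z = 1 \<longrightarrow> Re (poly A z * cnj (poly B z)) = Re (poly H z)"
    using Re_poly_mult_cnj_circle by blast
  have "u z * v z = Re (poly (Polynomial.smult (1/2) (A * B + H)) z)" if "norm z = 1" for z
  proof -
    have "Re (poly A z * poly B z) + Re (poly A z * cnj (poly B z)) = 2 * (Re (poly A z) * Re (poly B z))"
      by simp
    then have "2 * (u z * v z) = Re (poly A z * poly B z) + Re (poly H z)"
      using AB H that by (metis (no_types))
    then show ?thesis by simp
  qed
  then show ?case by blast
qed

text \<open>An approximate Dirichlet problem: continuous boundary values are matched by a function
  that is harmonic in the whole plane, without a Poisson integral.\<close>

lemma continuous_circle_approx:
  assumes "continuous_on (sphere 0 1) (u :: complex \<Rightarrow> real)" "e > 0"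
  obtains H where "\<And>z. norm z = 1 \<Longrightarrow> \<bar>u z - Re (poly H z)\<bar> < e"
proof -
  obtain g where g: "real_polynomial_function g" "\<And>x. x \<in> sphere 0 1 \<Longrightarrow> \<bar>u x - g x\<bar> < e"
    using Stone_Weierstrass_real_polynomial_function[OF compact_sphere assms] by blast
  then show ?thesis using real_polynomial_function_circle[OF g(1)] that by fastforce
qed

lemma Re_mean_circle:
  assumes "f holomorphic_on ball 0 R" "R > 1"
  shows "((\<lambda>t. Re (f (exp (2 * of_real pi * \<i> * of_real t)))) has_integral Re (f 0)) {0..1}"
proof -
  have "f holomorphic_on cball 0 1"
    by (rule holomorphic_on_subset[OF assms(1)]) (use assms(2) in auto)
  then have "((\<lambda>u. f u / (u - 0)) has_contour_integral (2 * of_real pi * \<i> * f 0)) (circlepath 0 1)"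
    by (rule Cauchy_integral_circlepath_simple) auto
  moreover have "(\<lambda>x. f (circlepath 0 1 x) / (circlepath 0 1 x - 0) * vector_derivative (circlepath 0 1) (at x))
      = (\<lambda>t. f (exp (2 * of_real pi * \<i> * of_real t)) * (2 * of_real pi * \<i>))"
    unfolding vector_derivative_circlepath by (simp add: circlepath fun_eq_iff)
  ultimately have "((\<lambda>t. f (exp (2 * of_real pi * \<i> * of_real t)) * (2 * of_real pi * \<i>)) has_integral (f 0 * (2 * of_real pi * \<i>))) {0..1}"
    unfolding has_contour_integral by (simp only: mult.commute[of "2 * of_real pi * \<i>" "f 0"])
  then have "((\<lambda>t. f (exp (2 * of_real pi * \<i> * of_real t)) * (2 * of_real pi * \<i>) / (2 * of_real pi * \<i>))
      has_integral (f 0 * (2 * of_real pi * \<i>)) / (2 * of_real pi * \<i>)) {0..1}"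
    by (rule has_integral_divide)
  then have "((\<lambda>t. f (exp (2 * of_real pi * \<i> * of_real t))) has_integral f 0) {0..1}"
    by (subst (asm) (1 2) nonzero_mult_div_cancel_right) auto
  then show ?thesis by (rule has_integral_Re)
qed

text \<open>The Moebius map taking \<open>w\<close> to \<open>(w - h0) / (w + cnj h0)\<close> sends
  the right half plane to the unit disc and the value at \<open>0\<close> to \<open>0\<close>, so
  the Schwarz lemma applies; solving for the value at \<open>a\<close> gives the bound.\<close>

lemma Harnack_poly:
  assumes pos: "\<And>z. norm z = 1 \<Longrightarrow> Re (poly H z) \<ge> 0" and a: "norm a < 1"
  shows "Re (poly H a) \<le> 2 / (1 - norm a) * Re (poly H 0)"
proof -
  have main: "Re (poly H a) \<le> 2 / (1 - norm a) * Re (poly H 0)"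
    if pos: "\<And>z. norm z = 1 \<Longrightarrow> Re (poly H z) > 0" for H
  proof -
    have pos': "Re (poly H z) > 0" if "norm z \<le> 1" for z
    proof (rule ccontr)
      assume "\<not> Re (poly H z) > 0"
      \<comment> \<open>The maximum principle for \<open>exp (- H)\<close> is the minimum principle
        for \<open>Re H\<close>.\<close>
      define E where "E = (\<lambda>z. exp (- poly H z))"
      obtain x where x: "x \<in> sphere 0 1" "\<And>y. y \<in> sphere (0::complex) 1 \<Longrightarrow> norm (E y) \<le> norm (E x)"
      proof -
        have "continuous_on (sphere 0 1) (\<lambda>z. norm (E z))" unfolding E_def by (intro continuous_intros)
        moreover have "(1::complex) \<in> sphere 0 1" by simp
        ultimately show ?thesis
          using continuous_attains_sup[of "sphere (0::complex) 1" "\<lambda>z. norm (E z)"] that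
          using compact_sphere[of "0::complex" 1] by (metis empty_iff)
      qed
      have "norm (E z) \<le> norm (E x)"
      proof (rule maximum_modulus_frontier[of E "cball 0 1"])
        show "E holomorphic_on interior (cball 0 1)" unfolding E_def by (intro holomorphic_intros)
        show "continuous_on (closure (cball 0 1)) E" unfolding E_def by (intro continuous_intros)
      qed (use x that in \<open>auto simp: frontier_cball\<close>)
      then have "Re (poly H x) \<le> Re (poly H z)" by (simp add: E_def)
      then show False using pos[of x] x \<open>\<not> Re (poly H z) > 0\<close> by auto
    qed
    define h0 where "h0 = poly H 0"
    define G where "G = (\<lambda>z. (poly H z - h0) / (poly H z + cnj h0))"
    have h0: "Re h0 > 0" using pos'[of 0] by (simp add: h0_def)
    have ne: "poly H z + cnj h0 \<noteq> 0" if "norm z \<le> 1" for z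
    proof
      assume "poly H z + cnj h0 = 0"
      then have "Re (poly H z) + Re h0 = 0" by (metis cnj.simps(1) zero_complex.simps(1) plus_complex.simps(1))
      then show False using pos'[OF that] h0 by simp
    qed
    have lt: "norm (G z) < 1" if "norm z < 1" for z
    proof -
      have p: "Re (poly H z) > 0" using pos'[of z] that by simp
      have "(norm (poly H z - h0))^2 < (norm (poly H z + cnj h0))^2"
        using mult_pos_pos[OF p h0] unfolding cmod_power2 by (simp add: power2_eq_square algebra_simps)
      then have "norm (poly H z - h0) < norm (poly H z + cnj h0)"
        by (rule power2_less_imp_less) simp
      then show ?thesis using ne[of z] that by (simp add: G_def norm_divide divide_less_eq)
    qed
    have "G holomorphic_on ball 0 1" unfolding G_def using ne by (intro holomorphic_intros) auto
    moreover have "G 0 = 0" by (simp add: G_def h0_def)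
    ultimately have G: "norm (G a) \<le> norm a" using Schwarz_Lemma(1)[of G] lt a by blast
    have "poly H a - h0 = G a * (poly H a + cnj h0)" using ne[of a] a by (simp add: G_def)
    then have eq: "poly H a * (1 - G a) = h0 + G a * cnj h0" by (simp add: algebra_simps)
    have g1: "norm (1 - G a) \<ge> 1 - norm a"
      using G norm_triangle_ineq2[of 1 "G a"] by simp
    then have g0: "1 - G a \<noteq> 0" using a by auto
    define i0 where "i0 = \<i> * of_real (Im h0)"
    have h0eq: "h0 = of_real (Re h0) + i0" "cnj h0 = of_real (Re h0) - i0"
      by (auto simp: i0_def complex_eq_iff)
    have "(poly H a - i0) * (1 - G a) = of_real (Re h0) * (1 + G a)"
      using eq unfolding h0eq(2) by (subst (asm) (1) h0eq(1)) (simp add: algebra_simps)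
    then have "norm (poly H a - i0) * norm (1 - G a) = Re h0 * norm (1 + G a)"
      using h0 by (metis abs_of_pos norm_mult norm_of_real)
    also have "\<dots> \<le> Re h0 * 2"
      using h0 G a norm_triangle_ineq[of 1 "G a"] by (intro mult_left_mono) auto
    finally have "norm (poly H a - i0) * norm (1 - G a) \<le> 2 * Re h0" by simp
    then have "norm (poly H a - i0) * (1 - norm a) \<le> 2 * Re h0"
      using g1 by (meson mult_left_mono norm_ge_zero order_trans)
    moreover have "Re (poly H a) \<le> norm (poly H a - i0)"
      using complex_Re_le_cmod[of "poly H a - i0"] by (simp add: i0_def)
    ultimately have "Re (poly H a) * (1 - norm a) \<le> 2 * Re h0"
      using a by (smt (verit) mult_right_mono)
    then have "Re (poly H a) \<le> 2 * Re h0 / (1 - norm a)"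
      using a by (subst pos_le_divide_eq) auto
    then show ?thesis by (simp add: h0_def)
  qed
  \<comment> \<open>The half plane argument wants strict positivity; a small constant is added to
    \<open>H\<close> and then sent to \<open>0\<close>.\<close>
  define k where "k = 2 / (1 - norm a)"
  have k: "k > 0" using a by (simp add: k_def)
  have *: "Re (poly H a) + e \<le> k * (Re (poly H 0) + e)" if "e > 0" for e
    unfolding k_def using main[of "H + [:complex_of_real e:]"] pos that by (simp add: add_nonneg_pos)
  have "Re (poly H a) \<le> k * Re (poly H 0) + e" if "e > 0" for e
  proof -
    have "0 < e / k" using that k by simp
    then have "Re (poly H a) + e / k \<le> k * (Re (poly H 0) + e / k)" by (rule *)
    also have "\<dots> = k * Re (poly H 0) + e" using k by (simp add: distrib_left)
    finally show ?thesis using \<open>0 < e / k\<close> by linarith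
  qed
  then show ?thesis unfolding k_def by (rule field_le_epsilon)
qed

text \<open>On the circle \<open>log max(|f j|\<^sup>1\<^sup>/\<^sup>j, c)\<close> is approximated by \<open>Re H\<close> with a polynomial \<open>H\<close>; the maximum
  principle for \<open>f j * exp (- j H)\<close>, Harnack's inequality and dominated convergence then replace
  the theory of subharmonic functions.\<close>

lemma Hartogs_lemma_unit:
  fixes f :: "nat \<Rightarrow> complex \<Rightarrow> complex"
  assumes hol: "\<And>j. f j holomorphic_on ball 0 R" "R > 1"
    and M: "\<And>j z. j > 0 \<Longrightarrow> norm z = 1 \<Longrightarrow> norm (f j z) \<le> M ^ j" "M > 0"
    and c: "c > 0" "\<And>z. norm z = 1 \<Longrightarrow> \<forall>\<^sub>F j in sequentially. norm (f j z) \<le> c ^ j"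
    and r: "r < 1" and q: "q > 1"
  shows "\<forall>\<^sub>F j in sequentially. \<forall>z. norm z \<le> r \<longrightarrow> norm (f j z) \<le> (c * q) ^ j"
proof (cases "r \<ge> 0")
  case False
  then show ?thesis by (smt (verit) always_eventually norm_ge_zero)
next
  case r0: True
  define E where "E t = exp (2 * of_real pi * \<i> * of_real t)" for t :: real
  have E: "norm (E t) = 1" for t by (simp add: E_def)
  have contE: "continuous_on {0..1} E" unfolding E_def by (intro continuous_intros)
  have contf: "continuous_on (sphere 0 1) (f j)" for j
    using holomorphic_on_imp_continuous_on[OF hol(1)] by (rule continuous_on_subset) (use hol(2) in auto)
  \<comment> \<open>The maximum with \<open>c ^ j\<close> keeps the logarithm finite and continuous
    at zeros of \<open>f j\<close>. After \<open>ln c\<close> is subtracted the functions are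
    nonnegative, bounded uniformly in \<open>j > 0\<close>, and eventually \<open>0\<close> at each
    point of the circle.\<close>
  define v where "v j z = ln (max (norm (f j z)) (c ^ j)) * inverse (real j) - ln c" for j z
  have cj: "max (norm (f j z)) (c ^ j) > 0" for j z using c(1) by (simp add: less_max_iff_disj)
  have contv: "continuous_on (sphere 0 1) (v j)" for j
    unfolding v_def using cj by (intro continuous_intros contf) (metis less_irrefl)
  have v0: "v j z \<ge> 0" if "j > 0" for j z
  proof -
    have "ln (c ^ j) \<le> ln (max (norm (f j z)) (c ^ j))" using c(1) cj by (subst ln_le_cancel_iff) auto
    then show ?thesis using that c(1) by (simp add: v_def ln_realpow field_simps)
  qed
  define B where "B = ln (max M c) - ln c"
  have vB: "v j z \<le> B" if "j > 0" "norm z = 1" for j z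
  proof -
    have "max (norm (f j z)) (c ^ j) \<le> (max M c) ^ j"
      using order_trans[OF M(1)[OF that] power_mono[of M "max M c" j]] power_mono[of c "max M c" j] c(1) M(2) by auto
    then have "ln (max (norm (f j z)) (c ^ j)) \<le> ln ((max M c) ^ j)" using cj M(2) by (subst ln_le_cancel_iff) auto
    then show ?thesis using that M(2) by (simp add: v_def B_def ln_realpow field_simps)
  qed
  have vlim: "(\<lambda>j. v j z) \<longlonglongrightarrow> 0" if "norm z = 1" for z
  proof (rule tendsto_eventually)
    show "\<forall>\<^sub>F j in sequentially. v j z = 0"
      using c(2)[OF that] eventually_gt_at_top[of 0]
      by eventually_elim (use c(1) in \<open>simp add: v_def max_absorb2 ln_realpow\<close>)
  qed
  have vint: "(\<lambda>t. v j (E t)) integrable_on {0..1}" for j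
    by (intro integrable_continuous_real continuous_on_compose2[OF contv contE]) (auto simp: E)
  \<comment> \<open>The index is shifted because the bounds on \<open>v j\<close> hold for
    \<open>j > 0\<close>.\<close>
  have "(\<lambda>j. integral {0..1} (\<lambda>t. v (Suc j) (E t))) \<longlonglongrightarrow> integral {0..1::real} (\<lambda>t. 0)"
  proof (rule dominated_convergence(2))
    show "(\<lambda>t. v (Suc j) (E t)) integrable_on {0..1}" for j by (rule vint)
    show "(\<lambda>t::real. B) integrable_on {0..1}" by (rule integrable_const_ivl)
    show "norm (v (Suc j) (E t)) \<le> B" for j t
      using v0[of "Suc j" "E t"] vB[of "Suc j" "E t"] by (simp add: E)
    show "(\<lambda>j. v (Suc j) (E t)) \<longlonglongrightarrow> 0" for t
      by (rule LIMSEQ_Suc[OF vlim[OF E]])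
  qed
  then have int0: "(\<lambda>j. integral {0..1} (\<lambda>t. v j (E t))) \<longlonglongrightarrow> 0"
    unfolding integral_0 by (rule LIMSEQ_imp_Suc)
  have ee: "x * exp (- y) \<le> 1 \<longleftrightarrow> x \<le> exp y" for x y :: real
    by (simp add: exp_minus pos_divide_le_eq flip: divide_inverse)
  \<comment> \<open>Chosen so that Harnack's factor \<open>2 / (1 - r)\<close> turns the bound
    \<open>2 * \<epsilon>\<close> for \<open>Re H\<close> at \<open>0\<close> into exactly
    \<open>ln q\<close>.\<close>
  define \<epsilon> where "\<epsilon> = ln q * (1 - r) / 4"
  have eps: "\<epsilon> > 0" using r q by (simp add: \<epsilon>_def)
  have "\<forall>\<^sub>F j in sequentially. integral {0..1} (\<lambda>t. v j (E t)) < \<epsilon>"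
    using int0 eps by (rule order_tendstoD)
  then show ?thesis using eventually_gt_at_top[of 0]
  proof eventually_elim
    case (elim j)
    \<comment> \<open>Approximating \<open>v j + \<epsilon> / 2\<close> to within
      \<open>\<epsilon> / 2\<close> makes \<open>Re H\<close> a majorant of \<open>v j\<close> that
      exceeds it by at most \<open>\<epsilon>\<close>.\<close>
    have "continuous_on (sphere 0 1) (\<lambda>z. v j z + \<epsilon> / 2)" by (intro continuous_intros contv)
    then obtain H where H: "\<And>z. norm z = 1 \<Longrightarrow> \<bar>(v j z + \<epsilon> / 2) - Re (poly H z)\<bar> < \<epsilon> / 2"
      by (rule continuous_circle_approx[where e = "\<epsilon> / 2"]) (use eps in auto)
    have H1: "v j z \<le> Re (poly H z)" "Re (poly H z) \<le> v j z + \<epsilon>" if "norm z = 1" for z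
      using H[OF that] by linarith+
    have mean: "((\<lambda>t. Re (poly H (E t))) has_integral Re (poly H 0)) {0..1}"
      unfolding E_def by (rule Re_mean_circle[of _ 2]) (auto intro!: holomorphic_intros)
    have "((\<lambda>t. v j (E t) + \<epsilon>) has_integral (integral {0..1} (\<lambda>t. v j (E t)) + \<epsilon>)) {0..1}"
      using has_integral_add[OF integrable_integral[OF vint[of j]] has_integral_const_real[of \<epsilon> 0 1]] by simp
    then have "Re (poly H 0) \<le> integral {0..1} (\<lambda>t. v j (E t)) + \<epsilon>"
      by (rule has_integral_le[OF mean]) (use H1 E in auto)
    then have H0: "Re (poly H 0) \<le> 2 * \<epsilon>" using elim by simp
    show "\<forall>z. norm z \<le> r \<longrightarrow> norm (f j z) \<le> (c * q) ^ j"
    proof (intro allI impI)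
      fix a :: complex assume a: "norm a \<le> r"
      have "Re (poly H a) \<le> 2 / (1 - norm a) * Re (poly H 0)"
        using a r H1(1) v0[OF \<open>0 < j\<close>] by (intro Harnack_poly) (auto intro: order_trans)
      also have "\<dots> \<le> 2 / (1 - norm a) * (2 * \<epsilon>)"
        using H0 a r by (intro mult_left_mono) auto
      also have "\<dots> \<le> 2 / (1 - r) * (2 * \<epsilon>)"
        using a r eps by (intro mult_right_mono divide_left_mono) auto
      also have "\<dots> = ln q" using r by (simp add: \<epsilon>_def)
      finally have Ha: "Re (poly H a) \<le> ln q" .
      define G where "G z = f j z * exp (- of_nat j * (poly H z + of_real (ln c)))" for z
      have "norm (G a) \<le> 1"
      proof (rule maximum_modulus_frontier[of G "cball 0 1"])
        have sub: "cball 0 1 \<subseteq> ball (0::complex) R" using hol(2) by auto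
        show "G holomorphic_on interior (cball 0 1)" unfolding G_def
          by (intro holomorphic_intros holomorphic_on_subset[OF hol(1)[of j]]) (use sub in auto)
        show "continuous_on (closure (cball 0 1)) G" unfolding G_def
          by (intro continuous_intros continuous_on_subset[OF holomorphic_on_imp_continuous_on[OF hol(1)[of j]]])
            (use sub in auto)
        fix z :: complex assume "z \<in> frontier (cball 0 1)"
        then have z: "norm z = 1" by (simp add: frontier_cball)
        have "norm (f j z) \<le> max (norm (f j z)) (c ^ j)" by simp
        also have "\<dots> = exp (ln (max (norm (f j z)) (c ^ j)))" using cj by simp
        also have "ln (max (norm (f j z)) (c ^ j)) = real j * (v j z + ln c)"
          using \<open>0 < j\<close> by (simp add: v_def)
        also have "exp \<dots> \<le> exp (real j * (Re (poly H z) + ln c))"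
          using H1(1)[OF z] by (auto intro!: mult_left_mono)
        finally have "norm (f j z) * exp (- (real j * (Re (poly H z) + ln c))) \<le> 1"
          by (simp only: ee)
        then show "norm (G z) \<le> 1" by (simp add: G_def norm_mult)
      qed (use a r in auto)
      then have "norm (f j a) * exp (- (real j * (Re (poly H a) + ln c))) \<le> 1"
        by (simp add: G_def norm_mult)
      then have "norm (f j a) \<le> exp (real j * (Re (poly H a) + ln c))"
        by (simp only: ee)
      also have "\<dots> \<le> exp (real j * (ln q + ln c))" using Ha by (auto intro!: mult_left_mono)
      also have "\<dots> = (c * q) ^ j"
        using c(1) q by (simp add: exp_of_nat_mult exp_add mult.commute)
      finally show "norm (f j a) \<le> (c * q) ^ j" .
    qed
  qed
qed

lemma Hartogs_lemma:
  fixes f :: "nat \<Rightarrow> complex \<Rightarrow> complex"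
  assumes hol: "\<And>j. f j holomorphic_on ball a R" "0 < \<rho>" "\<rho> < R"
    and M: "\<And>j z. j > 0 \<Longrightarrow> dist a z = \<rho> \<Longrightarrow> norm (f j z) \<le> M ^ j" "M > 0"
    and c: "c > 0" "\<And>z. dist a z = \<rho> \<Longrightarrow> \<forall>\<^sub>F j in sequentially. norm (f j z) \<le> c ^ j"
    and r: "r < \<rho>" and q: "q > 1"
  shows "\<forall>\<^sub>F j in sequentially. \<forall>z. dist a z \<le> r \<longrightarrow> norm (f j z) \<le> (c * q) ^ j"
proof -
  define T where "T z = a + of_real \<rho> * z" for z :: complex
  have dT: "dist a (T z) = \<rho> * norm z" for z using hol(2) by (simp add: T_def dist_norm norm_mult)
  have "\<forall>\<^sub>F j in sequentially. \<forall>z. norm z \<le> r / \<rho> \<longrightarrow> norm ((f j \<circ> T) z) \<le> (c * q) ^ j"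
  proof (rule Hartogs_lemma_unit[where R = "R / \<rho>"])
    show "f j \<circ> T holomorphic_on ball 0 (R / \<rho>)" for j
    proof (rule holomorphic_on_compose_gen[OF _ hol(1)])
      show "T holomorphic_on ball 0 (R / \<rho>)" unfolding T_def by (intro holomorphic_intros)
      show "T ` ball 0 (R / \<rho>) \<subseteq> ball a R" using dT hol(2) by (auto simp: field_simps)
    qed
  qed (use M c r q hol dT in auto)
  then show ?thesis
  proof eventually_elim
    case (elim j)
    show ?case
    proof (intro allI impI)
      fix z assume z: "dist a z \<le> r"
      have "z = T ((z - a) / of_real \<rho>)" using hol(2) by (simp add: T_def)
      moreover have "norm ((z - a) / of_real \<rho>) \<le> r / \<rho>"
        using z hol(2) by (simp add: norm_divide dist_norm norm_minus_commute divide_right_mono)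
      ultimately show "norm (f j z) \<le> (c * q) ^ j" using elim by (metis comp_apply)
    qed
  qed
qed

text \<open>The \<open>j\<close>-th coefficient is the limit at \<open>0\<close> of the remainder
  after \<open>j\<close> terms divided by \<open>x ^ j\<close>. The rate depends only on the bounds
  for the coefficients, so it is uniform in any further parameter.\<close>

lemma power_series_remainder_bound:
  fixes e :: "nat \<Rightarrow> complex"
  assumes e: "\<And>i. norm (e i) \<le> B * L ^ i" "L > 0" "B \<ge> 0" and x: "x \<noteq> 0" "L * norm x \<le> 1 / 2"
    and s: "(\<lambda>i. e i * x ^ i) sums v"
  shows "norm ((v - (\<Sum>i<j. e i * x ^ i)) / x ^ j - e j) \<le> 2 * B * L ^ Suc j * norm x"
proof -
  have g: "summable (\<lambda>i. B * (L * norm x) ^ (i + Suc j))"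
    using x(2) e(2) by (intro summable_mult summable_ignore_initial_segment summable_geometric) auto
  have n: "norm (e i * x ^ i) \<le> B * (L * norm x) ^ i" for i
    using mult_right_mono[OF e(1)[of i], of "norm x ^ i"] by (simp add: norm_mult norm_power power_mult_distrib mult.assoc)
  have "v = (\<Sum>i. e (i + Suc j) * x ^ (i + Suc j)) + (\<Sum>i<Suc j. e i * x ^ i)"
    using suminf_split_initial_segment[OF sums_summable[OF s], of "Suc j"] sums_unique[OF s] by simp
  then have "v - (\<Sum>i<j. e i * x ^ i) - e j * x ^ j = (\<Sum>i. e (i + Suc j) * x ^ (i + Suc j))" by simp
  also have "norm \<dots> \<le> (\<Sum>i. B * (L * norm x) ^ (i + Suc j))"
    by (rule norm_suminf_le[OF n g])
  also have "\<dots> = B * (L * norm x) ^ Suc j * (\<Sum>i. (L * norm x) ^ i)"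
    using x(2) e(2) by (subst suminf_mult[symmetric]) (auto simp: power_add mult_ac intro!: summable_geometric)
  also have "(\<Sum>i. (L * norm x) ^ i) = 1 / (1 - L * norm x)"
    using x(2) e(2) by (intro suminf_geometric) auto
  also have "B * (L * norm x) ^ Suc j * (1 / (1 - L * norm x)) \<le> B * (L * norm x) ^ Suc j * 2"
    using x(2) e by (intro mult_left_mono) (auto simp: field_simps)
  finally have "norm (v - (\<Sum>i<j. e i * x ^ i) - e j * x ^ j) \<le> 2 * B * L ^ Suc j * norm x * norm x ^ j"
    by (simp add: power_mult_distrib mult_ac)
  moreover have "(v - (\<Sum>i<j. e i * x ^ i)) / x ^ j - e j = (v - (\<Sum>i<j. e i * x ^ i) - e j * x ^ j) / x ^ j"
    using x(1) by (simp add: field_simps)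
  ultimately show ?thesis using x(1) by (simp add: norm_divide norm_power pos_divide_le_eq)
qed

text \<open>Differentiating a Cauchy integral in \<open>w\<close> under the integral sign would call
  for joint regularity of \<open>f\<close>. Instead the coefficients are obtained by induction on
  \<open>j\<close> as uniform limits of expressions in the values \<open>f z w\<close> and earlier
  coefficients, each holomorphic in \<open>z\<close>.\<close>

lemma Taylor_coeff_holomorphic:
  fixes f :: "complex \<Rightarrow> complex \<Rightarrow> complex"
  assumes S: "open S" and z: "\<And>w. w \<in> ball b s \<Longrightarrow> (\<lambda>z. f z w) holomorphic_on S"
    and w: "\<And>z. z \<in> S \<Longrightarrow> f z holomorphic_on ball b s"
    and B: "\<And>z w. z \<in> S \<Longrightarrow> w \<in> ball b s \<Longrightarrow> norm (f z w) \<le> B" "s > 0" "B \<ge> 0"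
  shows "(\<lambda>z. (deriv ^^ j) (f z) b / fact j) holomorphic_on S"
    and "z \<in> S \<Longrightarrow> norm ((deriv ^^ j) (f z) b / fact j) \<le> B * (2 / s) ^ j"
proof -
  define e where "e j z = (deriv ^^ j) (f z) b / fact j" for j z
  have eb: "norm (e j z) \<le> B * (2 / s) ^ j" if "z \<in> S" for j z
  proof -
    have "norm ((deriv ^^ j) (f z) b) \<le> fact j * B / (s / 2) ^ j"
    proof (rule Cauchy_inequality)
      have sub: "cball b (s / 2) \<subseteq> ball b s" "ball b (s / 2) \<subseteq> ball b s" using B(2) by auto
      show "f z holomorphic_on ball b (s / 2)" using holomorphic_on_subset[OF w[OF that] sub(2)] .
      show "continuous_on (cball b (s / 2)) (f z)"
        using holomorphic_on_imp_continuous_on[OF w[OF that]] sub(1) by (rule continuous_on_subset)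
    qed (use B that in \<open>auto simp: dist_norm\<close>)
    then show ?thesis by (simp add: e_def norm_divide divide_le_eq power_divide mult_ac)
  qed
  have sums: "(\<lambda>i. e i z * (w - b) ^ i) sums f z w" if "z \<in> S" "w \<in> ball b s" for z w
    unfolding e_def using holomorphic_power_series[OF w[OF that(1)] that(2)] .
  have "e j holomorphic_on S" for j
  proof (induction j rule: less_induct)
    case (less j)
    \<comment> \<open>Small enough for \<open>b + x n\<close> to lie in the disc and for the ratio
      \<open>2 / s * norm (x n)\<close> to be at most \<open>1 / 2\<close>.\<close>
    define x :: "nat \<Rightarrow> complex" where "x n = of_real (s / 4 / real (Suc n))" for n
    have x: "x n \<noteq> 0" "norm (x n) = s / 4 / real (Suc n)" for n
      using B(2) by (auto simp: x_def norm_divide simp del: of_nat_Suc)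
    have xle: "norm (x n) \<le> s / 4" for n unfolding x(2) using B(2) by (simp add: divide_le_eq field_simps)
    have xb: "b + x n \<in> ball b s" for n using xle[of n] B(2) by (simp add: dist_norm)
    have xlim: "(\<lambda>n. norm (x n)) \<longlonglongrightarrow> 0"
      unfolding x(2) using LIMSEQ_Suc[OF lim_const_over_n[of "s/4"]] by simp
    define h where "h n z = (f z (b + x n) - (\<Sum>i<j. e i z * x n ^ i)) / x n ^ j" for n z
    have hb: "norm (h n z - e j z) \<le> 2 * B * (2 / s) ^ Suc j * norm (x n)" if "z \<in> S" for n z
      unfolding h_def
    proof (rule power_series_remainder_bound)
      show "2 / s * norm (x n) \<le> 1 / 2" using xle[of n] B(2) by (simp add: field_simps)
      show "(\<lambda>i. e i z * x n ^ i) sums f z (b + x n)" using sums[OF that xb[of n]] by simp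
    qed (use eb[OF that] x B in auto)
    have unif: "uniform_limit S h (e j) sequentially"
    proof (rule uniform_limitI)
      fix \<epsilon> :: real assume "\<epsilon> > 0"
      have "(\<lambda>n. 2 * B * (2 / s) ^ Suc j * norm (x n)) \<longlonglongrightarrow> 2 * B * (2 / s) ^ Suc j * 0"
        by (intro tendsto_intros xlim)
      then have "\<forall>\<^sub>F n in sequentially. 2 * B * (2 / s) ^ Suc j * norm (x n) < \<epsilon>"
        by (rule order_tendstoD(2)) (use \<open>\<epsilon> > 0\<close> in simp)
      then show "\<forall>\<^sub>F n in sequentially. \<forall>z\<in>S. dist (h n z) (e j z) < \<epsilon>"
        by eventually_elim (auto simp: dist_norm intro: le_less_trans[OF hb])
    qed
    show ?case
    proof (rule holomorphic_uniform_sequence[OF S])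
      show "h n holomorphic_on S" for n
      proof -
        have "(\<lambda>z. f z (b + x n)) holomorphic_on S" by (rule z[OF xb])
        moreover have "(\<lambda>z. \<Sum>i<j. e i z * x n ^ i) holomorphic_on S"
          by (intro holomorphic_on_sum holomorphic_on_mult holomorphic_on_const less) auto
        ultimately show ?thesis
          unfolding h_def using x(1) by (intro holomorphic_on_divide holomorphic_on_diff holomorphic_on_const) auto
      qed
      show "\<exists>d>0. cball x d \<subseteq> S \<and> uniform_limit (cball x d) h (e j) sequentially" if xS: "x \<in> S" for x
      proof -
        obtain d where "d > 0" "cball x d \<subseteq> S" using S xS open_contains_cball by blast
        then show ?thesis using uniform_limit_on_subset[OF unif] by blast
      qed
    qed
  qed
  then show "(\<lambda>z. (deriv ^^ j) (f z) b / fact j) holomorphic_on S" by (simp add: e_def[abs_def])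
  show "z \<in> S \<Longrightarrow> norm ((deriv ^^ j) (f z) b / fact j) \<le> B * (2 / s) ^ j"
    using eb by (simp add: e_def)
qed

text \<open>Baire's theorem gives a bound on a product with a small disc around some
  \<open>b1\<close> near \<open>b\<close>; this disc may miss \<open>b\<close>. For each fixed
  \<open>z\<close> the Taylor series in \<open>w\<close> around \<open>b1\<close> converges on a
  disc of radius \<open>R\<close>; Hartogs' lemma makes this uniform in \<open>z\<close>, so the
  bound reaches a neighbourhood of \<open>b\<close>.\<close>

lemma separately_holomorphic_locally_bounded:
  fixes f :: "complex \<Rightarrow> complex \<Rightarrow> complex"
  assumes S: "open S" "a \<in> S" and T: "open T" "b \<in> T"
    and z: "\<And>w. w \<in> T \<Longrightarrow> (\<lambda>z. f z w) holomorphic_on S"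
    and w: "\<And>z. z \<in> S \<Longrightarrow> f z holomorphic_on T"
  shows "\<exists>d>0. \<exists>C. \<forall>z\<in>ball a d. \<forall>w\<in>ball b d. norm (f z w) \<le> C"
proof -
  obtain R where R: "R > 0" "cball a R \<subseteq> S" "cball b (2 * R) \<subseteq> T"
  proof -
    obtain R1 R2 where "R1 > 0" "cball a R1 \<subseteq> S" "R2 > 0" "cball b R2 \<subseteq> T"
      using S T open_contains_cball by meson
    then show ?thesis by (intro that[of "min R1 (R2 / 2)"]) auto
  qed
  define D where "D = cball b (R / 4)"
  have DT: "D \<subseteq> T" using R by (auto simp: D_def)
  \<comment> \<open>For fixed \<open>w\<close> the values \<open>f z w\<close> are bounded on the
    compact disc of the \<open>z\<close>, so these closed sets cover \<open>D\<close>, and the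
    complement of one of them is not dense in \<open>D\<close>.\<close>
  define En where "En n = {w \<in> D. \<forall>z\<in>cball a R. norm (f z w) \<le> real n}" for n
  have closed_En: "closed (En n)" for n
  proof -
    have "closed (D \<inter> f z -` cball 0 (real n))" if "z \<in> cball a R" for z
      using that R DT
      by (intro continuous_closed_preimage continuous_on_subset[OF holomorphic_on_imp_continuous_on[OF w]])
        (auto simp: D_def)
    then have "closed (D \<inter> (\<Inter>z\<in>cball a R. D \<inter> f z -` cball 0 (real n)))"
      by (intro closed_Int closed_INT) (auto simp: D_def)
    also have "D \<inter> (\<Inter>z\<in>cball a R. D \<inter> f z -` cball 0 (real n)) = En n" by (auto simp: En_def)
    finally show ?thesis .
  qed
  have cover: "\<exists>n. w \<in> En n" if "w \<in> D" for w
  proof -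
    have "compact ((\<lambda>z. f z w) ` cball a R)"
      using that DT R holomorphic_on_imp_continuous_on[OF z, of w]
      by (intro compact_continuous_image) (auto intro: continuous_on_subset)
    then obtain C where "\<forall>z\<in>cball a R. norm (f z w) \<le> C"
      using compact_imp_bounded bounded_iff by (metis (no_types, lifting) image_eqI)
    moreover obtain n where "C \<le> real n" using real_arch_simple by blast
    ultimately show ?thesis using that by (fastforce simp: En_def intro: order_trans)
  qed
  obtain n where n: "\<not> D \<subseteq> closure (D - En n)"
  proof (rule ccontr)
    assume "\<not> thesis"
    then have dense: "D \<subseteq> closure (D - En n)" for n using that by blast
    have "D \<subseteq> closure (\<Inter>(range (\<lambda>n. D - En n)))"
    proof (rule Baire)
      show "openin (top_of_set D) X \<and> D \<subseteq> closure X" if "X \<in> range (\<lambda>n. D - En n)" for X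
        using that dense openin_open_Int[OF open_Compl[OF closed_En]] by (auto simp: Diff_eq)
    qed (auto simp: D_def)
    moreover have "\<Inter>(range (\<lambda>n. D - En n)) = {}" using cover by blast
    ultimately have "D \<subseteq> {}" by (metis closure_empty)
    then show False using R by (simp add: D_def)
  qed
  then obtain x where x0: "x \<in> D" "x \<notin> closure (D - En n)" by blast
  then obtain \<epsilon> where eps: "\<epsilon> > 0" "\<forall>y\<in>D - En n. \<not> dist y x < \<epsilon>"
    unfolding closure_approachable by blast
  have x: "y \<in> En n" if "y \<in> D" "dist y x < \<epsilon>" for y using eps(2) that by blast
  have "x \<in> closure (ball b (R / 4))" using x0 R by (simp add: D_def)
  then obtain b1 where b1: "b1 \<in> ball b (R / 4)" "dist b1 x < \<epsilon>"
    using eps(1) unfolding closure_approachable by blast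
  have "open (ball b (R / 4) \<inter> ball x \<epsilon>)" "b1 \<in> ball b (R / 4) \<inter> ball x \<epsilon>"
    using b1 by (auto simp: dist_commute)
  then obtain s where s: "s > 0" "ball b1 s \<subseteq> ball b (R / 4) \<inter> ball x \<epsilon>"
    unfolding open_contains_ball by blast
  have sEn: "w \<in> En n" if "w \<in> ball b1 s" for w
  proof (rule x)
    have "w \<in> ball b (R / 4) \<inter> ball x \<epsilon>" using that s by blast
    then show "w \<in> D" "dist w x < \<epsilon>" by (auto simp: D_def dist_commute)
  qed
  define e where "e j z = (deriv ^^ j) (f z) b1 / fact j" for j z
  have Rb1: "cball b1 R \<subseteq> T"
  proof
    fix w assume "w \<in> cball b1 R"
    then have "dist b w \<le> 2 * R" using b1(1) R dist_triangle[of b w b1] by auto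
    then show "w \<in> T" using R by auto
  qed
  have sD: "ball b1 s \<subseteq> D" using sEn by (auto simp: En_def)
  have Taylor: "e j holomorphic_on ball a R"
    "z \<in> ball a R \<Longrightarrow> norm (e j z) \<le> real n * (2 / s) ^ j" for j z
  proof -
    have 1: "(\<lambda>z. f z w) holomorphic_on ball a R" if "w \<in> ball b1 s" for w
      using z that sD DT R by (intro holomorphic_on_subset[OF z]) auto
    have 2: "f z holomorphic_on ball b1 s" if "z \<in> ball a R" for z
      using w that sD DT R by (intro holomorphic_on_subset[OF w]) auto
    have 3: "norm (f z w) \<le> real n" if "z \<in> ball a R" "w \<in> ball b1 s" for z w
      using sEn[OF that(2)] that(1) by (auto simp: En_def)
    show "e j holomorphic_on ball a R"
      unfolding e_def[abs_def] by (rule Taylor_coeff_holomorphic(1)[OF _ 1 2 3 s(1)]) auto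
    show "z \<in> ball a R \<Longrightarrow> norm (e j z) \<le> real n * (2 / s) ^ j"
      unfolding e_def by (rule Taylor_coeff_holomorphic(2)[OF _ 1 2 3 s(1)]) auto
  qed
  define M where "M = max 1 (real n) * (2 / s)"
  have M: "norm (e j z) \<le> M ^ j" if "j > 0" "dist a z = R / 2" for j z
  proof -
    have "real n \<le> max 1 (real n) ^ j"
      using self_le_power[of "max 1 (real n)" j] that by auto
    then have "real n * (2 / s) ^ j \<le> M ^ j"
      unfolding M_def power_mult_distrib using s(1) by (intro mult_right_mono) auto
    then show ?thesis using Taylor(2)[of z j] that R by auto
  qed
  \<comment> \<open>Cauchy's estimate gives \<open>C / R ^ j\<close> with a \<open>C\<close>
    depending on \<open>z\<close>; the slack factor \<open>3 / 2\<close> absorbs it for large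
    \<open>j\<close>, with no uniformity in \<open>z\<close> so far.\<close>
  have ev: "\<forall>\<^sub>F j in sequentially. norm (e j z) \<le> (3 / 2 / R) ^ j" if "dist a z = R / 2" for z
  proof -
    have zS: "z \<in> S" using that R by auto
    have "compact (f z ` cball b1 R)"
      using Rb1 holomorphic_on_imp_continuous_on[OF w[OF zS]]
      by (intro compact_continuous_image) (auto intro: continuous_on_subset)
    then obtain C where C: "\<forall>w\<in>cball b1 R. norm (f z w) \<le> C"
      using compact_imp_bounded bounded_iff by (metis (no_types, lifting) image_eqI)
    have Cb: "norm (e j z) \<le> C / R ^ j" for j
    proof -
      have "norm ((deriv ^^ j) (f z) b1) \<le> fact j * C / R ^ j"
      proof (rule Cauchy_inequality)
        show "f z holomorphic_on ball b1 R" using holomorphic_on_subset[OF w[OF zS]] Rb1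
          by (meson ball_subset_cball order_trans)
        show "continuous_on (cball b1 R) (f z)"
          using holomorphic_on_imp_continuous_on[OF w[OF zS]] Rb1 by (rule continuous_on_subset)
        show "norm (f z x) \<le> C" if "norm (b1 - x) = R" for x using C that by (auto simp: dist_norm)
      qed (use R in auto)
      then show ?thesis by (simp add: e_def norm_divide divide_le_eq mult.commute)
    qed
    have "\<forall>\<^sub>F j in sequentially. C \<le> (3 / 2) ^ j"
    proof -
      obtain N where N: "C < (3 / 2) ^ N" using real_arch_pow[of "3 / 2" C] by auto
      have "C \<le> (3 / 2) ^ j" if "j \<ge> N" for j
        by (rule less_imp_le[OF less_le_trans[OF N power_increasing[OF that]]]) simp
      then show ?thesis by (auto simp: eventually_sequentially)
    qed
    then show ?thesis
    proof eventually_elim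
      case (elim j)
      then show ?case
        using Cb[of j] divide_right_mono[OF elim, of "R ^ j"] R by (simp add: power_divide)
    qed
  qed
  \<comment> \<open>With \<open>q = 4 / 3\<close> the rate \<open>3 / 2 / R\<close> becomes
    \<open>2 / R\<close>, now uniformly on the smaller disc.\<close>
  have "\<forall>\<^sub>F j in sequentially. \<forall>z. dist a z \<le> R / 4 \<longrightarrow> norm (e j z) \<le> (3 / 2 / R * (4 / 3)) ^ j"
    by (rule Hartogs_lemma[where R = R and \<rho> = "R / 2" and M = M])
      (use Taylor M ev R s in \<open>auto simp: M_def\<close>)
  then obtain J where J: "\<And>j z. j \<ge> J \<Longrightarrow> dist a z \<le> R / 4 \<Longrightarrow> norm (e j z) \<le> (2 / R) ^ j"
    by (auto simp: eventually_sequentially)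
  define K where "K = 1 + (\<Sum>j<J. real n * (2 / s) ^ j / (2 / R) ^ j)"
  have K1: "K \<ge> 1" unfolding K_def using R s by (simp add: sum_nonneg)
  have K: "norm (e j z) \<le> K * (2 / R) ^ j" if "dist a z \<le> R / 4" for j z
  proof (cases "j < J")
    case True
    have "real n * (2 / s) ^ j / (2 / R) ^ j \<le> (\<Sum>j<J. real n * (2 / s) ^ j / (2 / R) ^ j)"
      using True R s by (intro member_le_sum) auto
    then have "real n * (2 / s) ^ j / (2 / R) ^ j \<le> K" by (simp add: K_def)
    then have "real n * (2 / s) ^ j \<le> K * (2 / R) ^ j" using R by (subst (asm) pos_divide_le_eq) auto
    then show ?thesis using Taylor(2)[of z j] that R by auto
  next
    case False
    have "(2 / R) ^ j \<le> K * (2 / R) ^ j" using mult_right_mono[OF K1, of "(2 / R) ^ j"] R by simp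
    then show ?thesis using J[of j z] that False by force
  qed
  \<comment> \<open>Here \<open>norm (w - b1)\<close> is at most
    \<open>R / 12 + R / 4 = R / 3\<close>, so the series is dominated by \<open>K\<close> times a
    geometric one of ratio \<open>2 / 3\<close>, whose sum is \<open>3\<close>.\<close>
  have "norm (f z w) \<le> K * 3" if zw: "z \<in> ball a (R / 12)" "w \<in> ball b (R / 12)" for z w
  proof -
    have zS: "z \<in> S" using zw R by auto
    have wb: "norm (w - b1) \<le> R / 3"
      using zw(2) b1(1) dist_triangle[of w b1 b] by (simp add: dist_norm norm_minus_commute)
    have s1: "(\<lambda>j. e j z * (w - b1) ^ j) sums f z w"
      unfolding e_def
    proof (rule holomorphic_power_series)
      show "f z holomorphic_on ball b1 R"
        using w[OF zS] by (rule holomorphic_on_subset) (use Rb1 in auto)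
      show "w \<in> ball b1 R" using wb R by (simp add: dist_norm norm_minus_commute)
    qed
    have s2: "(\<lambda>j. K * (2 / 3) ^ j) sums (K * (1 / (1 - 2 / 3)))"
      by (intro sums_mult geometric_sums) auto
    have le: "norm (e j z * (w - b1) ^ j) \<le> K * (2 / 3) ^ j" for j
    proof -
      have "norm (e j z * (w - b1) ^ j) \<le> K * (2 / R) ^ j * (R / 3) ^ j"
        unfolding norm_mult norm_power
        by (intro mult_mono K power_mono wb) (use zw K1 R in auto)
      also have "\<dots> = K * (2 / 3) ^ j" using R by (simp flip: power_mult_distrib mult.assoc add: mult.assoc)
      finally show ?thesis .
    qed
    have "norm (f z w) \<le> K * (1 / (1 - 2 / 3))"
      using norm_suminf_le[OF le sums_summable[OF s2]]
      unfolding sums_unique[OF s1, symmetric] sums_unique[OF s2, symmetric] .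
    then show ?thesis by simp
  qed
  then have "\<forall>z\<in>ball a (R / 12). \<forall>w\<in>ball b (R / 12). norm (f z w) \<le> K * 3" by blast
  then show ?thesis using R by (intro exI[of _ "R / 12"] conjI exI[of _ "K * 3"]) auto
qed

subsection \<open>Compactly supported distributions\<close>

lemma smooth_on_pdiff_bounded:
  assumes "smooth_on S u" "compact K" "K \<subseteq> S"
  shows "\<exists>M\<ge>0. \<forall>a\<le>n. \<forall>b\<le>n. \<forall>z\<in>K. norm (pdiff a b u z) \<le> M"
proof -
  have "\<exists>M\<ge>0. \<forall>z\<in>K. norm (pdiff a b u z) \<le> M" for a b
  proof -
    have "continuous_on K (pdiff a b u)"
      using ck_continuous_on[OF smooth_on_imp_ck[OF assms(1), of a b]] assms(3)
      by (meson continuous_on_subset order_refl)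
    then have "bounded (pdiff a b u ` K)" using assms(2) compact_continuous_image compact_imp_bounded by blast
    then obtain M where "\<forall>x\<in>pdiff a b u ` K. norm x \<le> M" unfolding bounded_iff by blast
    then show ?thesis by (intro exI[of _ "max M 0"]) auto
  qed
  then obtain M where M: "\<And>a b. M a b \<ge> 0" "\<And>a b z. z \<in> K \<Longrightarrow> norm (pdiff a b u z) \<le> M a b"
    by metis
  have "M a b \<le> (\<Sum>a\<le>n. \<Sum>b\<le>n. M a b)" if "a \<le> n" "b \<le> n" for a b
  proof -
    have "M a b \<le> (\<Sum>b\<le>n. M a b)" using that M by (intro member_le_sum) auto
    also have "\<dots> \<le> (\<Sum>a\<le>n. \<Sum>b\<le>n. M a b)"
      using that M by (intro member_le_sum[where f = "\<lambda>a. \<Sum>b\<le>n. M a b"]) (auto intro: sum_nonneg)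
    finally show ?thesis .
  qed
  then have "norm (pdiff a b u z) \<le> (\<Sum>a\<le>n. \<Sum>b\<le>n. M a b)" if "a \<le> n" "b \<le> n" "z \<in> K" for a b z
    using M(2)[of z a b] that by (meson order_trans)
  moreover have "(\<Sum>a\<le>n. \<Sum>b\<le>n. M a b) \<ge> 0" using M(1) by (intro sum_nonneg)
  ultimately show ?thesis by blast
qed

text \<open>The seminorm estimate is opened once for the whole argument. \<open>N\<close> says how
  many derivatives in each direction have to be controlled, hence the finite order of all quotients
  and cutoffs below; a nonnegative constant is obtained from any other by taking its absolute
  value.\<close>

locale compact_dist =
  fixes \<Omega> :: "complex set" and F :: "(complex \<Rightarrow> complex) \<Rightarrow> complex"
    and K :: "complex set" and N :: nat and C :: real
  assumes open_dom: "open \<Omega>"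
    and add: "smooth_on \<Omega> \<phi> \<Longrightarrow> smooth_on \<Omega> \<psi> \<Longrightarrow> F (\<lambda>z. \<phi> z + \<psi> z) = F \<phi> + F \<psi>"
    and scale: "smooth_on \<Omega> \<phi> \<Longrightarrow> F (\<lambda>z. c * \<phi> z) = c * F \<phi>"
    and compact_K: "compact K" and K_subset: "K \<subseteq> \<Omega>" and C_nonneg: "C \<ge> 0"
    and bound: "smooth_on \<Omega> \<phi> \<Longrightarrow> M \<ge> 0 \<Longrightarrow>
      (\<And>a b z. a \<le> N \<Longrightarrow> b \<le> N \<Longrightarrow> z \<in> K \<Longrightarrow> norm (pdiff a b \<phi> z) \<le> M) \<Longrightarrow> norm (F \<phi>) \<le> C * M"

lemma compact_distribution_imp_compact_dist:
  assumes "open \<Omega>" "compact_distribution \<Omega> F"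
  shows "\<exists>K N C. compact_dist \<Omega> F K N C"
proof -
  obtain K N C where K: "compact K" "K \<subseteq> \<Omega>" and b: "\<And>\<phi> M. smooth_on \<Omega> \<phi> \<Longrightarrow>
      (\<forall>a\<le>N. \<forall>b\<le>N. \<forall>z\<in>K. norm (pdiff a b \<phi> z) \<le> M) \<Longrightarrow> norm (F \<phi>) \<le> C * M"
    using assms(2) unfolding compact_distribution_def by blast
  have "compact_dist \<Omega> F K N \<bar>C\<bar>"
  proof
    show "norm (F \<phi>) \<le> \<bar>C\<bar> * M"
      if "smooth_on \<Omega> \<phi>" "M \<ge> 0" "\<And>a b z. a \<le> N \<Longrightarrow> b \<le> N \<Longrightarrow> z \<in> K \<Longrightarrow> norm (pdiff a b \<phi> z) \<le> M" for \<phi> M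
    proof -
      have "norm (F \<phi>) \<le> C * M" using b that by blast
      also have "\<dots> \<le> \<bar>C\<bar> * M" using that(2) by (intro mult_right_mono) auto
      finally show ?thesis .
    qed
  qed (use assms K in \<open>auto simp: compact_distribution_def\<close>)
  then show ?thesis by blast
qed

context compact_dist
begin

lemma minus:
  assumes "smooth_on \<Omega> \<phi>" "smooth_on \<Omega> \<psi>"
  shows "F (\<lambda>z. \<phi> z - \<psi> z) = F \<phi> - F \<psi>"
  using add[OF assms(1) smooth_on_cmult[OF open_dom assms(2)], of "-1"] scale[OF assms(2), of "-1"] by simp

lemma F_zero: "F (\<lambda>z. 0) = 0"
  using scale[OF smooth_on_const[OF open_dom, of 0], of 0] by simp

text \<open>Test functions are total functions; the estimate with \<open>M = 0\<close> shows that
  their values outside \<open>\<Omega>\<close> have no influence.\<close>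

lemma cong:
  assumes "smooth_on \<Omega> \<phi>" "\<And>z. z \<in> \<Omega> \<Longrightarrow> \<phi> z = \<psi> z"
  shows "F \<phi> = F \<psi>"
proof -
  have s: "smooth_on \<Omega> \<psi>" using smooth_on_cong[OF open_dom assms(2,1)] by blast
  have "norm (F (\<lambda>z. \<phi> z - \<psi> z)) \<le> C * 0"
  proof (rule bound)
    fix a b z assume "z \<in> K"
    then have "z \<in> \<Omega>" using K_subset by blast
    then have "pdiff a b (\<lambda>z. \<phi> z - \<psi> z) z = pdiff a b (\<lambda>z. 0 * \<psi> z) z"
      using assms(2) by (intro pdiff_cong[OF open_dom]) auto
    also have "\<dots> = 0"
      using pdiff_cmult[OF open_dom smooth_on_imp_ck[OF s] \<open>z \<in> \<Omega>\<close>, of a b 0] by simp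
    finally show "norm (pdiff a b (\<lambda>z. \<phi> z - \<psi> z) z) \<le> 0" by simp
  qed (use assms s smooth_on_minus open_dom in auto)
  then show ?thesis using minus[OF assms(1) s] by simp
qed

lemma sum:
  assumes "\<And>i. i \<in> I \<Longrightarrow> smooth_on \<Omega> (f i)"
  shows "F (\<lambda>z. \<Sum>i\<in>I. f i z) = (\<Sum>i\<in>I. F (f i))"
  using assms
proof (induction I rule: infinite_finite_induct)
  case (insert x I)
  then show ?case using add[of "f x" "\<lambda>z. \<Sum>i\<in>I. f i z"] smooth_on_sum[OF open_dom, of I f] by simp
qed (auto simp: F_zero)

text \<open>Cauchy's estimates on discs around the points of \<open>K\<close> turn a sup norm on
  \<open>K'\<close> into bounds for derivatives on \<open>K\<close>. So uniform convergence of
  holomorphic factors on \<open>K'\<close>, one and the same set for all \<open>u\<close>, passes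
  through \<open>F\<close>.\<close>

lemma holomorphic_factor_bound:
  obtains K' where "compact K'" "K' \<subseteq> \<Omega>"
    "\<And>u. smooth_on \<Omega> u \<Longrightarrow> \<exists>C'\<ge>0. \<forall>f e. f holomorphic_on \<Omega> \<longrightarrow> e \<ge> 0 \<longrightarrow> (\<forall>z\<in>K'. norm (f z) \<le> e) \<longrightarrow>
      norm (F (\<lambda>z. u z * f z)) \<le> C' * e \<and> norm (F (\<lambda>z. u z * cnj (f z))) \<le> C' * e"
proof -
  obtain \<delta> where \<delta>: "\<delta> > 0" "(\<Union>x\<in>K. cball x \<delta>) \<subseteq> \<Omega>"
    using compact_subset_open_imp_cball_epsilon_subset[OF compact_K open_dom K_subset] .
  define K' where "K' = (\<Union>x\<in>K. cball x \<delta>)"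
  have "K' = (\<lambda>(x, y). x + y) ` (K \<times> cball 0 \<delta>)"
  proof
    show "K' \<subseteq> (\<lambda>(x, y). x + y) ` (K \<times> cball 0 \<delta>)"
    proof
      fix y assume "y \<in> K'"
      then obtain x where "x \<in> K" "dist x y \<le> \<delta>" by (auto simp: K'_def)
      then show "y \<in> (\<lambda>(x, y). x + y) ` (K \<times> cball 0 \<delta>)"
        by (intro image_eqI[of _ _ "(x, y - x)"]) (auto simp: dist_norm norm_minus_commute)
    qed
  qed (auto simp: K'_def dist_norm)
  moreover have "compact ((\<lambda>(x, y). x + y) ` (K \<times> cball (0::complex) \<delta>))"
    by (intro compact_continuous_image compact_Times compact_K compact_cball)
      (auto simp: case_prod_unfold intro!: continuous_intros)
  ultimately have cK': "compact K'" by simp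
  \<comment> \<open>Orders up to \<open>2 * N\<close> occur, since \<open>pdiff a b\<close> of a
    holomorphic function is a derivative of order \<open>a + b\<close>.\<close>
  define D where "D = (\<Sum>j\<le>2 * N. fact j / \<delta> ^ j :: real)"
  have D0: "D \<ge> 0" unfolding D_def using \<delta> by (intro sum_nonneg) auto
  have der: "norm ((deriv ^^ j) f z) \<le> D * e"
    if f: "f holomorphic_on \<Omega>" "e \<ge> 0" "\<forall>z\<in>K'. norm (f z) \<le> e" and z: "z \<in> K" "j \<le> 2 * N" for f e z j
  proof -
    have sub: "cball z \<delta> \<subseteq> \<Omega>" using \<delta> z by blast
    have "norm ((deriv ^^ j) f z) \<le> fact j * e / \<delta> ^ j"
    proof (rule Cauchy_inequality)
      show "f holomorphic_on ball z \<delta>" using f(1) by (rule holomorphic_on_subset) (use sub in auto)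
      show "continuous_on (cball z \<delta>) f"
        using holomorphic_on_imp_continuous_on[OF f(1)] sub by (rule continuous_on_subset)
      show "norm (f x) \<le> e" if "norm (z - x) = \<delta>" for x
        using f(3) z(1) that by (auto simp: K'_def dist_norm)
    qed (use \<delta> in auto)
    also have "\<dots> = (fact j / \<delta> ^ j) * e" by simp
    also have "\<dots> \<le> D * e"
      unfolding D_def using \<delta> z(2) f(2) by (intro mult_right_mono member_le_sum) auto
    finally show ?thesis .
  qed
  have "\<exists>C'\<ge>0. \<forall>f e. f holomorphic_on \<Omega> \<longrightarrow> e \<ge> 0 \<longrightarrow> (\<forall>z\<in>K'. norm (f z) \<le> e) \<longrightarrow>
      norm (F (\<lambda>z. u z * f z)) \<le> C' * e \<and> norm (F (\<lambda>z. u z * cnj (f z))) \<le> C' * e"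
    if u: "smooth_on \<Omega> u" for u
  proof -
    obtain M where M: "M \<ge> 0" "\<forall>a\<le>N. \<forall>b\<le>N. \<forall>z\<in>K. norm (pdiff a b u z) \<le> M"
      using smooth_on_pdiff_bounded[OF u compact_K K_subset] by blast
    have main: "norm (F (\<lambda>z. u z * g z)) \<le> C * (2 ^ (2 * N) * M * D) * e"
      if g: "smooth_on \<Omega> g" and e: "e \<ge> 0"
        and gb: "\<And>a b z. a \<le> N \<Longrightarrow> b \<le> N \<Longrightarrow> z \<in> K \<Longrightarrow> norm (pdiff a b g z) \<le> D * e" for g e
    proof -
      have "norm (F (\<lambda>z. u z * g z)) \<le> C * (2 ^ (2 * N) * M * (D * e))"
      proof (rule bound)
        fix a b z assume ab: "a \<le> N" "b \<le> N" "z \<in> K"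
        have "norm (pdiff a b (\<lambda>z. u z * g z) z) \<le> 2 ^ (a + b) * M * (D * e)"
          using ab K_subset M gb
          by (intro pdiff_mult_bound[OF open_dom] smooth_on_imp_ck u g) auto
        also have "\<dots> \<le> 2 ^ (2 * N) * M * (D * e)"
          using ab M D0 e by (intro mult_right_mono power_increasing) auto
        finally show "norm (pdiff a b (\<lambda>z. u z * g z) z) \<le> 2 ^ (2 * N) * M * (D * e)" .
      qed (use smooth_on_mult[OF open_dom u g] M D0 e in auto)
      then show ?thesis by (simp add: mult_ac)
    qed
    show ?thesis
    proof (intro exI[of _ "C * (2 ^ (2 * N) * M * D)"] conjI allI impI)
      show "0 \<le> C * (2 ^ (2 * N) * M * D)" using C_nonneg M D0 by simp
      fix f e assume f: "f holomorphic_on \<Omega>" "0 \<le> (e::real)" "\<forall>z\<in>K'. norm (f z) \<le> e"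
      show "norm (F (\<lambda>z. u z * f z)) \<le> C * (2 ^ (2 * N) * M * D) * e"
        using pdiff_holomorphic[OF open_dom f(1), of _ _ _ 1] K_subset der[OF f]
        by (intro main smooth_on_holomorphic open_dom f) (auto simp: norm_mult norm_power)
      show "norm (F (\<lambda>z. u z * cnj (f z))) \<le> C * (2 ^ (2 * N) * M * D) * e"
        using pdiff_cnj_holomorphic[OF open_dom f(1), of _ _ _ 1] K_subset der[OF f]
        by (intro main smooth_on_cnj_holomorphic open_dom f) (auto simp: norm_mult norm_power)
    qed
  qed
  then show ?thesis using cK' \<delta> by (intro that[of K']) (auto simp: K'_def)
qed

end

subsection \<open>The reproducing kernel\<close>

locale kernel_space =
  fixes \<Omega> :: "complex set" and \<tau> :: "complex measure" and P :: "complex \<Rightarrow> complex \<Rightarrow> complex"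
  assumes open_dom: "open \<Omega>"
    and meas: "sets \<tau> = sets (restrict_space borel \<Omega>)"
    and kernel: "reproducing_kernel \<Omega> \<tau> P"
begin

abbreviation "A \<equiv> analytic_L2 \<Omega> \<tau>"

lemma A_measurable:
  assumes "u \<in> A" shows "u \<in> borel_measurable \<tau>"
proof -
  have "continuous_on \<Omega> u" using assms by (auto simp: analytic_L2_def holomorphic_on_imp_continuous_on)
  then have "u \<in> borel_measurable (restrict_space borel \<Omega>)" by (rule borel_measurable_continuous_on_restrict)
  then show ?thesis using measurable_cong_sets[OF meas refl] by blast
qed

lemma A_square_integrable:
  assumes "u \<in> A" shows "integrable \<tau> (\<lambda>w. (norm (u w))\<^sup>2)"
proof (rule integrableI_bounded)
  show "(\<lambda>w. (norm (u w))\<^sup>2) \<in> borel_measurable \<tau>" using A_measurable[OF assms] by measurable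
  show "(\<integral>\<^sup>+ w. ennreal (norm ((norm (u w))\<^sup>2)) \<partial>\<tau>) < \<infinity>" using assms by (simp add: analytic_L2_def)
qed

lemma A_I:
  assumes "u holomorphic_on \<Omega>" "integrable \<tau> (\<lambda>w. (norm (u w))\<^sup>2)"
  shows "u \<in> A"
  using assms integrable_iff_bounded[of \<tau> "\<lambda>w. (norm (u w))\<^sup>2"] by (simp add: analytic_L2_def)

lemma A_add:
  assumes "u \<in> A" "v \<in> A" shows "(\<lambda>w. u w + v w) \<in> A"
proof (rule A_I)
  show "(\<lambda>w. u w + v w) holomorphic_on \<Omega>"
    using assms by (auto simp: analytic_L2_def intro: holomorphic_intros)
  have "integrable \<tau> (\<lambda>w. 2 * (norm (u w))\<^sup>2 + 2 * (norm (v w))\<^sup>2)"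
    using A_square_integrable assms by (intro Bochner_Integration.integrable_add) auto
  then show "integrable \<tau> (\<lambda>w. (norm (u w + v w))\<^sup>2)"
  proof (rule Bochner_Integration.integrable_bound)
    show "(\<lambda>w. (norm (u w + v w))\<^sup>2) \<in> borel_measurable \<tau>"
      using A_measurable[OF assms(1)] A_measurable[OF assms(2)] by measurable
    have "(norm (x + y))\<^sup>2 \<le> 2 * (norm x)\<^sup>2 + 2 * (norm y)\<^sup>2" for x y :: complex
    proof -
      have "(norm (x + y))\<^sup>2 \<le> (norm x + norm y)\<^sup>2" by (intro power_mono norm_triangle_ineq) auto
      also have "\<dots> \<le> 2 * (norm x)\<^sup>2 + 2 * (norm y)\<^sup>2"
        using sum_squares_bound[of "norm x" "norm y"] by (simp add: power2_sum)
      finally show ?thesis .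
    qed
    then show "AE w in \<tau>. norm ((norm (u w + v w))\<^sup>2) \<le> norm (2 * (norm (u w))\<^sup>2 + 2 * (norm (v w))\<^sup>2)"
      by (intro AE_I2) (simp add: add_nonneg_nonneg)
  qed
qed

lemma A_cmult:
  assumes "u \<in> A" shows "(\<lambda>w. c * u w) \<in> A"
  using assms A_square_integrable[OF assms]
  by (intro A_I) (auto simp: analytic_L2_def norm_mult power_mult_distrib intro: holomorphic_intros)

lemma A_minus:
  assumes "u \<in> A" "v \<in> A" shows "(\<lambda>w. u w - v w) \<in> A"
  using A_add[OF assms(1) A_cmult[OF assms(2), of "-1"]] by simp

lemma kernel_in_A: "z \<in> \<Omega> \<Longrightarrow> (\<lambda>w. cnj (P z w)) \<in> A"
  using kernel by (auto simp: reproducing_kernel_def)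

lemma reproducing:
  assumes "u \<in> A" "z \<in> \<Omega>"
  shows "integrable \<tau> (\<lambda>w. P z w * u w)" "(\<integral> w. P z w * u w \<partial>\<tau>) = u z"
  using kernel assms by (auto simp: reproducing_kernel_def)

lemma kernel_hermitian:
  assumes "z \<in> \<Omega>" "w \<in> \<Omega>" shows "P z w = cnj (P w z)"
proof -
  have "cnj (P z w) = (\<integral> v. P w v * cnj (P z v) \<partial>\<tau>)"
    using reproducing(2)[OF kernel_in_A[OF assms(1)] assms(2)] by simp
  moreover have "cnj (P w z) = (\<integral> v. P z v * cnj (P w v) \<partial>\<tau>)"
    using reproducing(2)[OF kernel_in_A[OF assms(2)] assms(1)] by simp
  moreover have "(\<integral> v. P z v * cnj (P w v) \<partial>\<tau>) = cnj (\<integral> v. P w v * cnj (P z v) \<partial>\<tau>)"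
    by (subst Bochner_Integration.integral_cnj[symmetric]) (simp add: mult.commute)
  ultimately show ?thesis by (metis complex_cnj_cnj)
qed

text \<open>Hermitian symmetry makes \<open>P z (cnj w)\<close> holomorphic in \<open>z\<close> as
  well as in \<open>w\<close>, and Hartogs' theorem bounds it locally. As \<open>P z z\<close> is
  the squared norm of evaluation at \<open>z\<close>, this is local uniform boundedness of the
  evaluations.\<close>

lemma kernel_diagonal_locally_bounded:
  assumes "a \<in> \<Omega>"
  shows "\<exists>d>0. \<exists>B. \<forall>z\<in>ball a d. norm (P z z) \<le> B"
proof -
  define f where "f z w = P z (cnj w)" for z w
  have hol: "(\<lambda>w. cnj (P z w)) holomorphic_on \<Omega>" if "z \<in> \<Omega>" for z
    using kernel_in_A[OF that] by (simp add: analytic_L2_def)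
  have "cnj ` \<Omega> = cnj -` \<Omega>" by (auto simp: image_iff) (metis complex_cnj_cnj)
  then have open_cnj: "open (cnj ` \<Omega>)" using open_dom by (auto intro!: open_vimage continuous_intros)
  have "\<exists>d>0. \<exists>B. \<forall>z\<in>ball a d. \<forall>w\<in>ball (cnj a) d. norm (f z w) \<le> B"
  proof (rule separately_holomorphic_locally_bounded[OF open_dom assms])
    show "open (cnj ` \<Omega>)" by (rule open_cnj)
    show "cnj a \<in> cnj ` \<Omega>" using assms by auto
    show "f z holomorphic_on cnj ` \<Omega>" if "z \<in> \<Omega>" for z
    proof -
      have "cnj \<circ> (\<lambda>w. cnj (P z w)) \<circ> cnj holomorphic_on cnj ` \<Omega>"
        using hol[OF that] open_cnj by (intro holomorphic_on_compose_cnj_cnj) (auto simp: image_image)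
      then show ?thesis by (simp add: o_def f_def[abs_def])
    qed
    show "(\<lambda>z. f z w) holomorphic_on \<Omega>" if "w \<in> cnj ` \<Omega>" for w
    proof -
      have w: "cnj w \<in> \<Omega>" using that by auto
      show ?thesis
        using hol[OF w] by (rule holomorphic_transform) (simp add: f_def kernel_hermitian[OF _ w])
    qed
  qed
  then obtain d B where "d > 0" and B: "\<And>z w. z \<in> ball a d \<Longrightarrow> w \<in> ball (cnj a) d \<Longrightarrow> norm (f z w) \<le> B"
    by metis
  moreover have "cnj z \<in> ball (cnj a) d" if "z \<in> ball a d" for z
    using that by (metis complex_cnj_diff complex_mod_cnj dist_norm mem_ball)
  ultimately show ?thesis unfolding f_def by (metis complex_cnj_cnj)
qed

lemma kernel_diagonal_bounded:
  assumes "compact K" "K \<subseteq> \<Omega>"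
  obtains B where "B > 0" "\<And>z. z \<in> K \<Longrightarrow> norm (P z z) \<le> B"
proof -
  have "\<forall>a\<in>K. \<exists>d B. d > 0 \<and> (\<forall>z\<in>ball a d. norm (P z z) \<le> B)"
    using kernel_diagonal_locally_bounded assms(2) by (meson subsetD)
  then obtain d B where dB: "\<And>a. a \<in> K \<Longrightarrow> d a > 0" "\<And>a z. a \<in> K \<Longrightarrow> z \<in> ball a (d a) \<Longrightarrow> norm (P z z) \<le> B a"
    by metis
  have "K \<subseteq> (\<Union>a\<in>K. ball a (d a))" using dB(1) by force
  then obtain T where T: "T \<subseteq> K" "finite T" "K \<subseteq> (\<Union>a\<in>T. ball a (d a))"
    using compactE_image[OF assms(1), of K "\<lambda>a. ball a (d a)"] by auto
  have "norm (P z z) \<le> 1 + (\<Sum>a\<in>T. \<bar>B a\<bar>)" if z: "z \<in> K" for z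
  proof -
    obtain a where a: "a \<in> T" "z \<in> ball a (d a)" using T z by blast
    have "norm (P z z) \<le> \<bar>B a\<bar>" using dB(2)[of a z] a T by force
    also have "\<dots> \<le> (\<Sum>a\<in>T. \<bar>B a\<bar>)" using a T by (intro member_le_sum) auto
    finally show ?thesis by simp
  qed
  then show ?thesis by (intro that[of "1 + (\<Sum>a\<in>T. \<bar>B a\<bar>)"]) (auto simp: add_pos_nonneg sum_nonneg)
qed

text \<open>The span of the kernel functions, built by adding one multiple at a time: minimality of
  a distance is tested against a single such step, and linearity of \<open>F\<close> is applied to
  it.\<close>

inductive_set kspan :: "(complex \<Rightarrow> complex) set" where
  zero: "(\<lambda>w. 0) \<in> kspan"
| step: "s \<in> kspan \<Longrightarrow> z \<in> \<Omega> \<Longrightarrow> (\<lambda>w. s w + c * cnj (P z w)) \<in> kspan"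

lemma kspan_in_A: "s \<in> kspan \<Longrightarrow> s \<in> A"
proof (induction rule: kspan.induct)
  case zero
  show ?case by (rule A_I) auto
next
  case (step s z c)
  then show ?case using A_add[OF _ A_cmult[OF kernel_in_A]] by simp
qed

text \<open>When the square is expanded, the reproducing property evaluates the cross term to
  \<open>g z\<close> and the last term to \<open>P z z\<close>.\<close>

lemma norm_sub_kernel:
  assumes "g \<in> A" "z \<in> \<Omega>"
  shows "(\<integral> w. (norm (g w - t * cnj (P z w)))\<^sup>2 \<partial>\<tau>)
    = (\<integral> w. (norm (g w))\<^sup>2 \<partial>\<tau>) - 2 * Re (cnj t * g z) + (norm t)\<^sup>2 * Re (P z z)"
proof -
  have eq: "(norm (x - t * cnj p))\<^sup>2 = (norm x)\<^sup>2 - 2 * Re (cnj t * (p * x)) + (norm t)\<^sup>2 * Re (p * cnj p)" for x p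
    unfolding cmod_power2 by (simp add: power2_eq_square algebra_simps)
  have i1: "integrable \<tau> (\<lambda>w. (norm (g w))\<^sup>2)" using A_square_integrable assms by auto
  have i2: "integrable \<tau> (\<lambda>w. P z w * g w)" using reproducing assms by auto
  have i3: "integrable \<tau> (\<lambda>w. P z w * cnj (P z w))" using reproducing(1)[OF kernel_in_A] assms by auto
  have "(\<integral> w. (norm (g w - t * cnj (P z w)))\<^sup>2 \<partial>\<tau>)
    = (\<integral> w. (norm (g w))\<^sup>2 \<partial>\<tau>) - 2 * Re (cnj t * (\<integral> w. P z w * g w \<partial>\<tau>))
      + (norm t)\<^sup>2 * Re (\<integral> w. P z w * cnj (P z w) \<partial>\<tau>)"
  proof -
    have j2: "integrable \<tau> (\<lambda>w. cnj t * (P z w * g w))" using i2 by (rule integrable_mult_right)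
    have k2: "integrable \<tau> (\<lambda>w. 2 * Re (cnj t * (P z w * g w)))"
      by (rule integrable_mult_right[OF integrable_Re[OF j2]])
    have k3: "integrable \<tau> (\<lambda>w. (norm t)\<^sup>2 * Re (P z w * cnj (P z w)))"
      by (rule integrable_mult_right[OF integrable_Re[OF i3]])
    have "(\<integral> w. 2 * Re (cnj t * (P z w * g w)) \<partial>\<tau>) = 2 * Re (cnj t * (\<integral> w. P z w * g w \<partial>\<tau>))"
      unfolding integral_mult_right_zero integral_Re[OF j2] ..
    moreover have "(\<integral> w. (norm t)\<^sup>2 * Re (P z w * cnj (P z w)) \<partial>\<tau>) = (norm t)\<^sup>2 * Re (\<integral> w. P z w * cnj (P z w) \<partial>\<tau>)"
      unfolding integral_mult_right_zero integral_Re[OF i3] ..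
    ultimately show ?thesis
      unfolding eq Bochner_Integration.integral_add[OF Bochner_Integration.integrable_diff[OF i1 k2] k3]
        Bochner_Integration.integral_diff[OF i1 k2] by (simp only:)
  qed
  then show ?thesis
    unfolding reproducing(2)[OF assms] reproducing(2)[OF kernel_in_A[OF assms(2)] assms(2)]
    by (simp only: cnj.simps)
qed

text \<open>A minimizing sequence of the \<open>L\<^sup>2\<close> distance to the span of the kernels converges pointwise, with a rate
  controlled by \<open>P z z\<close>; neither completeness nor a limit of the sequence is needed.\<close>

lemma kspan_dense:
  assumes "v \<in> A" "compact K" "K \<subseteq> \<Omega>" "e > 0"
  shows "\<exists>s\<in>kspan. \<forall>z\<in>K. norm (v z - s z) \<le> e"
proof -
  obtain B where B: "B > 0" "\<And>z. z \<in> K \<Longrightarrow> norm (P z z) \<le> B"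
    using kernel_diagonal_bounded[OF assms(2,3)] by blast
  define n2 where "n2 s = (\<integral> w. (norm (v w - s w))\<^sup>2 \<partial>\<tau>)" for s
  define d where "d = Inf (n2 ` kspan)"
  have n2: "n2 s \<ge> 0" for s by (simp add: n2_def)
  have bdd: "bdd_below (n2 ` kspan)" using n2 by (intro bdd_belowI2[of kspan 0]) auto
  have ne: "n2 ` kspan \<noteq> {}" using kspan.zero by blast
  have "Inf (n2 ` kspan) < d + e\<^sup>2 / B" using assms(4) B(1) by (simp add: d_def)
  then obtain s where s: "s \<in> kspan" "n2 s < d + e\<^sup>2 / B"
    using cInf_less_iff[OF ne bdd] by auto
  have "norm (v z - s z) \<le> e" if z: "z \<in> K" for z
  proof -
    have z\<Omega>: "z \<in> \<Omega>" using z assms by blast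
    define g where "g w = v w - s w" for w
    have gA: "g \<in> A" unfolding g_def using A_minus[OF assms(1) kspan_in_A[OF s(1)]] .
    \<comment> \<open>The step that minimises the expanded square when \<open>P z z\<close> is
      replaced by its bound \<open>B\<close>; it lowers the squared distance by at least
      \<open>(norm (g z))\<^sup>2 / B\<close>. As \<open>s\<close> is within
      \<open>e\<^sup>2 / B\<close> of the infimum, this forces
      \<open>norm (g z) < e\<close>.\<close>
    define t where "t = of_real (1 / B) * g z"
    have "d \<le> n2 (\<lambda>w. s w + t * cnj (P z w))"
      unfolding d_def using kspan.step[OF s(1) z\<Omega>] by (intro cInf_lower[OF _ bdd]) auto
    also have "\<dots> = (\<integral> w. (norm (g w - t * cnj (P z w)))\<^sup>2 \<partial>\<tau>)"
      unfolding n2_def g_def by (simp add: algebra_simps)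
    also have "\<dots> = n2 s - 2 * Re (cnj t * g z) + (norm t)\<^sup>2 * Re (P z z)"
      unfolding norm_sub_kernel[OF gA z\<Omega>] by (simp add: n2_def g_def)
    also have "Re (cnj t * g z) = (norm (g z))\<^sup>2 / B"
      unfolding cmod_power2 by (simp add: t_def power2_eq_square field_simps)
    also have "(norm t)\<^sup>2 * Re (P z z) \<le> (norm t)\<^sup>2 * B"
      using B(2)[OF z] complex_Re_le_cmod[of "P z z"] by (intro mult_left_mono) auto
    also have "(norm t)\<^sup>2 * B = (norm (g z))\<^sup>2 / B"
    proof -
      have "norm t = norm (g z) / B" using B(1) by (simp add: t_def norm_divide)
      then show ?thesis using B(1) by (simp add: power2_eq_square)
    qed
    finally have "(norm (g z))\<^sup>2 / B < e\<^sup>2 / B" using s(2) by simp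
    then have "(norm (g z))\<^sup>2 < e\<^sup>2" using B(1) by (simp add: divide_less_cancel)
    then have "norm (g z) < e" by (rule power2_less_imp_less) (use assms(4) in auto)
    then show ?thesis by (simp add: g_def)
  qed
  then show ?thesis using s by blast
qed

end

section \<open>From the Toeplitz operator to a sesquilinear form on polynomials\<close>

lemma toeplitz_zero_imp:
  assumes "compact_dist \<Omega> F K N C" "kernel_space \<Omega> \<tau> P"
    and u: "u holomorphic_on \<Omega>" "\<And>z. z \<in> \<Omega> \<Longrightarrow> toeplitz F P u z = 0"
    and v: "v \<in> analytic_L2 \<Omega> \<tau>"
  shows "F (\<lambda>w. u w * cnj (v w)) = 0"
proof -
  interpret compact_dist \<Omega> F K N C by fact
  interpret ker: kernel_space \<Omega> \<tau> P by fact
  have smu: "smooth_on \<Omega> u" using smooth_on_holomorphic[OF open_dom u(1)] .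
  have smA: "smooth_on \<Omega> (\<lambda>w. cnj (s w))" if "s \<in> ker.A" for s
    using that smooth_on_cnj_holomorphic[OF open_dom] by (auto simp: analytic_L2_def)
  have smP: "smooth_on \<Omega> (P z)" if "z \<in> \<Omega>" for z
    using smA[OF ker.kernel_in_A[OF that]] by simp
  \<comment> \<open>\<open>P z\<close> is the conjugate of a kernel function, so vanishing of the
    Toeplitz image of \<open>u\<close> at \<open>z\<close> says that \<open>F\<close> annihilates
    \<open>u\<close> times that conjugate; density of the kernel span then carries this over to
    \<open>v\<close>.\<close>
  have span: "F (\<lambda>w. u w * cnj (s w)) = 0" if "s \<in> ker.kspan" for s
    using that
  proof (induction rule: ker.kspan.induct)
    case zero
    then show ?case by (simp add: F_zero)
  next
    case (step s z c)
    have "F (\<lambda>w. u w * cnj (s w) + cnj c * (P z w * u w)) = F (\<lambda>w. u w * cnj (s w)) + cnj c * F (\<lambda>w. P z w * u w)"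
      using smA[OF ker.kspan_in_A[OF step(1)]] smP[OF step(2)] smu
      using scale[OF smooth_on_mult[OF open_dom smP[OF step(2)] smu], of "cnj c"]
      by (subst add) (auto intro!: smooth_on_mult smooth_on_const open_dom)
    also have "\<dots> = 0" using step u(2)[of z] by (simp add: toeplitz_def)
    finally show ?case by (simp add: algebra_simps)
  qed
  obtain K' where K': "compact K'" "K' \<subseteq> \<Omega>"
    "\<And>u. smooth_on \<Omega> u \<Longrightarrow> \<exists>C'\<ge>0. \<forall>f e. f holomorphic_on \<Omega> \<longrightarrow> e \<ge> 0 \<longrightarrow> (\<forall>z\<in>K'. norm (f z) \<le> e) \<longrightarrow>
      norm (F (\<lambda>z. u z * f z)) \<le> C' * e \<and> norm (F (\<lambda>z. u z * cnj (f z))) \<le> C' * e"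
    using holomorphic_factor_bound by blast
  obtain C' where C': "C' \<ge> 0" "\<And>f e. f holomorphic_on \<Omega> \<Longrightarrow> e \<ge> 0 \<Longrightarrow> (\<forall>z\<in>K'. norm (f z) \<le> e) \<Longrightarrow>
      norm (F (\<lambda>z. u z * cnj (f z))) \<le> C' * e"
    using K'(3)[OF smu] by blast
  have "norm (F (\<lambda>w. u w * cnj (v w))) \<le> C' * e" if "e > 0" for e
  proof -
    obtain s where s: "s \<in> ker.kspan" "\<forall>z\<in>K'. norm (v z - s z) \<le> e"
      using ker.kspan_dense[OF v K'(1,2) \<open>e > 0\<close>] by blast
    have "norm (F (\<lambda>w. u w * cnj (v w - s w))) \<le> C' * e"
      using ker.A_minus[OF v ker.kspan_in_A[OF s(1)]] that s(2)
      by (intro C'(2)) (auto simp: analytic_L2_def)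
    moreover have "F (\<lambda>w. u w * cnj (v w) - u w * cnj (s w)) = F (\<lambda>w. u w * cnj (v w)) - F (\<lambda>w. u w * cnj (s w))"
      using smu smA[OF v] smA[OF ker.kspan_in_A[OF s(1)]] by (intro minus smooth_on_mult open_dom)
    ultimately show ?thesis using span[OF s(1)] by (simp add: algebra_simps)
  qed
  then have le: "norm (F (\<lambda>w. u w * cnj (v w))) \<le> C' * e" if "e > 0" for e using that by blast
  have "norm (F (\<lambda>w. u w * cnj (v w))) \<le> 0"
  proof (rule field_le_epsilon)
    fix e :: real assume "e > 0"
    then have "norm (F (\<lambda>w. u w * cnj (v w))) \<le> C' * (e / (C' + 1))"
      using C'(1) by (intro le) simp
    also have "\<dots> \<le> e" using C'(1) \<open>e > 0\<close> by (simp add: field_simps)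
    finally show "norm (F (\<lambda>w. u w * cnj (v w))) \<le> 0 + e" by simp
  qed
  then show ?thesis by simp
qed

text \<open>Gaussian elimination by induction on the equations: an equation with a nonzero
  coefficient is solved for one unknown, a trivial one is dropped. The index types are arbitrary,
  since equations will be indexed by functions and by pairs.\<close>

lemma underdetermined_system:
  fixes M :: "'i \<Rightarrow> 'j \<Rightarrow> 'a::field"
  assumes "finite I" "finite J" "card I < card J"
  shows "\<exists>c. (\<exists>j\<in>J. c j \<noteq> 0) \<and> (\<forall>i\<in>I. (\<Sum>j\<in>J. M i j * c j) = 0)"
  using assms
proof (induction I arbitrary: J M rule: finite_induct)
  case empty
  then obtain j where "j \<in> J" by fastforce
  then show ?case by (intro exI[of _ "\<lambda>_. 1"]) auto
next
  case (insert i0 I)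
  show ?case
  proof (cases "\<forall>j\<in>J. M i0 j = 0")
    case True
    have "card I < card J" using insert by simp
    from insert.IH[OF insert.prems(1) this, of M]
    obtain c where "\<exists>j\<in>J. c j \<noteq> 0" "\<forall>i\<in>I. (\<Sum>j\<in>J. M i j * c j) = 0" by blast
    then show ?thesis using True by (intro exI[of _ c]) auto
  next
    case False
    then obtain j0 where j0: "j0 \<in> J" "M i0 j0 \<noteq> 0" by blast
    define J' where "J' = J - {j0}"
    have "\<exists>c. (\<exists>j\<in>J'. c j \<noteq> 0) \<and> (\<forall>i\<in>I. (\<Sum>j\<in>J'. (M i j - M i j0 * M i0 j / M i0 j0) * c j) = 0)"
      using insert j0 by (intro insert.IH) (auto simp: J'_def)
    then obtain c where c: "\<exists>j\<in>J'. c j \<noteq> 0"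
      "\<And>i. i \<in> I \<Longrightarrow> (\<Sum>j\<in>J'. (M i j - M i j0 * M i0 j / M i0 j0) * c j) = 0" by blast
    define S where "S = (\<Sum>j\<in>J'. M i0 j * c j)"
    define c' where "c' = c(j0 := - S / M i0 j0)"
    have split: "(\<Sum>j\<in>J. M i j * c' j) = (\<Sum>j\<in>J'. M i j * c j) - M i j0 * S / M i0 j0" for i
    proof -
      have "(\<Sum>j\<in>J. M i j * c' j) = M i j0 * c' j0 + (\<Sum>j\<in>J'. M i j * c' j)"
        unfolding J'_def using j0 insert by (simp add: sum.remove)
      moreover have "(\<Sum>j\<in>J'. M i j * c' j) = (\<Sum>j\<in>J'. M i j * c j)"
        by (intro sum.cong) (auto simp: c'_def J'_def)
      ultimately show ?thesis by (simp add: c'_def)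
    qed
    have "(\<Sum>j\<in>J. M i j * c' j) = 0" if "i \<in> I" for i
    proof -
      have "(\<Sum>j\<in>J'. (M i j - M i j0 * M i0 j / M i0 j0) * c j)
          = (\<Sum>j\<in>J'. M i j * c j) - M i j0 / M i0 j0 * S"
        unfolding S_def sum_distrib_left sum_subtractf[symmetric] by (intro sum.cong) (auto simp: algebra_simps)
      then show ?thesis using c(2)[OF that] split[of i] by simp
    qed
    moreover have "(\<Sum>j\<in>J. M i0 j * c' j) = 0" using split[of i0] j0 by (simp add: S_def)
    moreover have "\<exists>j\<in>J. c' j \<noteq> 0" using c(1) by (auto simp: c'_def J'_def)
    ultimately show ?thesis by (intro exI[of _ c']) auto
  qed
qed

lemma vector_space_fscale: "vector_space fscale"
  by unfold_locales (auto simp: fscale_def fun_eq_iff algebra_simps)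

text \<open>The images of \<open>m + 1\<close> polynomials have coordinates with respect to
  \<open>m\<close> functions, which leaves more unknown coefficients than equations. The resulting
  combination is annihilated by the Toeplitz operator, hence by the form.\<close>

lemma finite_rank_kernel:
  assumes cd: "compact_dist \<Omega> F K N C" and ks: "kernel_space \<Omega> \<tau> P"
    and rank: "toeplitz_rank \<Omega> \<tau> F P m"
    and poly: "\<And>p. (\<lambda>z. poly p z) \<in> analytic_L2 \<Omega> \<tau>"
  shows "\<exists>c. (\<exists>j\<le>m. c j \<noteq> 0) \<and> (\<forall>q. F (\<lambda>z. poly (\<Sum>j\<le>m. Polynomial.smult (c j) (f j)) z * cnj (poly q z)) = 0)"
proof -
  interpret compact_dist \<Omega> F K N C by fact
  interpret ker: kernel_space \<Omega> \<tau> P by fact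
  interpret fs: vector_space fscale by (rule vector_space_fscale)
  define R where "R u = (\<lambda>z. if z \<in> \<Omega> then toeplitz F P u z else 0)" for u
  obtain B where B: "finite B" "card B = m" "fs.span B = fs.span (R ` analytic_L2 \<Omega> \<tau>)"
    using rank unfolding toeplitz_rank_def span_dim_eq_def R_def by blast
  have "\<exists>M. R (poly (f j)) = (\<Sum>b\<in>B. fscale (M b) b)" for j
  proof -
    have "R (poly (f j)) \<in> fs.span B" unfolding B(3) by (intro fs.span_base imageI poly)
    then show ?thesis using fs.span_finite[OF B(1)] by auto
  qed
  then obtain M where M: "\<And>j. R (poly (f j)) = (\<Sum>b\<in>B. fscale (M j b) b)" by metis
  obtain c where c: "\<exists>j\<in>{..m}. c j \<noteq> 0" "\<And>b. b \<in> B \<Longrightarrow> (\<Sum>j\<le>m. M j b * c j) = 0"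
    using underdetermined_system[of B "{..m}" "\<lambda>b j. M j b"] B by auto
  have smP: "smooth_on \<Omega> (P z)" if "z \<in> \<Omega>" for z
    using ker.kernel_in_A[OF that] smooth_on_cnj_holomorphic[OF open_dom, of "\<lambda>w. cnj (P z w)"]
    by (auto simp: analytic_L2_def)
  have smp: "smooth_on \<Omega> (poly p)" for p :: "complex poly"
    by (intro smooth_on_holomorphic open_dom holomorphic_intros)
  have fun_sum: "(\<Sum>b\<in>B'. g b) z = (\<Sum>b\<in>B'. g b z)" for B' :: "(complex \<Rightarrow> complex) set" and g :: "_ \<Rightarrow> complex \<Rightarrow> complex" and z
    by (induction B' rule: infinite_finite_induct) auto
  have "toeplitz F P (poly (\<Sum>j\<le>m. Polynomial.smult (c j) (f j))) z = 0" if z: "z \<in> \<Omega>" for z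
  proof -
    have "toeplitz F P (poly (\<Sum>j\<le>m. Polynomial.smult (c j) (f j))) z = F (\<lambda>w. \<Sum>j\<le>m. c j * (P z w * poly (f j) w))"
      unfolding toeplitz_def poly_sum by (simp add: sum_distrib_left mult_ac)
    also have "\<dots> = (\<Sum>j\<le>m. c j * F (\<lambda>w. P z w * poly (f j) w))"
      using scale[OF smooth_on_mult[OF open_dom smP[OF z] smp]]
      by (subst sum) (auto intro!: smooth_on_mult smooth_on_const open_dom smP[OF z] smp sum.cong)
    also have "\<dots> = (\<Sum>j\<le>m. c j * R (poly (f j)) z)" using z by (simp add: R_def toeplitz_def)
    also have "\<dots> = (\<Sum>j\<le>m. \<Sum>b\<in>B. (M j b * c j) * b z)"
      unfolding M fun_sum by (simp add: fscale_def sum_distrib_left mult_ac)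
    also have "\<dots> = (\<Sum>b\<in>B. (\<Sum>j\<le>m. M j b * c j) * b z)"
      by (subst sum.swap) (simp add: sum_distrib_right)
    also have "\<dots> = 0" using c(2) by simp
    finally show ?thesis .
  qed
  then have "F (\<lambda>z. poly (\<Sum>j\<le>m. Polynomial.smult (c j) (f j)) z * cnj (poly q z)) = 0" for q
    using toeplitz_zero_imp[OF cd ks _ _ poly, of "poly (\<Sum>j\<le>m. Polynomial.smult (c j) (f j))" q]
    by (simp add: holomorphic_intros)
  then show ?thesis using c(1) by auto
qed

subsection \<open>Determinants of functions of two indices\<close>

text \<open>Only indices below \<open>r\<close> count. Working with functions of two indices keeps
  carriers and dimensions out of statements in which the entries depend on the parameter
  \<open>c\<close>.\<close>

definition fdet :: "nat \<Rightarrow> (nat \<Rightarrow> nat \<Rightarrow> complex) \<Rightarrow> complex" where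
  "fdet r v = Determinant.det (Matrix.mat r r (\<lambda>(i, j). v i j))"

definition fcof :: "nat \<Rightarrow> (nat \<Rightarrow> nat \<Rightarrow> complex) \<Rightarrow> nat \<Rightarrow> nat \<Rightarrow> complex" where
  "fcof r v i j = cofactor (Matrix.mat r r (\<lambda>(i, j). v i j)) i j"

lemma fdet_eq: "fdet r v = (\<Sum>p | p permutes {0..<r}. signof p * (\<Prod>i=0..<r. v i (p i)))"
  unfolding fdet_def by (subst det_def'[of _ r]) (auto intro!: sum.cong prod.cong simp: permutes_in_image)

lemma fdet_cong: "(\<And>i j. i < r \<Longrightarrow> j < r \<Longrightarrow> u i j = v i j) \<Longrightarrow> fdet r u = fdet r v"
  unfolding fdet_def by (intro arg_cong[of _ _ Determinant.det] eq_matI) auto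

lemma fdet_mult: "fdet r (\<lambda>i j. \<Sum>k<r. u i k * v k j) = fdet r u * fdet r v"
proof -
  have "Matrix.mat r r (\<lambda>(i, j). u i j) * Matrix.mat r r (\<lambda>(i, j). v i j)
      = Matrix.mat r r (\<lambda>(i, j). \<Sum>k<r. u i k * v k j)"
    by (intro eq_matI) (auto simp: scalar_prod_def atLeast0LessThan)
  then show ?thesis unfolding fdet_def by (subst det_mult[of _ r, symmetric]) auto
qed

lemma fdet_id: "fdet r (\<lambda>i j. if i = j then 1 else 0) = 1"
proof -
  have "Matrix.mat r r (\<lambda>(i, j). if i = j then 1 else (0::complex)) = 1\<^sub>m r"
    by (intro eq_matI) auto
  then show ?thesis unfolding fdet_def by simp
qed

text \<open>The cofactors along a column do not involve that column, so they may be taken from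
  \<open>v\<close>; this makes the determinant visibly linear in \<open>x\<close>.\<close>

lemma fdet_column:
  assumes "k < r"
  shows "fdet r (\<lambda>i j. if j = k then x i else v i j) = (\<Sum>i<r. x i * fcof r v i k)"
proof -
  let ?A = "Matrix.mat r r (\<lambda>(i, j). if j = k then x i else v i j)"
  have "fdet r (\<lambda>i j. if j = k then x i else v i j) = (\<Sum>i<r. ?A $$ (i, k) * cofactor ?A i k)"
    unfolding fdet_def by (rule laplace_expansion_column) (use assms in auto)
  also have "\<dots> = (\<Sum>i<r. x i * fcof r v i k)"
  proof (rule sum.cong)
    fix i assume i: "i \<in> {..<r}"
    have "mat_delete ?A i k = mat_delete (Matrix.mat r r (\<lambda>(i, j). v i j)) i k"
      unfolding mat_delete_def by (intro eq_matI) (use i assms in auto)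
    then show "?A $$ (i, k) * cofactor ?A i k = x i * fcof r v i k"
      using i assms by (simp add: cofactor_def fcof_def)
  qed auto
  finally show ?thesis .
qed

text \<open>Weighting the equations with row \<open>i\<close> of \<open>v\<close>, and using that a
  matrix times its adjugate is the determinant times the identity, gives
  \<open>x i * fdet r v = 0\<close>.\<close>

lemma fdet_cramer_zero:
  assumes "fdet r v \<noteq> 0" "\<And>k. k < r \<Longrightarrow> (\<Sum>i<r. x i * fcof r v i k) = 0" "i < r"
  shows "x i = 0"
proof -
  let ?A = "Matrix.mat r r (\<lambda>(i, j). v i j)"
  have adj: "(\<Sum>k<r. v i k * fcof r v l k) = (if l = i then fdet r v else 0)" if "l < r" for l
  proof -
    have "(?A * adj_mat ?A) $$ (i, l) = (Determinant.det ?A \<cdot>\<^sub>m 1\<^sub>m r) $$ (i, l)"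
      by (subst adj_mat(2)[of _ r]) auto
    moreover have "(?A * adj_mat ?A) $$ (i, l) = (\<Sum>k<r. v i k * fcof r v l k)"
      using assms(3) that adj_mat(1)[of ?A r]
      by (auto simp: scalar_prod_def adj_mat_def fcof_def atLeast0LessThan)
    ultimately show ?thesis using that assms(3) by (auto simp: fdet_def)
  qed
  have "0 = (\<Sum>k<r. (\<Sum>l<r. x l * fcof r v l k) * v i k)" using assms(2) by simp
  also have "\<dots> = (\<Sum>k<r. \<Sum>l<r. x l * (v i k * fcof r v l k))"
    by (simp add: sum_distrib_left mult_ac)
  also have "\<dots> = (\<Sum>l<r. x l * (\<Sum>k<r. v i k * fcof r v l k))"
    by (subst sum.swap) (simp add: sum_distrib_left)
  also have "\<dots> = (\<Sum>l<r. if l = i then x i * fdet r v else 0)"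
    by (intro sum.cong) (auto simp: adj)
  also have "\<dots> = x i * fdet r v" using assms(3) by simp
  finally show ?thesis using assms(1) by simp
qed

lemma fdet_holomorphic:
  assumes "\<And>i j. i < r \<Longrightarrow> j < r \<Longrightarrow> (\<lambda>c. v c i j) holomorphic_on S"
  shows "(\<lambda>c. fdet r (v c)) holomorphic_on S"
  unfolding fdet_eq
  by (intro holomorphic_on_sum holomorphic_on_mult holomorphic_on_const holomorphic_on_prod assms)
    (auto simp: permutes_in_image)

lemma cnj_fdet: "cnj (fdet r v) = fdet r (\<lambda>i j. cnj (v i j))"
  unfolding fdet_eq cnj_sum complex_cnj_mult cnj_prod by simp

lemma fdet_bound:
  assumes "\<And>i j. i < r \<Longrightarrow> j < r \<Longrightarrow> norm (v i j) \<le> b"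
  shows "norm (fdet r v) \<le> fact r * b ^ r"
proof -
  have "norm (fdet r v) \<le> (\<Sum>p | p permutes {0..<r}. b ^ r)"
    unfolding fdet_eq
  proof (rule sum_norm_le)
    fix p assume p: "p \<in> {p. p permutes {0..<r}}"
    have "norm (\<Prod>i=0..<r. v i (p i)) \<le> (\<Prod>i=0..<r. b)"
      unfolding prod_norm[symmetric]
      by (intro prod_mono) (use p in \<open>auto intro!: assms simp: permutes_in_image\<close>)
    then show "norm (signof p * (\<Prod>i=0..<r. v i (p i))) \<le> b ^ r"
      by (simp add: norm_mult sign_def)
  qed
  also have "\<dots> = fact r * b ^ r" by (simp add: card_permutations[of "{0..<r}" r])
  finally show ?thesis .
qed

subsection \<open>An ideal in the kernel of a finite rank form\<close>

lemma smooth_on_poly: "open S \<Longrightarrow> smooth_on S (poly p)"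
  by (intro smooth_on_holomorphic holomorphic_intros)

lemma smooth_on_cnj_poly: "open S \<Longrightarrow> smooth_on S (\<lambda>z. cnj (poly p z))"
  by (intro smooth_on_cnj_holomorphic holomorphic_intros)

text \<open>The function is the exponential of \<open>c * z - cnj (c * z)\<close>, an eigenfunction
  of both \<open>dx\<close> and \<open>dy\<close>.\<close>

lemma pdiff_phase:
  "pdiff a b (\<lambda>z. exp (c * z) * cnj (exp (- c * z)))
    = (\<lambda>z. (c - cnj c) ^ a * (\<i> * (c + cnj c)) ^ b * (exp (c * z) * cnj (exp (- c * z))))"
proof -
  define w where "w z = exp (c * z) * cnj (exp (- c * z))" for z
  have hd: "((\<lambda>z. k * w z) has_derivative (\<lambda>h. k * ((c * h - cnj (c * h)) * w z))) (at z)" for k z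
  proof -
    have e: "(exp has_derivative (\<lambda>h. h * exp x)) (at x)" for x :: complex
    proof -
      have "(\<lambda>h. h * exp x) = (*) (exp x)" by (auto simp: fun_eq_iff)
      then show ?thesis using DERIV_exp[of x] by (simp only: has_field_derivative_def)
    qed
    have 1: "((\<lambda>z. exp (d * z)) has_derivative (\<lambda>h. d * h * exp (d * z))) (at z)" for d
      by (rule has_derivative_compose[OF _ e]) (auto intro!: derivative_eq_intros)
    show ?thesis unfolding w_def
      by (rule has_derivative_eq_rhs[OF has_derivative_mult_right[OF has_derivative_mult[OF 1 has_derivative_cnj[OF 1]]]])
        (simp add: fun_eq_iff algebra_simps)
  qed
  have d: "dx (\<lambda>z. k * w z) = (\<lambda>z. (k * (c - cnj c)) * w z)" "dy (\<lambda>z. k * w z) = (\<lambda>z. (k * (\<i> * (c + cnj c))) * w z)" for k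
    using has_derivative_dx_dy[OF hd] by (auto simp: fun_eq_iff algebra_simps)
  have b0: "pdiff 0 b (\<lambda>z. w z) = (\<lambda>z. (\<i> * (c + cnj c)) ^ b * w z)"
  proof (induction b)
    case (Suc b)
    show ?case unfolding pdiff_0_Suc Suc d by (simp add: mult_ac)
  qed simp
  have "pdiff a b (\<lambda>z. w z) = (\<lambda>z. (c - cnj c) ^ a * (\<i> * (c + cnj c)) ^ b * w z)"
  proof (induction a)
    case (Suc a)
    show ?case unfolding pdiff_Suc_left Suc d by (simp add: mult_ac)
  qed (simp add: b0)
  then show ?thesis by (simp add: w_def)
qed

context compact_dist
begin

section \<open>The sesquilinear form and its rank\<close>

definition B :: "complex poly \<Rightarrow> complex poly \<Rightarrow> complex" where
  "B p q = F (\<lambda>z. poly p z * cnj (poly q z))"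

lemma smooth_poly_cnj_poly: "smooth_on \<Omega> (\<lambda>z. poly p z * cnj (poly q z))"
  by (intro smooth_on_mult open_dom smooth_on_poly smooth_on_cnj_poly)

lemma B_add_left: "B (p + p') q = B p q + B p' q"
  unfolding B_def using add[OF smooth_poly_cnj_poly smooth_poly_cnj_poly, of p q p' q] by (simp add: algebra_simps)

lemma B_smult_left: "B (Polynomial.smult c p) q = c * B p q"
  unfolding B_def using scale[OF smooth_poly_cnj_poly, of c p q] by (simp add: algebra_simps)

lemma B_add_right: "B p (q + q') = B p q + B p q'"
  unfolding B_def using add[OF smooth_poly_cnj_poly smooth_poly_cnj_poly, of p q p q'] by (simp add: algebra_simps)

lemma B_smult_right: "B p (Polynomial.smult c q) = cnj c * B p q"
  unfolding B_def using scale[OF smooth_poly_cnj_poly, of "cnj c" p q] by (simp add: algebra_simps)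

lemma B_0_left: "B 0 q = 0" and B_0_right: "B p 0 = 0"
  using F_zero by (auto simp: B_def)

lemma B_sum_left: "B (\<Sum>i\<in>I. f i) q = (\<Sum>i\<in>I. B (f i) q)"
  by (induction I rule: infinite_finite_induct) (auto simp: B_add_left B_0_left)

lemma B_sum_right: "B p (\<Sum>i\<in>I. f i) = (\<Sum>i\<in>I. B p (f i))"
  by (induction I rule: infinite_finite_induct) (auto simp: B_add_right B_0_right)

lemma B_diff_left: "B (p - p') q = B p q - B p' q"
  using B_add_left[of p "Polynomial.smult (-1) p'" q] B_smult_left[of "-1" p' q] by simp

lemma B_diff_right: "B p (q - q') = B p q - B p q'"
  using B_add_right[of p q "Polynomial.smult (-1) q'"] B_smult_right[of p "-1" q'] by simp

text \<open>A biorthogonal system of maximal length exists because the rank condition bounds the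
  length by \<open>m\<close>. If the expansion failed for some \<open>p\<close> and
  \<open>s\<close>, their parts biorthogonal to the system would pair to something nonzero and
  extend it.\<close>

lemma dual_system:
  assumes rank: "\<And>f :: nat \<Rightarrow> complex poly. \<exists>c. (\<exists>j\<le>m. c j \<noteq> 0) \<and> (\<forall>q. B (\<Sum>j\<le>m. Polynomial.smult (c j) (f j)) q = 0)"
  shows "\<exists>(r::nat) f q. (\<forall>j<r. \<forall>k<r. B (f j) (q k) = (if j = k then 1 else 0)) \<and>
    (\<forall>p s. B p s = (\<Sum>j<r. B p (q j) * B (f j) s))"
proof -
  define Q where "Q r \<longleftrightarrow> (\<exists>f q. \<forall>j<r. \<forall>k<r. B (f j) (q k) = (if j = k then 1 else 0))" for r :: nat
  have "Q 0" by (simp add: Q_def)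
  moreover have "r \<le> m" if "Q r" for r
  proof (rule ccontr)
    assume r: "\<not> r \<le> m"
    obtain f q where fq: "\<And>j k. j < r \<Longrightarrow> k < r \<Longrightarrow> B (f j) (q k) = (if j = k then 1 else 0)"
      using \<open>Q r\<close> unfolding Q_def by blast
    obtain c k where c: "k \<le> m" "c k \<noteq> 0" "\<And>s. B (\<Sum>j\<le>m. Polynomial.smult (c j) (f j)) s = 0"
      using rank[of f] by blast
    have "0 = (\<Sum>j\<le>m. c j * B (f j) (q k))" using c(3)[of "q k"] by (simp add: B_sum_left B_smult_left)
    also have "\<dots> = (\<Sum>j\<le>m. if j = k then c k else 0)" using r c(1) by (intro sum.cong) (auto simp: fq)
    also have "\<dots> = c k" using c(1) by simp
    finally show False using c(2) by simp
  qed
  ultimately obtain r where r: "Q r" "\<And>r'. Q r' \<Longrightarrow> r' \<le> r"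
    using GreatestI_nat[of Q 0 m] Greatest_le_nat[of Q _ m] by metis
  obtain f q where fq: "\<And>j k. j < r \<Longrightarrow> k < r \<Longrightarrow> B (f j) (q k) = (if j = k then 1 else 0)"
    using r(1) unfolding Q_def by blast
  have "B p s = (\<Sum>j<r. B p (q j) * B (f j) s)" for p s
  proof (rule ccontr)
    assume ne: "B p s \<noteq> (\<Sum>j<r. B p (q j) * B (f j) s)"
    \<comment> \<open>Projections: \<open>p'\<close> pairs to zero with every \<open>q k\<close>,
      and every \<open>f k\<close> pairs to zero with \<open>s'\<close>; what is left,
      \<open>B p' s'\<close>, is the defect of the expansion.\<close>
    define p' where "p' = p - (\<Sum>j<r. Polynomial.smult (B p (q j)) (f j))"
    define s' where "s' = s - (\<Sum>j<r. Polynomial.smult (cnj (B (f j) s)) (q j))"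
    have 1: "B p' (q k) = 0" if "k < r" for k
    proof -
      have "(\<Sum>j<r. B p (q j) * B (f j) (q k)) = (\<Sum>j<r. if j = k then B p (q k) else 0)"
        using that by (intro sum.cong) (auto simp: fq)
      then show ?thesis using that by (simp add: p'_def B_diff_left B_sum_left B_smult_left)
    qed
    have 2: "B (f k) s' = 0" if "k < r" for k
    proof -
      have "(\<Sum>j<r. B (f j) s * B (f k) (q j)) = (\<Sum>j<r. if j = k then B (f k) s else 0)"
        using that by (intro sum.cong) (auto simp: fq)
      then show ?thesis using that by (simp add: s'_def B_diff_right B_sum_right B_smult_right)
    qed
    have "B p' s' = B p' s"
      by (simp add: s'_def B_diff_right B_sum_right B_smult_right 1)
    also have "\<dots> = B p s - (\<Sum>j<r. B p (q j) * B (f j) s)"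
      by (simp add: p'_def B_diff_left B_sum_left B_smult_left)
    finally have 3: "B p' s' \<noteq> 0" using ne by simp
    define f' where "f' = f(r := Polynomial.smult (1 / B p' s') p')"
    define q' where "q' = q(r := s')"
    have "B (f' j) (q' k) = (if j = k then 1 else 0)" if "j < Suc r" "k < Suc r" for j k
      using that 1 2 3 fq by (auto simp: f'_def q'_def B_smult_left less_Suc_eq)
    then have "Q (Suc r)" unfolding Q_def by blast
    then show False using r(2) by fastforce
  qed
  then show ?thesis using fq by blast
qed

section \<open>Exponential weights in the form, reached through Taylor polynomials\<close>

definition texp :: "nat \<Rightarrow> complex \<Rightarrow> complex poly" where
  "texp n c = (\<Sum>k\<le>n. monom (c ^ k / fact k) k)"

lemma texp_uniform:
  assumes "compact K'" "e > 0"
  shows "\<forall>\<^sub>F n in sequentially. \<forall>z\<in>K'. norm (poly (texp n c) z - exp (c * z)) \<le> e"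
proof -
  obtain R where R: "\<forall>z\<in>K'. norm z \<le> R"
    using assms(1) compact_imp_bounded bounded_iff by metis
  define R' where "R' = norm c * \<bar>R\<bar>"
  have R': "norm (c * z) \<le> R'" if "z \<in> K'" for z
    unfolding R'_def norm_mult using R that by (intro mult_left_mono) force+
  have "(\<lambda>n. exp R' * R' * (R' ^ n / fact n)) \<longlonglongrightarrow> exp R' * R' * 0"
    using summable_LIMSEQ_zero[OF summable_exp[of R']]
    by (intro tendsto_mult tendsto_const) (simp add: divide_inverse mult.commute)
  then have "\<forall>\<^sub>F n in sequentially. exp R' * R' * (R' ^ n / fact n) < e"
    by (rule order_tendstoD(2)) (use assms(2) in simp)
  then show ?thesis
  proof eventually_elim
    case (elim n)
    show ?case
    proof
      fix z assume z: "z \<in> K'"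
      have R0: "R' \<ge> 0" by (simp add: R'_def)
      have "poly (texp n c) z = (\<Sum>k\<le>n. (c * z) ^ k / fact k)"
        unfolding texp_def poly_sum by (simp add: poly_monom power_mult_distrib)
      then have "norm (poly (texp n c) z - exp (c * z)) \<le> exp (norm (c * z)) * norm (c * z) ^ Suc n / fact n"
        using Taylor_exp_field[of "c * z" n] by (simp add: norm_minus_commute)
      also have "\<dots> \<le> exp R' * R' ^ Suc n / fact n"
        using R'[OF z] R0 by (intro divide_right_mono mult_mono power_mono) auto
      also have "\<dots> = exp R' * R' * (R' ^ n / fact n)" by simp
      finally show "norm (poly (texp n c) z - exp (c * z)) \<le> e" using elim by linarith
    qed
  qed
qed

lemma texp_tendsto:
  assumes "smooth_on \<Omega> u"
  shows "(\<lambda>n. F (\<lambda>z. u z * poly (texp n c) z)) \<longlonglongrightarrow> F (\<lambda>z. u z * exp (c * z))"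
    and "(\<lambda>n. F (\<lambda>z. u z * cnj (poly (texp n c) z))) \<longlonglongrightarrow> F (\<lambda>z. u z * cnj (exp (c * z)))"
proof -
  obtain K' where K': "compact K'" "K' \<subseteq> \<Omega>"
    "\<And>u. smooth_on \<Omega> u \<Longrightarrow> \<exists>C'\<ge>0. \<forall>f e. f holomorphic_on \<Omega> \<longrightarrow> e \<ge> 0 \<longrightarrow> (\<forall>z\<in>K'. norm (f z) \<le> e) \<longrightarrow>
      norm (F (\<lambda>z. u z * f z)) \<le> C' * e \<and> norm (F (\<lambda>z. u z * cnj (f z))) \<le> C' * e"
    using holomorphic_factor_bound by blast
  obtain C' where C': "C' \<ge> 0" "\<And>f e. f holomorphic_on \<Omega> \<Longrightarrow> e \<ge> 0 \<Longrightarrow> (\<forall>z\<in>K'. norm (f z) \<le> e) \<Longrightarrow>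
      norm (F (\<lambda>z. u z * f z)) \<le> C' * e \<and> norm (F (\<lambda>z. u z * cnj (f z))) \<le> C' * e"
    using K'(3)[OF assms] by blast
  have sm: "smooth_on \<Omega> (\<lambda>z. u z * poly p z)" "smooth_on \<Omega> (\<lambda>z. u z * exp (c * z))"
    "smooth_on \<Omega> (\<lambda>z. u z * cnj (poly p z))" "smooth_on \<Omega> (\<lambda>z. u z * cnj (exp (c * z)))" for p
    by (intro smooth_on_mult assms open_dom smooth_on_holomorphic smooth_on_cnj_holomorphic holomorphic_intros)+
  have *: "\<forall>\<^sub>F n in sequentially. norm (F (\<lambda>z. u z * poly (texp n c) z) - F (\<lambda>z. u z * exp (c * z))) < e \<and>
     norm (F (\<lambda>z. u z * cnj (poly (texp n c) z)) - F (\<lambda>z. u z * cnj (exp (c * z)))) < e" if e: "e > 0" for e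
  proof -
    define d where "d = e / (C' + 1)"
    have d: "d > 0" using e C'(1) by (simp add: d_def)
    have le: "C' * d < e" using e C'(1) by (simp add: d_def field_simps)
    show ?thesis
      using texp_uniform[OF K'(1) d, of c]
    proof eventually_elim
      case (elim n)
      have "(\<lambda>z. poly (texp n c) z - exp (c * z)) holomorphic_on \<Omega>" by (intro holomorphic_intros)
      from C'(2)[OF this _ elim] d
      have b: "norm (F (\<lambda>z. u z * (poly (texp n c) z - exp (c * z)))) \<le> C' * d"
        "norm (F (\<lambda>z. u z * cnj (poly (texp n c) z - exp (c * z)))) \<le> C' * d" by auto
      have e1: "F (\<lambda>z. u z * (poly (texp n c) z - exp (c * z)))
          = F (\<lambda>z. u z * poly (texp n c) z) - F (\<lambda>z. u z * exp (c * z))"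
        unfolding right_diff_distrib by (rule minus[OF sm(1,2)])
      have e2: "F (\<lambda>z. u z * cnj (poly (texp n c) z - exp (c * z)))
          = F (\<lambda>z. u z * cnj (poly (texp n c) z)) - F (\<lambda>z. u z * cnj (exp (c * z)))"
        unfolding right_diff_distrib complex_cnj_diff by (rule minus[OF sm(3,4)])
      show ?case using b(1)[unfolded e1] b(2)[unfolded e2] le by (intro conjI) linarith+
    qed
  qed
  show "(\<lambda>n. F (\<lambda>z. u z * poly (texp n c) z)) \<longlonglongrightarrow> F (\<lambda>z. u z * exp (c * z))"
  proof (rule tendstoI)
    fix e :: real assume "e > 0"
    from *[OF this] show "\<forall>\<^sub>F n in sequentially. dist (F (\<lambda>z. u z * poly (texp n c) z)) (F (\<lambda>z. u z * exp (c * z))) < e"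
      by eventually_elim (simp add: dist_norm)
  qed
  show "(\<lambda>n. F (\<lambda>z. u z * cnj (poly (texp n c) z))) \<longlonglongrightarrow> F (\<lambda>z. u z * cnj (exp (c * z)))"
  proof (rule tendstoI)
    fix e :: real assume "e > 0"
    from *[OF this] show "\<forall>\<^sub>F n in sequentially. dist (F (\<lambda>z. u z * cnj (poly (texp n c) z))) (F (\<lambda>z. u z * cnj (exp (c * z)))) < e"
      by eventually_elim (simp add: dist_norm)
  qed
qed

definition expB :: "complex poly \<Rightarrow> complex poly \<Rightarrow> complex \<Rightarrow> complex" where
  "expB p q c = F (\<lambda>z. poly p z * cnj (poly q z) * exp (c * z))"

text \<open>The minus sign makes the two weights combine to a function of modulus one. The
  conjugation makes the value antiholomorphic in \<open>c\<close>, so that it is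
  \<open>cnj (Bexp p q c)\<close> that is entire.\<close>

definition Bexp :: "complex poly \<Rightarrow> complex poly \<Rightarrow> complex \<Rightarrow> complex" where
  "Bexp p q c = F (\<lambda>z. poly p z * cnj (poly q z) * cnj (exp (- c * z)))"

definition expBexp :: "complex poly \<Rightarrow> complex poly \<Rightarrow> complex \<Rightarrow> complex" where
  "expBexp p q c = F (\<lambda>z. poly p z * cnj (poly q z) * (exp (c * z) * cnj (exp (- c * z))))"

lemma B_texp_left: "(\<lambda>n. B (p * texp n c) q) \<longlonglongrightarrow> expB p q c"
  using texp_tendsto(1)[OF smooth_poly_cnj_poly, of p q c] by (simp add: B_def expB_def mult_ac)

lemma B_texp_right: "(\<lambda>n. B p (q * texp n (- c))) \<longlonglongrightarrow> Bexp p q c"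
  using texp_tendsto(2)[OF smooth_poly_cnj_poly, of p q "- c"] by (simp add: B_def Bexp_def mult_ac)

text \<open>Besides showing that \<open>expB\<close> is entire in \<open>c\<close>, the series
  exhibits the values \<open>B (p * monom 1 n) q\<close> as its Taylor coefficients up to
  factorials; vanishing near \<open>c = 0\<close> can thus be read back as vanishing of the
  form.\<close>

lemma expB_sums: "(\<lambda>n. (B (p * monom 1 n) q / fact n) * c ^ n) sums expB p q c"
proof -
  have "B (p * texp n c) q = (\<Sum>k\<le>n. (B (p * monom 1 k) q / fact k) * c ^ k)" for n
  proof -
    have "p * texp n c = (\<Sum>k\<le>n. Polynomial.smult (c ^ k / fact k) (p * monom 1 k))"
      unfolding texp_def sum_distrib_left
      by (intro sum.cong) (auto simp: mult_smult_right[symmetric] smult_monom)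
    then show ?thesis by (simp add: B_sum_left B_smult_left mult.commute)
  qed
  then show ?thesis using B_texp_left[of p c q] by (simp add: sums_def_le)
qed

lemma cnj_Bexp_sums: "(\<lambda>n. ((-1) ^ n * cnj (B p (q * monom 1 n)) / fact n) * c ^ n) sums cnj (Bexp p q c)"
proof -
  have "cnj (B p (q * texp n (- c))) = (\<Sum>k\<le>n. ((-1) ^ k * cnj (B p (q * monom 1 k)) / fact k) * c ^ k)" for n
  proof -
    have "q * texp n (- c) = (\<Sum>k\<le>n. Polynomial.smult ((- c) ^ k / fact k) (q * monom 1 k))"
      unfolding texp_def sum_distrib_left
      by (intro sum.cong) (auto simp: mult_smult_right[symmetric] smult_monom)
    then show ?thesis
      by (simp add: B_sum_right B_smult_right cnj_sum) (intro sum.cong, auto simp: power_minus[of c])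
  qed
  then show ?thesis using tendsto_cnj[OF B_texp_right[of p q c]] by (simp add: sums_def_le)
qed

lemma entire_power_series:
  assumes "\<And>c::complex. (\<lambda>n. a n * c ^ n) sums f c"
  shows "f holomorphic_on UNIV"
proof -
  have hol: "f holomorphic_on ball 0 (norm z + 1)" for z :: complex
    by (rule power_series_holomorphic[of 0 _ a]) (use assms in simp)
  have "f field_differentiable (at z)" for z
    by (rule holomorphic_on_imp_differentiable_at[OF hol[of z]]) auto
  then show ?thesis by (simp add: holomorphic_on_def field_differentiable_at_within)
qed

lemma expB_holomorphic: "expB p q holomorphic_on UNIV"
  by (rule entire_power_series[OF expB_sums])

lemma cnj_Bexp_holomorphic: "(\<lambda>c. cnj (Bexp p q c)) holomorphic_on UNIV"
  by (rule entire_power_series[OF cnj_Bexp_sums])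

text \<open>The expansion of the form survives the weights: it is inserted for Taylor polynomials of
  the exponentials, and the limit is taken in the left and then in the right factor. For matrices
  this says that the doubly weighted one is a product.\<close>

lemma expBexp_decompose:
  assumes dec: "\<And>p s. B p s = (\<Sum>j<r. B p (q j) * B (f j) s)"
  shows "expBexp p s c = (\<Sum>j<r. expB p (q j) c * Bexp (f j) s c)"
proof -
  have 1: "expB p s c = (\<Sum>j<r. expB p (q j) c * B (f j) s)" for s
  proof (rule LIMSEQ_unique[OF B_texp_left])
    show "(\<lambda>n. B (p * texp n c) s) \<longlonglongrightarrow> (\<Sum>j<r. expB p (q j) c * B (f j) s)"
      by (subst dec) (intro tendsto_intros B_texp_left)
  qed
  have sm: "smooth_on \<Omega> (\<lambda>z. poly p z * cnj (poly s z) * exp (c * z))"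
    by (intro smooth_on_mult smooth_poly_cnj_poly open_dom smooth_on_holomorphic holomorphic_intros)
  have "(\<lambda>n. expB p (s * texp n (- c)) c) \<longlonglongrightarrow> expBexp p s c"
    using texp_tendsto(2)[OF sm, of "- c"] by (simp add: expB_def expBexp_def mult_ac)
  moreover have "(\<lambda>n. expB p (s * texp n (- c)) c) \<longlonglongrightarrow> (\<Sum>j<r. expB p (q j) c * Bexp (f j) s c)"
    by (subst 1) (intro tendsto_intros B_texp_right)
  ultimately show ?thesis by (rule LIMSEQ_unique)
qed

text \<open>The phase \<open>exp (c z - cnj (c z))\<close> is unimodular, so only the derivatives that enter the seminorm produce
  powers of \<open>c\<close>.\<close>

lemma expBexp_bound: "\<exists>A\<ge>0. \<forall>c. norm (expBexp p q c) \<le> A * (1 + norm c) ^ (2 * N)"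
proof -
  obtain M where M: "M \<ge> 0" "\<forall>a\<le>N. \<forall>b\<le>N. \<forall>z\<in>K. norm (pdiff a b (\<lambda>z. poly p z * cnj (poly q z)) z) \<le> M"
    using smooth_on_pdiff_bounded[OF smooth_poly_cnj_poly[of p q] compact_K K_subset, of N] by (elim exE conjE)
  \<comment> \<open>One factor \<open>2 ^ (2 * N)\<close> is the Leibniz count, the other comes from
    \<open>norm (c - cnj c)\<close> and \<open>norm (c + cnj c)\<close> being at most
    \<open>2 * (1 + norm c)\<close>.\<close>
  define A where "A = C * (2 ^ (2 * N) * M * 2 ^ (2 * N))"
  have "norm (expBexp p q c) \<le> A * (1 + norm c) ^ (2 * N)" for c
  proof -
    define w where "w z = exp (c * z) * cnj (exp (- c * z))" for z
    have nw: "norm (w z) = 1" for z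
      by (simp add: w_def norm_mult flip: exp_add)
    have smw: "smooth_on \<Omega> w" unfolding w_def
      by (intro smooth_on_mult open_dom smooth_on_holomorphic smooth_on_cnj_holomorphic holomorphic_intros)
    have wb: "norm (pdiff a b w z) \<le> (2 * (1 + norm c)) ^ (2 * N)" if "a \<le> N" "b \<le> N" for a b z
    proof -
      have "norm (pdiff a b w z) = norm (c - cnj c) ^ a * norm (c + cnj c) ^ b"
        using pdiff_phase[of a b c] nw[of z] unfolding w_def by (simp add: norm_mult norm_power)
      also have "\<dots> \<le> (2 * (1 + norm c)) ^ a * (2 * (1 + norm c)) ^ b"
        using norm_triangle_ineq4[of c "cnj c"] norm_triangle_ineq[of c "cnj c"]
        by (intro mult_mono power_mono) auto
      also have "\<dots> = (2 * (1 + norm c)) ^ (a + b)" by (simp add: power_add)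
      also have "\<dots> \<le> (2 * (1 + norm c)) ^ (2 * N)" using that
        by (intro power_increasing) (auto simp: add_increasing2)
      finally show ?thesis .
    qed
    have "norm (F (\<lambda>z. poly p z * cnj (poly q z) * w z)) \<le> C * (2 ^ (2 * N) * M * (2 * (1 + norm c)) ^ (2 * N))"
    proof (rule bound)
      fix a b z assume ab: "a \<le> N" "b \<le> N" "z \<in> K"
      have "norm (pdiff a b (\<lambda>z. poly p z * cnj (poly q z) * w z) z) \<le> 2 ^ (a + b) * M * (2 * (1 + norm c)) ^ (2 * N)"
        using ab M K_subset wb
        by (intro pdiff_mult_bound[OF open_dom] smooth_on_imp_ck smooth_poly_cnj_poly smw) auto
      also have "\<dots> \<le> 2 ^ (2 * N) * M * (2 * (1 + norm c)) ^ (2 * N)"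
        using ab M by (intro mult_right_mono power_increasing) auto
      finally show "norm (pdiff a b (\<lambda>z. poly p z * cnj (poly q z) * w z) z) \<le> 2 ^ (2 * N) * M * (2 * (1 + norm c)) ^ (2 * N)" .
    qed (use M smw in \<open>auto intro!: smooth_on_mult smooth_poly_cnj_poly open_dom\<close>)
    also have "C * (2 ^ (2 * N) * M * (2 * (1 + norm c)) ^ (2 * N)) = A * (1 + norm c) ^ (2 * N)"
      unfolding A_def power_mult_distrib by (simp only: mult_ac)
    finally show ?thesis by (simp only: expBexp_def w_def)
  qed
  moreover have "A \<ge> 0" using C_nonneg M by (simp add: A_def)
  ultimately show ?thesis by blast
qed

text \<open>The identity theorem for the power series of \<open>expB g q\<close> at
  \<open>0\<close>. The index \<open>0\<close> is settled apart, since \<open>B g q\<close> is the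
  value at \<open>c = 0\<close> and \<open>powser_0_nonzero\<close> wants a nonzero coefficient of
  positive index.\<close>

lemma B_mult_zero:
  assumes "\<And>c. norm c < \<rho> \<Longrightarrow> expB g q c = 0" "\<rho> > 0"
  shows "B (g * monom 1 n) q = 0"
proof (rule ccontr)
  assume ne: "B (g * monom 1 n) q \<noteq> 0"
  have s: "(\<lambda>n. (B (g * monom 1 n) q / fact n) * (c - 0) ^ n) sums expB g q c" for c
    using expB_sums[of g q c] by simp
  have "expB g q 0 = B g q" by (simp add: expB_def B_def)
  then have n0: "n > 0" using ne assms(1)[of 0] assms(2) by (cases n) (auto simp: monom_0 one_pCons[symmetric])
  obtain t where t: "0 < t" "\<And>z. z \<in> cball 0 t - {0} \<Longrightarrow> expB g q z \<noteq> 0"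
  proof (rule powser_0_nonzero[where r = 1 and f = "expB g q" and \<xi> = 0 and m = n])
    show "(\<lambda>n. (B (g * monom 1 n) q / fact n) * (c - 0) ^ n) sums expB g q c" for c by (rule s)
  qed (use assms ne n0 in auto)
  have "expB g q (of_real (min t (\<rho> / 2))) \<noteq> 0" using t(1) assms(2) by (intro t(2)) auto
  then show False using assms t(1) by auto
qed

text \<open>By Liouville's theorem, \<open>D * E\<close> below is a polynomial in \<open>c\<close> whose degree does not depend on the polynomial
  inserted in one of the columns; so the insertion map from polynomials to coefficients has a kernel.\<close>

lemma ideal_in_kernel:
  assumes rank: "\<And>f :: nat \<Rightarrow> complex poly. \<exists>c. (\<exists>j\<le>m. c j \<noteq> 0) \<and> (\<forall>q. B (\<Sum>j\<le>m. Polynomial.smult (c j) (f j)) q = 0)"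
  shows "\<exists>g. g \<noteq> 0 \<and> (\<forall>p q. B (g * p) q = 0)"
proof -
  obtain r :: nat and f q where fq': "\<forall>j<r. \<forall>k<r. B (f j) (q k) = (if j = k then 1 else 0)"
    and dec': "\<forall>p s. B p s = (\<Sum>j<r. B p (q j) * B (f j) s)"
    using dual_system[OF rank] by (elim exE conjE)
  have fq: "B (f j) (q k) = (if j = k then 1 else 0)" if "j < r" "k < r" for j k using fq' that by simp
  have dec: "B p s = (\<Sum>j<r. B p (q j) * B (f j) s)" for p s using dec' by blast
  define A where "A c j i = expB (f i) (q j) c" for c j i
  define E where "E c = cnj (fdet r (\<lambda>k j. Bexp (f j) (q k) c))" for c
  \<comment> \<open>The determinant of \<open>A c\<close> with column \<open>i\<close> replaced by
    the values for \<open>p\<close>, written through cofactors so that linearity in \<open>p\<close>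
    is visible.\<close>
  define D where "D i p c = (\<Sum>j<r. expB p (q j) c * fcof r (A c) j i)" for i p c
  have D_det: "D i p c = fdet r (\<lambda>j l. expB ((f(i := p)) l) (q j) c)" if "i < r" for i p c
  proof -
    have "D i p c = fdet r (\<lambda>j l. if l = i then expB p (q j) c else A c j l)"
      unfolding D_def using fdet_column[OF that] by simp
    then show ?thesis by (auto simp: A_def intro!: fdet_cong)
  qed
  have E_hol: "E holomorphic_on UNIV"
    unfolding E_def cnj_fdet by (intro fdet_holomorphic cnj_Bexp_holomorphic)
  have D_hol: "D i p holomorphic_on UNIV" if "i < r" for i p
    unfolding D_det[OF that, abs_def] by (intro fdet_holomorphic expB_holomorphic)
  have A0: "fdet r (A 0) = 1"
  proof -
    have "fdet r (A 0) = fdet r (\<lambda>i j. if i = j then 1 else 0)"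
      by (intro fdet_cong) (auto simp: A_def expB_def fq[unfolded B_def])
    then show ?thesis by (simp add: fdet_id)
  qed
  have E0: "E 0 = 1"
  proof -
    have "fdet r (\<lambda>k j. Bexp (f j) (q k) 0) = fdet r (\<lambda>i j. if i = j then 1 else 0)"
      by (intro fdet_cong) (auto simp: Bexp_def fq[unfolded B_def])
    then show ?thesis by (simp add: E_def fdet_id)
  qed
  \<comment> \<open>Each of the \<open>r\<close> factors in a term of the determinant grows at most
    like \<open>(1 + norm c) ^ (2 * N)\<close>, whichever polynomial \<open>p\<close> is inserted;
    \<open>p\<close> affects only the constant.\<close>
  define n where "n = 2 * N * r"
  have DE_poly: "D i p c * E c = (\<Sum>k\<le>n. (deriv ^^ k) (\<lambda>c. D i p c * E c) 0 / fact k * c ^ k)"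
    if i: "i < r" for i p c
  proof -
    define g where "g = f(i := p)"
    obtain A' where A': "\<And>p s. A' p s \<ge> 0" "\<And>p s c. norm (expBexp p s c) \<le> A' p s * (1 + norm c) ^ (2 * N)"
      using expBexp_bound by metis
    define b where "b = (\<Sum>k<r. \<Sum>l<r. A' (g l) (q k))"
    have b: "A' (g l) (q k) \<le> b" if "k < r" "l < r" for k l
    proof -
      have "A' (g l) (q k) \<le> (\<Sum>l<r. A' (g l) (q k))" using that A' by (intro member_le_sum) auto
      also have "\<dots> \<le> b" unfolding b_def
        using that A' by (intro member_le_sum[where f = "\<lambda>k. \<Sum>l<r. A' (g l) (q k)"]) (auto intro: sum_nonneg)
      finally show ?thesis .
    qed
    have b0: "b \<ge> 0" unfolding b_def using A' by (intro sum_nonneg)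
    have nb: "norm (D i p c * E c) \<le> fact r * (b * (1 + norm c) ^ (2 * N)) ^ r" for c
    proof -
      have "norm (D i p c * E c) = norm (fdet r (\<lambda>k j. Bexp (f j) (q k) c) * fdet r (\<lambda>j l. expB (g l) (q j) c))"
        using D_det[OF i] by (simp add: norm_mult E_def g_def)
      also have "fdet r (\<lambda>k j. Bexp (f j) (q k) c) * fdet r (\<lambda>j l. expB (g l) (q j) c)
          = fdet r (\<lambda>k l. expBexp (g l) (q k) c)"
        unfolding fdet_mult[symmetric] expBexp_decompose[where r = r and q = q and f = f, OF dec] by (simp add: mult.commute)
      also have "norm \<dots> \<le> fact r * (b * (1 + norm c) ^ (2 * N)) ^ r"
      proof (rule fdet_bound)
        fix k l assume "k < r" "l < r"
        then show "norm (expBexp (g l) (q k) c) \<le> b * (1 + norm c) ^ (2 * N)"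
          using A'(2)[of "g l" "q k" c] mult_right_mono[OF b[of k l], of "(1 + norm c) ^ (2 * N)"] by auto
      qed
      finally show ?thesis .
    qed
    have hol: "(\<lambda>c. D i p c * E c) holomorphic_on UNIV" by (intro holomorphic_on_mult D_hol E_hol i)
    show ?thesis
    proof (rule Liouville_polynomial[OF hol, of 1 "fact r * b ^ r * 2 ^ n"])
      fix c :: complex assume c: "1 \<le> norm c"
      have "(b * (1 + norm c) ^ (2 * N)) ^ r = b ^ r * (1 + norm c) ^ n"
        by (simp add: power_mult_distrib n_def power_mult)
      also have "\<dots> \<le> b ^ r * (2 * norm c) ^ n"
        using c b0 by (intro mult_left_mono power_mono) auto
      finally have "(b * (1 + norm c) ^ (2 * N)) ^ r \<le> b ^ r * (2 ^ n * norm c ^ n)"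
        by (simp add: power_mult_distrib)
      then have "fact r * (b * (1 + norm c) ^ (2 * N)) ^ r \<le> fact r * (b ^ r * (2 ^ n * norm c ^ n))"
        by (intro mult_left_mono) auto
      with nb[of c] have "norm (D i p c * E c) \<le> fact r * (b ^ r * (2 ^ n * norm c ^ n))"
        by (rule order_trans)
      then show "norm (D i p c * E c) \<le> fact r * b ^ r * 2 ^ n * norm c ^ n"
        by (simp only: mult.assoc)
    qed
  qed
  \<comment> \<open>There are \<open>r\<close> columns and \<open>n + 1\<close> coefficients for
    each, hence \<open>L\<close> linear conditions on the \<open>L + 1\<close> coefficients of a
    polynomial of degree at most \<open>L\<close>.\<close>
  define L where "L = r * Suc n"
  define M where "M = (\<lambda>(i, k) j. (deriv ^^ k) (\<lambda>c. D i (monom 1 j) c * E c) 0 / fact k)"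
  obtain \<kappa> where \<kappa>: "\<exists>j\<in>{..L}. \<kappa> j \<noteq> 0"
    "\<forall>x\<in>{..<r} \<times> {..n}. (\<Sum>j\<le>L. M x j * \<kappa> j) = 0"
    using underdetermined_system[of "{..<r} \<times> {..n}" "{..L}" M]
    by (auto simp: card_cartesian_product L_def)
  define g where "g = (\<Sum>j\<le>L. monom (\<kappa> j) j)"
  have "coeff g j = \<kappa> j" if "j \<le> L" for j
    unfolding g_def coeff_sum coeff_monom using that by simp
  then have g0: "g \<noteq> 0" using \<kappa>(1) by (metis atMost_iff coeff_0)
  have expB_g: "expB g s c = (\<Sum>j\<le>L. \<kappa> j * expB (monom 1 j) s c)" for s c
  proof -
    have sm: "smooth_on \<Omega> (\<lambda>z. poly (monom 1 j) z * cnj (poly s z) * exp (c * z))" for j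
      by (intro smooth_on_mult smooth_poly_cnj_poly open_dom smooth_on_holomorphic holomorphic_intros)
    have "expB g s c = F (\<lambda>z. \<Sum>j\<le>L. \<kappa> j * (poly (monom 1 j) z * cnj (poly s z) * exp (c * z)))"
      unfolding expB_def g_def poly_sum by (simp add: poly_monom sum_distrib_left mult_ac)
    also have "\<dots> = (\<Sum>j\<le>L. F (\<lambda>z. \<kappa> j * (poly (monom 1 j) z * cnj (poly s z) * exp (c * z))))"
      by (rule sum) (intro smooth_on_cmult open_dom sm)
    also have "\<dots> = (\<Sum>j\<le>L. \<kappa> j * expB (monom 1 j) s c)"
      unfolding expB_def by (intro sum.cong refl scale sm)
    finally show ?thesis .
  qed
  have DE0: "D i g c * E c = 0" if i: "i < r" for i c
  proof -
    have Dg: "D i g c = (\<Sum>j\<le>L. \<kappa> j * D i (monom 1 j) c)"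
      unfolding D_def expB_g sum_distrib_right sum_distrib_left by (subst sum.swap) (simp add: mult_ac)
    have DE: "D i (monom 1 j) c * E c = (\<Sum>k\<le>n. M (i, k) j * c ^ k)" for j
      using DE_poly[OF i, of "monom 1 j" c] by (simp only: M_def prod.case)
    have "D i g c * E c = (\<Sum>j\<le>L. \<kappa> j * (D i (monom 1 j) c * E c))"
      unfolding Dg sum_distrib_right by (simp only: mult.assoc)
    also have "\<dots> = (\<Sum>j\<le>L. \<kappa> j * (\<Sum>k\<le>n. M (i, k) j * c ^ k))"
      by (simp only: DE)
    also have "\<dots> = (\<Sum>k\<le>n. (\<Sum>j\<le>L. M (i, k) j * \<kappa> j) * c ^ k)"
      unfolding sum_distrib_left sum_distrib_right by (subst sum.swap) (simp add: mult_ac)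
    also have "\<dots> = 0" using \<kappa>(2) i by (intro sum.neutral) auto
    finally show ?thesis .
  qed
  have contE: "isCont E 0" and contA: "isCont (\<lambda>c. fdet r (A c)) 0"
  proof -
    have "(\<lambda>c. fdet r (A c)) holomorphic_on UNIV" unfolding A_def by (intro fdet_holomorphic expB_holomorphic)
    then show "isCont (\<lambda>c. fdet r (A c)) 0" "isCont E 0"
      using E_hol holomorphic_on_imp_continuous_on continuous_on_eq_continuous_at open_UNIV by blast+
  qed
  \<comment> \<open>At \<open>c = 0\<close> both determinants are \<open>1\<close> by
    biorthogonality, so near \<open>0\<close> the factor \<open>E\<close> can be cancelled and
    Cramer's rule applies.\<close>
  have "\<forall>\<^sub>F c in nhds 0. E c \<noteq> 0 \<and> fdet r (A c) \<noteq> 0"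
  proof (intro eventually_conj)
    show "\<forall>\<^sub>F c in nhds 0. E c \<noteq> 0"
      using contE[unfolded isCont_def tendsto_at_iff_tendsto_nhds]
      by (rule tendsto_imp_eventually_ne) (simp add: E0)
    show "\<forall>\<^sub>F c in nhds 0. fdet r (A c) \<noteq> 0"
      using tendsto_at_iff_tendsto_nhds[of "\<lambda>c. fdet r (A c)" 0, THEN iffD1, OF contA[unfolded isCont_def]]
      by (rule tendsto_imp_eventually_ne) (simp add: A0)
  qed
  then obtain \<rho> where \<rho>: "\<rho> > 0" "\<And>c. dist c 0 < \<rho> \<Longrightarrow> E c \<noteq> 0 \<and> fdet r (A c) \<noteq> 0"
    unfolding eventually_nhds_metric by blast
  have zero: "expB g (q j) c = 0" if "j < r" "norm c < \<rho>" for j c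
  proof (rule fdet_cramer_zero[where v = "A c" and x = "\<lambda>j. expB g (q j) c"])
    show "fdet r (A c) \<noteq> 0" using \<rho>(2)[of c] that by simp
    show "(\<Sum>i<r. expB g (q i) c * fcof r (A c) i k) = 0" if "k < r" for k
      using DE0[OF that, of c] \<rho>(2)[of c] \<open>norm c < \<rho>\<close> by (simp add: D_def)
  qed (use that in auto)
  \<comment> \<open>The expansion of the form in terms of the \<open>q j\<close> extends the
    vanishing from these finitely many polynomials to all \<open>s\<close>.\<close>
  have mono: "B (g * monom 1 k) s = 0" for k s
  proof -
    have "B (g * monom 1 k) (q j) = 0" if "j < r" for j
      using B_mult_zero[OF zero[OF that] \<rho>(1)] by simp
    then show ?thesis by (subst dec) simp
  qed
  have "B (g * p) s = 0" for p s
  proof -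
    have "g * p = (\<Sum>k\<le>degree p. Polynomial.smult (coeff p k) (g * monom 1 k))"
      by (subst (1) poly_as_sum_of_monoms[of p, symmetric])
        (auto simp: sum_distrib_left mult_smult_right[symmetric] smult_monom intro!: sum.cong)
    then show ?thesis by (simp add: B_sum_left B_smult_left mono)
  qed
  then show ?thesis using g0 by blast
qed

end

subsection \<open>Cutoff functions of finite order\<close>

lemma ck_Un: "ck A B S f \<Longrightarrow> ck A B T f \<Longrightarrow> ck A B (S \<union> T) f"
  unfolding ck_def by blast

lemma dx_dy_Re:
  assumes "(h has_vector_derivative h') (at (Re z))"
  shows "(\<lambda>z. h (Re z)) differentiable (at z)" "dx (\<lambda>z. h (Re z)) z = h'" "dy (\<lambda>z. h (Re z)) z = 0"
proof -
  have "(Re has_derivative Re) (at z)" by (rule bounded_linear_imp_has_derivative) (rule bounded_linear_Re)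
  then have d: "((\<lambda>z. h (Re z)) has_derivative (\<lambda>v. Re v *\<^sub>R h')) (at z)"
    using assms unfolding has_vector_derivative_def by (rule has_derivative_compose)
  then show "(\<lambda>z. h (Re z)) differentiable (at z)" by (auto simp: differentiable_def)
  show "dx (\<lambda>z. h (Re z)) z = h'" "dy (\<lambda>z. h (Re z)) z = 0"
    using has_derivative_dx_dy[OF d] by auto
qed

lemma dx_dy_Im:
  assumes "(h has_vector_derivative h') (at (Im z))"
  shows "(\<lambda>z. h (Im z)) differentiable (at z)" "dx (\<lambda>z. h (Im z)) z = 0" "dy (\<lambda>z. h (Im z)) z = h'"
proof -
  have "(Im has_derivative Im) (at z)" by (rule bounded_linear_imp_has_derivative) (rule bounded_linear_Im)
  then have d: "((\<lambda>z. h (Im z)) has_derivative (\<lambda>v. Im v *\<^sub>R h')) (at z)"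
    using assms unfolding has_vector_derivative_def by (rule has_derivative_compose)
  then show "(\<lambda>z. h (Im z)) differentiable (at z)" by (auto simp: differentiable_def)
  show "dx (\<lambda>z. h (Im z)) z = 0" "dy (\<lambda>z. h (Im z)) z = h'"
    using has_derivative_dx_dy[OF d] by auto
qed

lemma ck_Re_0:
  assumes "\<And>k x. k \<le> A \<Longrightarrow> (hs k has_vector_derivative hs (Suc k) x) (at x)"
  shows "ck A 0 UNIV (\<lambda>z. hs 0 (Re z))"
  using assms
proof (induction A arbitrary: hs)
  case 0
  then show ?case using dx_dy_Re(1)[OF 0[of 0]] by (simp add: ck_00)
next
  case (Suc A)
  have "dx (\<lambda>z. hs 0 (Re z)) = (\<lambda>z. hs (Suc 0) (Re z))"
    using dx_dy_Re(2)[OF Suc.prems[of 0]] by auto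
  moreover have "ck A 0 UNIV (\<lambda>z. hs (Suc 0) (Re z))"
    using Suc.prems by (intro Suc.IH[of "\<lambda>k. hs (Suc k)"]) auto
  ultimately show ?case using dx_dy_Re(1)[OF Suc.prems[of 0]] by (simp add: ck_Suc_left ck_00)
qed

lemma ck_Re:
  assumes "\<And>k x. k \<le> A \<Longrightarrow> (hs k has_vector_derivative hs (Suc k) x) (at x)"
  shows "ck A B UNIV (\<lambda>z. hs 0 (Re z))"
proof (cases B)
  case 0
  then show ?thesis using ck_Re_0[of A hs] assms by simp
next
  case (Suc B')
  have "dy (\<lambda>z. hs 0 (Re z)) = (\<lambda>z. 0)" using dx_dy_Re(3)[OF assms[of 0]] by auto
  then show ?thesis using ck_Re_0[of A hs] assms by (simp add: Suc ck_Suc_right ck_const)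
qed

lemma ck_Im:
  assumes "\<And>k x. k \<le> B \<Longrightarrow> (hs k has_vector_derivative hs (Suc k) x) (at x)"
  shows "ck A B UNIV (\<lambda>z. hs 0 (Im z))"
  using assms
proof (induction B arbitrary: hs)
  case 0
  have d: "dx (\<lambda>z. hs 0 (Im z)) = (\<lambda>z. 0)" using dx_dy_Im(2)[OF 0[of 0]] by auto
  then show ?case using dx_dy_Im(1)[OF 0[of 0]]
    by (cases A) (auto simp: ck_00 ck_Suc_left d ck_const)
next
  case (Suc B)
  have d: "dx (\<lambda>z. hs 0 (Im z)) = (\<lambda>z. 0)" "dy (\<lambda>z. hs 0 (Im z)) = (\<lambda>z. hs (Suc 0) (Im z))"
    using dx_dy_Im(2,3)[OF Suc.prems[of 0]] by auto
  have "ck A 0 UNIV (\<lambda>z. hs 0 (Im z))"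
    using dx_dy_Im(1)[OF Suc.prems[of 0]] by (cases A) (auto simp: ck_00 ck_Suc_left d ck_const)
  moreover have "ck A B UNIV (\<lambda>z. hs (Suc 0) (Im z))"
    using Suc.prems by (intro Suc.IH[of "\<lambda>k. hs (Suc k)"]) auto
  ultimately show ?case by (simp add: ck_Suc_right d)
qed

lemma DERIV_glue:
  fixes p q :: "real \<Rightarrow> real"
  assumes "(p has_real_derivative d) (at c)" "(q has_real_derivative d) (at c)" "p c = q c"
  shows "((\<lambda>x. if x \<le> c then p x else q x) has_real_derivative d) (at c)"
  unfolding has_field_derivative_iff
proof (rule filterlim_split_at)
  let ?f = "\<lambda>x. if x \<le> c then p x else q x"
  have "((\<lambda>y. (p y - p c) / (y - c)) \<longlongrightarrow> d) (at_left c)"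
    using assms(1) unfolding has_field_derivative_iff by (rule filterlim_mono) (auto simp: at_le)
  then show "((\<lambda>y. (?f y - ?f c) / (y - c)) \<longlongrightarrow> d) (at_left c)"
    by (rule Lim_transform_eventually) (auto simp: eventually_at_left_field intro!: exI[of _ "c - 1"])
  have "((\<lambda>y. (q y - q c) / (y - c)) \<longlongrightarrow> d) (at_right c)"
    using assms(2) unfolding has_field_derivative_iff by (rule filterlim_mono) (auto simp: at_le)
  then show "((\<lambda>y. (?f y - ?f c) / (y - c)) \<longlongrightarrow> d) (at_right c)"
    by (rule Lim_transform_eventually) (auto simp: eventually_at_right_field assms(3) intro!: exI[of _ "c + 1"])
qed

text \<open>Each derivative lowers the multiplicity of a root by at most one.\<close>

lemma poly_higher_pderiv_root:
  fixes P :: "'a::field poly"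
  assumes "[:- c, 1:] ^ m dvd P" "k < m"
  shows "poly ((pderiv ^^ k) P) c = 0"
proof -
  have step: "[:- c, 1:] ^ n dvd pderiv P" if dvd: "[:- c, 1:] ^ Suc n dvd P" for P :: "'a poly" and n
  proof -
    obtain R where "P = [:- c, 1:] ^ Suc n * R" using dvd by blast
    then have "pderiv P = [:- c, 1:] ^ n * ([:- c, 1:] * pderiv R + of_nat (Suc n) * R)"
      by (simp only: pderiv_mult pderiv_power_Suc) (simp add: pderiv_pCons algebra_simps of_nat_poly)
    then show ?thesis by simp
  qed
  have "[:- c, 1:] ^ (m - k) dvd (pderiv ^^ k) P" using assms(2)
  proof (induction k)
    case (Suc k)
    then have "[:- c, 1:] ^ Suc (m - Suc k) dvd (pderiv ^^ k) P" by (simp add: Suc_diff_Suc del: power_Suc)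
    then show ?case using step by simp
  qed (use assms in simp)
  then have "[:- c, 1:] dvd (pderiv ^^ k) P"
    using assms(2) by (meson dvd_power dvd_trans zero_less_diff)
  then show ?thesis by (simp add: poly_eq_0_iff_dvd)
qed

text \<open>\<open>1 - (1 - x ^ m) ^ m\<close> is flat of order \<open>m\<close> at its value \<open>0\<close> in \<open>0\<close> and at its value \<open>1\<close> in \<open>1\<close>.\<close>

lemma smooth_step_exists:
  "\<exists>g :: nat \<Rightarrow> real \<Rightarrow> real. (\<forall>k\<le>n. \<forall>x. (g k has_real_derivative g (Suc k) x) (at x)) \<and>
    (\<forall>x\<le>0. g 0 x = 0) \<and> (\<forall>x\<ge>1. g 0 x = 1)"
proof -
  \<comment> \<open>Derivatives of order up to \<open>n + 1\<close> have to match at both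
    joints.\<close>
  define m where "m = n + 2"
  define Q :: "real poly" where "Q = 1 - (1 - [:0, 1:] ^ m) ^ m"
  define g where "g k x = (if x \<le> 0 then 0 else if x \<le> 1 then poly ((pderiv ^^ k) Q) x else if k = 0 then 1 else 0)" for k x
  \<comment> \<open>\<open>1 - y\<close> divides \<open>1 - y ^ m\<close>, here with
    \<open>y = 1 - x ^ m\<close>.\<close>
  have "[:0, 1:] ^ m dvd Q"
    unfolding Q_def using one_diff_power_eq[of "1 - [:0, 1:] ^ m :: real poly" m] by simp
  then have Q0: "poly ((pderiv ^^ k) Q) 0 = 0" if "k < m" for k
    using poly_higher_pderiv_root[of 0 m Q k] that by simp
  have "[:-1, 1:] dvd (1 - [:0, 1:] ^ m :: real poly)" by (simp add: poly_eq_0_iff_dvd[symmetric])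
  then have "[:-1, 1:] ^ m dvd (1 - [:0, 1:] ^ m :: real poly) ^ m" by (rule dvd_power_same)
  then have 1: "poly ((pderiv ^^ k) ((1 - [:0, 1:] ^ m) ^ m)) (1::real) = 0" if "k < m" for k
    using poly_higher_pderiv_root[of 1 m _ k] that by simp
  have "(pderiv ^^ k) Q = (if k = 0 then 1 else 0) - (pderiv ^^ k) ((1 - [:0, 1:] ^ m) ^ m)" for k
    by (induction k) (auto simp: Q_def pderiv_diff)
  then have Q1: "poly ((pderiv ^^ k) Q) 1 = (if k = 0 then 1 else 0)" if "k < m" for k
    using 1[OF that] by simp
  have dQ: "((\<lambda>x. poly ((pderiv ^^ k) Q) x) has_real_derivative poly ((pderiv ^^ Suc k) Q) x) (at x)" for k x
    using poly_DERIV[of "(pderiv ^^ k) Q" x] by simp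
  have "(g k has_real_derivative g (Suc k) x) (at x)" if k: "k \<le> n" for k x
  proof -
    have km: "k < m" "Suc k < m" using k by (auto simp: m_def)
    consider "x < 0" | "x = 0" | "0 < x" "x < 1" | "x = 1" | "1 < x" by linarith
    then show ?thesis
    proof cases
      case 1
      have "((\<lambda>x. 0) has_real_derivative g (Suc k) x) (at x)" using 1 by (simp add: g_def)
      then show ?thesis
        by (rule has_field_derivative_transform_within_open[where S = "{..<0}"]) (use 1 in \<open>auto simp: g_def\<close>)
    next
      case 2
      have d: "((\<lambda>x. poly ((pderiv ^^ k) Q) x) has_real_derivative 0) (at 0)"
        using dQ[of k 0] by (simp only: Q0[OF km(2)])
      have "((\<lambda>x. if x \<le> 0 then 0 else poly ((pderiv ^^ k) Q) x) has_real_derivative 0) (at 0)"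
        by (rule DERIV_glue[OF DERIV_const d]) (simp add: Q0[OF km(1)])
      then have "((\<lambda>x. if x \<le> 0 then 0 else poly ((pderiv ^^ k) Q) x) has_real_derivative g (Suc k) x) (at x)"
        using 2 by (simp add: g_def)
      then show ?thesis
        by (rule has_field_derivative_transform_within_open[where S = "{..<1}"]) (use 2 in \<open>auto simp: g_def\<close>)
    next
      case 3
      have "((\<lambda>x. poly ((pderiv ^^ k) Q) x) has_real_derivative g (Suc k) x) (at x)"
        using dQ[of k x] 3 by (simp add: g_def)
      then show ?thesis
        by (rule has_field_derivative_transform_within_open[where S = "{0<..<1}"]) (use 3 in \<open>auto simp: g_def\<close>)
    next
      case 4
      have "((\<lambda>x. if x \<le> 1 then poly ((pderiv ^^ k) Q) x else if k = 0 then 1 else 0) has_real_derivative g (Suc k) x) (at x)"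
      proof -
        have d: "((\<lambda>x. poly ((pderiv ^^ k) Q) x) has_real_derivative 0) (at 1)"
          using dQ[of k 1] Q1[OF km(2)] by (simp only: nat.distinct if_False)
        have "((\<lambda>x. if x \<le> 1 then poly ((pderiv ^^ k) Q) x else if k = 0 then 1 else 0) has_real_derivative 0) (at 1)"
          by (rule DERIV_glue[OF d DERIV_const]) (rule Q1[OF km(1)])
        moreover have "g (Suc k) 1 = 0" unfolding g_def using Q1[OF km(2)] by (simp del: funpow.simps)
        ultimately show ?thesis using 4 by simp
      qed
      then show ?thesis
        by (rule has_field_derivative_transform_within_open[where S = "{0<..}"]) (use 4 in \<open>auto simp: g_def\<close>)
    next
      case 5
      have "((\<lambda>x. if k = 0 then 1 else 0) has_real_derivative g (Suc k) x) (at x)" using 5 by (simp add: g_def)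
      then show ?thesis
        by (rule has_field_derivative_transform_within_open[where S = "{1<..}"]) (use 5 in \<open>auto simp: g_def\<close>)
    qed
  qed
  moreover have "g 0 x = 1" if "x \<ge> 1" for x using that Q1[of 0] by (auto simp: g_def m_def)
  ultimately show ?thesis by (intro exI[of _ g]) (auto simp: g_def)
qed

text \<open>A product of four steps, two in \<open>Re z\<close> and two in \<open>Im z\<close>,
  equal to \<open>1\<close> on the square of half side \<open>r\<close> around \<open>a\<close> and
  to \<open>0\<close> off the one of half side \<open>2 * r\<close>. At distance
  \<open>4 * r\<close> one of the two coordinates differs by at least \<open>2 * r\<close>, since
  the modulus is at most the sum of the coordinates in absolute value.\<close>

lemma bump_exists:
  assumes "r > 0"
  shows "\<exists>\<beta>. ck n n UNIV \<beta> \<and> (\<forall>z. dist a z \<le> r \<longrightarrow> \<beta> z = 1) \<and> (\<forall>z. dist a z \<ge> 4 * r \<longrightarrow> \<beta> z = 0)"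
proof -
  obtain g :: "nat \<Rightarrow> real \<Rightarrow> real" where g: "\<And>k x. k \<le> n \<Longrightarrow> (g k has_real_derivative g (Suc k) x) (at x)"
    and g0: "\<And>x. x \<le> 0 \<Longrightarrow> g 0 x = 0" and g1: "\<And>x. x \<ge> 1 \<Longrightarrow> g 0 x = 1"
    using smooth_step_exists[of n] by blast
  define hs where "hs s t k x = complex_of_real (s ^ k * g k (s * x + t))" for s t k x
  have der: "(hs s t k has_vector_derivative hs s t (Suc k) x) (at x)" if "k \<le> n" for s t k x
  proof -
    have "((\<lambda>x. s * x + t) has_real_derivative s) (at x)" by (auto intro!: derivative_eq_intros)
    from DERIV_chain2[OF g[OF that, of "s * x + t"] this]
    have "((\<lambda>x. s ^ k * g k (s * x + t)) has_real_derivative s ^ k * (g (Suc k) (s * x + t) * s)) (at x)"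
      by (rule DERIV_cmult)
    then have "((\<lambda>x. s ^ k * g k (s * x + t)) has_real_derivative s ^ Suc k * g (Suc k) (s * x + t)) (at x)"
      by (simp add: mult_ac)
    from has_vector_derivative_of_real[OF this] show ?thesis
      by (simp add: hs_def[abs_def])
  qed
  have h1: "1 / r * x + (2 - y / r) = 2 - (y - x) / r" "- 1 / r * x + (2 + y / r) = 2 - (x - y) / r" for x y
    by (simp_all add: diff_divide_distrib)
  define \<beta> where "\<beta> z = hs (1 / r) (2 - Re a / r) 0 (Re z) * hs (- 1 / r) (2 + Re a / r) 0 (Re z) *
     (hs (1 / r) (2 - Im a / r) 0 (Im z) * hs (- 1 / r) (2 + Im a / r) 0 (Im z))" for z
  have "ck n n UNIV \<beta>" unfolding \<beta>_def
    by (intro ck_mult open_UNIV ck_Re ck_Im der)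
  moreover have "\<beta> z = 1" if "dist a z \<le> r" for z
  proof -
    have "\<bar>Re a - Re z\<bar> \<le> r" "\<bar>Im a - Im z\<bar> \<le> r"
      using that abs_Re_le_cmod[of "a - z"] abs_Im_le_cmod[of "a - z"] by (auto simp: dist_norm)
    then have "g 0 (1 / r * Re z + (2 - Re a / r)) = 1" "g 0 (- 1 / r * Re z + (2 + Re a / r)) = 1"
      "g 0 (1 / r * Im z + (2 - Im a / r)) = 1" "g 0 (- 1 / r * Im z + (2 + Im a / r)) = 1"
      unfolding h1 using assms by (auto intro!: g1 simp: abs_le_iff pos_divide_le_eq pos_le_divide_eq minus_le_iff)
    then show ?thesis by (simp only: \<beta>_def hs_def) simp
  qed
  moreover have "\<beta> z = 0" if z: "dist a z \<ge> 4 * r" for z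
  proof -
    have "4 * r \<le> \<bar>Re a - Re z\<bar> + \<bar>Im a - Im z\<bar>"
      using z cmod_le[of "a - z"] by (simp add: dist_norm)
    then consider "Re z \<le> Re a - 2 * r" | "Re z \<ge> Re a + 2 * r" | "Im z \<le> Im a - 2 * r" | "Im z \<ge> Im a + 2 * r"
      by linarith
    then show ?thesis
    proof cases
      case 1
      then have "g 0 (1 / r * Re z + (2 - Re a / r)) = 0"
        unfolding h1 by (intro g0) (use assms in \<open>simp add: pos_le_divide_eq pos_divide_le_eq add_nonpos_nonpos\<close>)
      then have "hs (1 / r) (2 - Re a / r) 0 (Re z) = 0" by (simp only: hs_def) simp
      then show ?thesis by (simp add: \<beta>_def)
    next
      case 2
      then have "g 0 (- 1 / r * Re z + (2 + Re a / r)) = 0"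
        unfolding h1 by (intro g0) (use assms in \<open>simp add: pos_le_divide_eq pos_divide_le_eq add_nonpos_nonpos\<close>)
      then have "hs (- 1 / r) (2 + Re a / r) 0 (Re z) = 0" by (simp only: hs_def) simp
      then show ?thesis by (simp add: \<beta>_def)
    next
      case 3
      then have "g 0 (1 / r * Im z + (2 - Im a / r)) = 0"
        unfolding h1 by (intro g0) (use assms in \<open>simp add: pos_le_divide_eq pos_divide_le_eq add_nonpos_nonpos\<close>)
      then have "hs (1 / r) (2 - Im a / r) 0 (Im z) = 0" by (simp only: hs_def) simp
      then show ?thesis by (simp add: \<beta>_def)
    next
      case 4
      then have "g 0 (- 1 / r * Im z + (2 + Im a / r)) = 0"
        unfolding h1 by (intro g0) (use assms in \<open>simp add: pos_le_divide_eq pos_divide_le_eq add_nonpos_nonpos\<close>)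
      then have "hs (- 1 / r) (2 + Im a / r) 0 (Im z) = 0" by (simp only: hs_def) simp
      then show ?thesis by (simp add: \<beta>_def)
    qed
  qed
  ultimately show ?thesis by blast
qed

text \<open>\<open>1 - \<kappa>\<close> is the product of the factors \<open>1 - \<beta> a\<close>,
  so \<open>\<kappa>\<close> is \<open>1\<close> as soon as one bump is, and \<open>0\<close> where
  all bumps are. The value \<open>1\<close> is wanted on an open \<open>U\<close> around
  \<open>K\<close> because derivatives on \<open>K\<close> depend on a neighbourhood.\<close>

lemma cutoff_exists:
  assumes "compact K" "open S" "K \<subseteq> S"
  obtains \<kappa> L U where "ck n n UNIV \<kappa>" "compact L" "L \<subseteq> S" "\<forall>z. z \<notin> L \<longrightarrow> \<kappa> z = 0"
    "open U" "K \<subseteq> U" "U \<subseteq> S" "\<forall>z\<in>U. \<kappa> z = 1"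
proof -
  have "\<forall>a\<in>K. \<exists>r>0. cball a (4 * r) \<subseteq> S"
  proof
    fix a assume "a \<in> K"
    then obtain e where "e > 0" "cball a e \<subseteq> S" using assms open_contains_cball by blast
    then show "\<exists>r>0. cball a (4 * r) \<subseteq> S" by (intro exI[of _ "e / 4"]) auto
  qed
  then obtain r where r: "\<And>a. a \<in> K \<Longrightarrow> r a > 0" "\<And>a. a \<in> K \<Longrightarrow> cball a (4 * r a) \<subseteq> S" by metis
  have "K \<subseteq> (\<Union>a\<in>K. ball a (r a))" using r(1) by force
  then obtain T where T: "T \<subseteq> K" "finite T" "K \<subseteq> (\<Union>a\<in>T. ball a (r a))"
    using compactE_image[OF assms(1), of K "\<lambda>a. ball a (r a)"] by auto
  have "\<forall>a\<in>K. \<exists>\<beta>. ck n n UNIV \<beta> \<and> (\<forall>z. dist a z \<le> r a \<longrightarrow> \<beta> z = 1) \<and> (\<forall>z. dist a z \<ge> 4 * r a \<longrightarrow> \<beta> z = 0)"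
    using bump_exists r(1) by blast
  then obtain \<beta> where \<beta>: "\<And>a. a \<in> K \<Longrightarrow> ck n n UNIV (\<beta> a)"
    "\<And>a z. a \<in> K \<Longrightarrow> dist a z \<le> r a \<Longrightarrow> \<beta> a z = 1" "\<And>a z. a \<in> K \<Longrightarrow> dist a z \<ge> 4 * r a \<Longrightarrow> \<beta> a z = 0"
    by metis
  define \<kappa> where "\<kappa> z = 1 - (\<Prod>a\<in>T. 1 - \<beta> a z)" for z
  have "ck n n UNIV (\<lambda>z. \<Prod>a\<in>T'. 1 - \<beta> a z)" if "T' \<subseteq> K" for T'
    using that
  proof (induction T' rule: infinite_finite_induct)
    case (insert x T')
    then show ?case by (simp add: ck_mult ck_minus ck_const \<beta>(1))
  qed (auto simp: ck_const)
  then have "ck n n UNIV \<kappa>" unfolding \<kappa>_def using T by (intro ck_minus ck_const open_UNIV) auto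
  moreover have "compact (\<Union>a\<in>T. cball a (4 * r a))" using T by (intro compact_UN) auto
  moreover have "(\<Union>a\<in>T. cball a (4 * r a)) \<subseteq> S" using r(2) T by blast
  moreover have "\<kappa> z = 0" if "z \<notin> (\<Union>a\<in>T. cball a (4 * r a))" for z
  proof -
    have "\<beta> a z = 0" if "a \<in> T" for a using that \<open>z \<notin> _\<close> T \<beta>(3)[of a z] by force
    then show ?thesis by (simp add: \<kappa>_def)
  qed
  moreover have "open (\<Union>a\<in>T. ball a (r a))" by auto
  moreover have "(\<Union>a\<in>T. ball a (r a)) \<subseteq> S"
  proof -
    have "ball a (r a) \<subseteq> cball a (4 * r a)" if "a \<in> T" for a using r(1)[of a] that T by auto
    then show ?thesis using r(2) T by blast
  qed
  moreover have "\<kappa> z = 1" if zT: "z \<in> (\<Union>a\<in>T. ball a (r a))" for z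
  proof -
    obtain a where a: "a \<in> T" "dist a z < r a" using zT by auto
    then have "\<beta> a z = 1" using \<beta>(2)[of a z] T by force
    then have "(\<Prod>a\<in>T. 1 - \<beta> a z) = 0" using a T by (intro prod_zero) auto
    then show ?thesis by (simp add: \<kappa>_def)
  qed
  ultimately show ?thesis using T(3)
    by (intro that[of \<kappa> "\<Union>a\<in>T. cball a (4 * r a)" "\<Union>a\<in>T. ball a (r a)"]) blast+
qed

text \<open>Multiplying by a cutoff changes nothing near \<open>K\<close>, where the seminorms of
  \<open>F\<close> live, and allows an extension by \<open>0\<close> to the plane, where polynomial
  approximation takes place.\<close>

lemma ck_extension:
  assumes "open S" "compact K" "K \<subseteq> S" "ck n n S \<psi>"
  obtains \<Psi> L U where "ck n n UNIV \<Psi>" "compact L" "\<forall>z. z \<notin> L \<longrightarrow> \<Psi> z = 0"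
    "open U" "K \<subseteq> U" "U \<subseteq> S" "\<forall>z\<in>U. \<Psi> z = \<psi> z"
proof -
  obtain \<kappa> L U where \<kappa>: "ck n n UNIV \<kappa>" "compact L" "L \<subseteq> S" "\<forall>z. z \<notin> L \<longrightarrow> \<kappa> z = 0"
    "open U" "K \<subseteq> U" "U \<subseteq> S" "\<forall>z\<in>U. \<kappa> z = 1"
    by (rule cutoff_exists[OF assms(2,1,3), where n = n])
  define \<Psi> where "\<Psi> z = (if z \<in> S then \<psi> z * \<kappa> z else 0)" for z
  have "ck n n S (\<lambda>z. \<psi> z * \<kappa> z)"
    by (rule ck_mult[OF assms(1,4) ck_mono[OF \<kappa>(1) order_refl order_refl subset_UNIV]])
  then have "ck n n S \<Psi>" by (rule ck_cong[OF assms(1), rotated]) (simp add: \<Psi>_def)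
  moreover have "ck n n (- L) \<Psi>"
  proof (rule ck_cong)
    show "open (- L)" by (rule open_Compl[OF compact_imp_closed[OF \<kappa>(2)]])
    then show "ck n n (- L) (\<lambda>z. 0)" by (rule ck_const)
  qed (simp add: \<Psi>_def \<kappa>(4))
  ultimately have "ck n n (S \<union> - L) \<Psi>" by (rule ck_Un)
  moreover have "S \<union> - L = UNIV" using \<kappa>(3) by blast
  ultimately have "ck n n UNIV \<Psi>" by simp
  then show ?thesis
  proof (rule that)
    show "\<forall>z. z \<notin> L \<longrightarrow> \<Psi> z = 0" using \<kappa>(4) by (simp add: \<Psi>_def)
    show "\<forall>z\<in>U. \<Psi> z = \<psi> z" using \<kappa>(7,8) by (auto simp: \<Psi>_def)
  qed (use \<kappa> in auto)
qed

subsection \<open>Density of polynomials in \<open>z\<close> and \<open>cnj z\<close>\<close>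

text \<open>The factorials make differentiation a shift of indices; the translation by
  \<open>R\<close> makes the functions with positive exponents vanish on the lines
  \<open>Re z = - R\<close> and \<open>Im z = - R\<close>.\<close>

definition shifted_monom :: "real \<Rightarrow> nat \<Rightarrow> nat \<Rightarrow> complex \<Rightarrow> complex" where
  "shifted_monom R j k z = of_real ((Re z + R) ^ j / fact j) * of_real ((Im z + R) ^ k / fact k)"

inductive_set xypoly :: "real \<Rightarrow> (complex \<Rightarrow> complex) set" for R where
  monom: "(\<lambda>z. c * shifted_monom R j k z) \<in> xypoly R"
| add: "f \<in> xypoly R \<Longrightarrow> g \<in> xypoly R \<Longrightarrow> (\<lambda>z. f z + g z) \<in> xypoly R"

lemma shifted_power_derivative:
  "((\<lambda>x. complex_of_real ((x + R) ^ j / fact j)) has_vector_derivative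
     (case j of 0 \<Rightarrow> 0 | Suc j' \<Rightarrow> of_real ((x + R) ^ j' / fact j'))) (at x)"
proof -
  have "((\<lambda>x. (x + R) ^ j / fact j) has_real_derivative (case j of 0 \<Rightarrow> 0 | Suc j' \<Rightarrow> (x + R) ^ j' / fact j')) (at x)"
  proof (cases j)
    case (Suc j')
    have "((\<lambda>x. x + R) has_real_derivative 1) (at x)" by (auto intro!: derivative_eq_intros)
    from DERIV_power[OF this, of "Suc j'"]
    have "((\<lambda>x. (x + R) ^ Suc j') has_real_derivative real (Suc j') * (x + R) ^ j') (at x)"
      by (simp del: power_Suc of_nat_Suc)
    then have "((\<lambda>x. (x + R) ^ Suc j' / fact (Suc j')) has_real_derivative (real (Suc j') * (x + R) ^ j') / fact (Suc j')) (at x)"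
      by (rule DERIV_cdivide)
    moreover have "(real (Suc j') * (x + R) ^ j') / fact (Suc j') = (x + R) ^ j' / fact j'"
      by (simp add: field_simps del: of_nat_Suc)
    ultimately show ?thesis by (simp add: Suc)
  qed auto
  then have "((\<lambda>x. complex_of_real ((x + R) ^ j / fact j)) has_vector_derivative
      complex_of_real (case j of 0 \<Rightarrow> 0 | Suc j' \<Rightarrow> (x + R) ^ j' / fact j')) (at x)"
    by (rule has_vector_derivative_of_real)
  then show ?thesis by (cases j) (simp_all only: nat.case of_real_0)
qed

lemma shifted_monom_derivatives:
  shows "shifted_monom R j k differentiable (at z)"
    "dx (shifted_monom R j k) z = (case j of 0 \<Rightarrow> 0 | Suc j' \<Rightarrow> shifted_monom R j' k z)"
    "dy (shifted_monom R j k) z = (case k of 0 \<Rightarrow> 0 | Suc k' \<Rightarrow> shifted_monom R j k' z)"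
proof -
  note re = dx_dy_Re[OF shifted_power_derivative, of R j z]
  note im = dx_dy_Im[OF shifted_power_derivative, of R k z]
  have eq: "shifted_monom R j k = (\<lambda>z. complex_of_real ((Re z + R) ^ j / fact j) * complex_of_real ((Im z + R) ^ k / fact k))"
    by (simp add: shifted_monom_def[abs_def])
  show "shifted_monom R j k differentiable (at z)"
    unfolding eq using re(1) im(1) by (rule differentiable_mult)
  show "dx (shifted_monom R j k) z = (case j of 0 \<Rightarrow> 0 | Suc j' \<Rightarrow> shifted_monom R j' k z)"
    unfolding eq dx_dy_mult[OF re(1) im(1)] re(2) im(2) by (cases j) (auto simp: shifted_monom_def)
  show "dy (shifted_monom R j k) z = (case k of 0 \<Rightarrow> 0 | Suc k' \<Rightarrow> shifted_monom R j k' z)"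
    unfolding eq dx_dy_mult[OF re(1) im(1)] re(3) im(3) by (cases k) (auto simp: shifted_monom_def)
qed

lemma pdiff_zero_fun: "pdiff a b (\<lambda>z. 0) = (\<lambda>z. 0)"
  using pdiff_holomorphic[of UNIV "\<lambda>z. 0" _ a b 0] by (auto simp: fun_eq_iff)

lemma pdiff_shifted_monom:
  "pdiff a b (shifted_monom R j k) = (\<lambda>z. if a \<le> j \<and> b \<le> k then shifted_monom R (j - a) (k - b) z else 0)"
proof -
  have z: "dx (\<lambda>z. 0) = (\<lambda>z. 0)" "dy (\<lambda>z. 0) = (\<lambda>z. 0)"
    using pdiff_zero_fun[of 1 0] pdiff_zero_fun[of 0 1] by (simp_all add: pdiff_def)
  have b0: "pdiff 0 b (shifted_monom R j k) = (\<lambda>z. if b \<le> k then shifted_monom R j (k - b) z else 0)"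
  proof (induction b)
    case (Suc b)
    show ?case
    proof (cases "b \<le> k")
      case True
      then have "pdiff 0 (Suc b) (shifted_monom R j k) = dy (shifted_monom R j (k - b))"
        unfolding pdiff_0_Suc Suc.IH by simp
      then show ?thesis using True
        by (cases "k - b") (auto simp: fun_eq_iff shifted_monom_derivatives(3) Suc_le_eq diff_Suc)
    next
      case False
      then show ?thesis unfolding pdiff_0_Suc Suc.IH by (simp add: z)
    qed
  qed simp
  show ?thesis
  proof (induction a)
    case 0
    then show ?case by (auto simp: b0 fun_eq_iff)
  next
    case (Suc a)
    show ?case
    proof (cases "a \<le> j \<and> b \<le> k")
      case True
      then have "pdiff (Suc a) b (shifted_monom R j k) = dx (shifted_monom R (j - a) (k - b))"
        unfolding pdiff_Suc_left Suc.IH by simp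
      then show ?thesis using True
        by (cases "j - a") (auto simp: fun_eq_iff shifted_monom_derivatives(2) Suc_le_eq diff_Suc)
    next
      case False
      then show ?thesis unfolding pdiff_Suc_left Suc.IH by (auto simp: z)
    qed
  qed
qed

lemma smooth_on_shifted_monom: "smooth_on UNIV (shifted_monom R j k)"
  unfolding smooth_on_def
proof (intro allI ballI)
  fix a b z
  show "pdiff a b (shifted_monom R j k) differentiable at z"
  proof (cases "a \<le> j \<and> b \<le> k")
    case True
    then have "pdiff a b (shifted_monom R j k) = shifted_monom R (j - a) (k - b)"
      unfolding pdiff_shifted_monom by simp
    then show ?thesis using shifted_monom_derivatives(1) by simp
  next
    case False
    then have "pdiff a b (shifted_monom R j k) = (\<lambda>z. 0)"
      unfolding pdiff_shifted_monom by (auto simp: fun_eq_iff)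
    then show ?thesis by simp
  qed
qed

lemma xypoly_smooth: "f \<in> xypoly R \<Longrightarrow> smooth_on UNIV f"
  by (induction rule: xypoly.induct)
    (auto intro: smooth_on_cmult smooth_on_shifted_monom smooth_on_add)

text \<open>Raising both exponents by \<open>n\<close> is an antiderivative of order
  \<open>n\<close> in each variable. A derivative that falls short of order \<open>n\<close> in one
  variable keeps a positive exponent there, so it vanishes on the edge from which integration in
  that variable will start.\<close>

lemma xypoly_antiderivative:
  assumes "f \<in> xypoly R"
  shows "\<exists>P\<in>xypoly R. pdiff n n P = f \<and> (\<forall>b<n. \<forall>z. Im z = - R \<longrightarrow> pdiff n b P z = 0) \<and>
    (\<forall>a<n. \<forall>b\<le>n. \<forall>z. Re z = - R \<longrightarrow> pdiff a b P z = 0)"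
  using assms
proof (induction rule: xypoly.induct)
  case (monom c j k)
  define P where "P = (\<lambda>z. c * shifted_monom R (j + n) (k + n) z)"
  have pd: "pdiff a b P z = c * pdiff a b (shifted_monom R (j + n) (k + n)) z" for a b z
    unfolding P_def by (rule pdiff_cmult[OF open_UNIV smooth_on_imp_ck[OF smooth_on_shifted_monom]]) auto
  have "P \<in> xypoly R" unfolding P_def by (rule xypoly.monom)
  then show ?case
    by (intro bexI[of _ P] conjI) (auto simp: fun_eq_iff pd pdiff_shifted_monom, auto simp: shifted_monom_def)
next
  case (add f g)
  then obtain P Q where P: "P \<in> xypoly R" "pdiff n n P = f" "\<forall>b<n. \<forall>z. Im z = - R \<longrightarrow> pdiff n b P z = 0"
      "\<forall>a<n. \<forall>b\<le>n. \<forall>z. Re z = - R \<longrightarrow> pdiff a b P z = 0"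
    and Q: "Q \<in> xypoly R" "pdiff n n Q = g" "\<forall>b<n. \<forall>z. Im z = - R \<longrightarrow> pdiff n b Q z = 0"
      "\<forall>a<n. \<forall>b\<le>n. \<forall>z. Re z = - R \<longrightarrow> pdiff a b Q z = 0" by blast
  have "pdiff a b (\<lambda>z. P z + Q z) z = pdiff a b P z + pdiff a b Q z" for a b z
    using P Q by (intro pdiff_add[OF open_UNIV] smooth_on_imp_ck xypoly_smooth) auto
  then show ?case using P Q xypoly.add[OF P(1) Q(1)]
    by (intro bexI[of _ "\<lambda>z. P z + Q z"]) (auto simp: fun_eq_iff)
qed

lemma xypoly_cmult: "f \<in> xypoly R \<Longrightarrow> (\<lambda>z. c * f z) \<in> xypoly R"
proof (induction rule: xypoly.induct)
  case (monom c' j k)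
  show ?case using xypoly.monom[of "c * c'" R j k] by (simp add: mult.assoc)
next
  case (add f g)
  show ?case using xypoly.add[OF add.IH] by (simp add: algebra_simps)
qed

lemma xypoly_mult:
  assumes "f \<in> xypoly R" "g \<in> xypoly R"
  shows "(\<lambda>z. f z * g z) \<in> xypoly R"
  using assms(1)
proof (induction rule: xypoly.induct)
  case (monom c j k)
  show ?case using assms(2)
  proof (induction rule: xypoly.induct)
    case (monom c' j' k')
    define e where "e = of_real (fact (j + j') / (fact j * fact j') * (fact (k + k') / (fact k * fact k'))) * (c * c')"
    have "c * shifted_monom R j k z * (c' * shifted_monom R j' k' z) = e * shifted_monom R (j + j') (k + k') z" for z
      by (simp add: shifted_monom_def e_def power_add field_simps)
    then show ?case using xypoly.monom[of e R "j + j'" "k + k'"] by simp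
  next
    case (add f g)
    show ?case using xypoly.add[OF add.IH] by (simp add: algebra_simps)
  qed
next
  case (add f h)
  show ?case using xypoly.add[OF add.IH] by (simp add: algebra_simps)
qed

lemma xypoly_const: "(\<lambda>z. c) \<in> xypoly R"
  using xypoly.monom[of c R 0 0] by (simp add: shifted_monom_def)

lemma real_polynomial_function_xypoly:
  "real_polynomial_function (u :: complex \<Rightarrow> real) \<Longrightarrow> (\<lambda>z. of_real (u z)) \<in> xypoly R"
proof (induction rule: real_polynomial_function.induct)
  case (linear u)
  interpret bounded_linear u by fact
  have "(\<lambda>z. complex_of_real (u z)) = (\<lambda>z. (of_real (u 1) * shifted_monom R 1 0 z + of_real (u \<i>) * shifted_monom R 0 1 z)
      + of_real (- u 1 * R - u \<i> * R))"
  proof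
    fix z
    have "u z = u (Re z *\<^sub>R 1 + Im z *\<^sub>R \<i>)"
      by (rule arg_cong[of _ _ u]) (simp add: complex_eq_iff)
    also have "\<dots> = Re z * u 1 + Im z * u \<i>" by (simp only: add scaleR) simp
    finally have "u z = Re z * u 1 + Im z * u \<i>" .
    then show "complex_of_real (u z) = (of_real (u 1) * shifted_monom R 1 0 z + of_real (u \<i>) * shifted_monom R 0 1 z)
      + of_real (- u 1 * R - u \<i> * R)"
      by (simp add: shifted_monom_def algebra_simps)
  qed
  then show ?case by (rule ssubst) (intro xypoly.add xypoly.monom xypoly_const)
next
  case (const c)
  show ?case by (rule xypoly_const)
next
  case (add u v)
  show ?case using xypoly.add[OF add.IH] by simp
next
  case (mult u v)
  show ?case using xypoly_mult[OF mult.IH] by simp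
qed

lemma xypoly_Weierstrass:
  assumes "compact S" "continuous_on S (f :: complex \<Rightarrow> complex)" "e > 0"
  obtains p where "p \<in> xypoly R" "\<And>z. z \<in> S \<Longrightarrow> norm (f z - p z) < e"
proof -
  obtain g where g: "polynomial_function g" "\<And>z. z \<in> S \<Longrightarrow> norm (f z - g z) < e"
    using Stone_Weierstrass_polynomial_function[OF assms] by blast
  have "real_polynomial_function (Re \<circ> g)" "real_polynomial_function (Im \<circ> g)"
    using g(1) bounded_linear_Re bounded_linear_Im unfolding polynomial_function_def by blast+
  then have "(\<lambda>z. of_real ((Re \<circ> g) z) + \<i> * of_real ((Im \<circ> g) z)) \<in> xypoly R"
    by (intro xypoly.add xypoly_cmult real_polynomial_function_xypoly)
  moreover have "(\<lambda>z. of_real ((Re \<circ> g) z) + \<i> * of_real ((Im \<circ> g) z)) = g"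
    by (simp add: fun_eq_iff complex_eq_iff)
  ultimately show ?thesis using g(2) that by simp
qed

section \<open>Uniform approximation together with all lower derivatives\<close>

lemma norm_diff_le_horizontal:
  assumes "\<And>t. x0 \<le> t \<Longrightarrow> t \<le> Re z \<Longrightarrow> f differentiable (at (Complex t (Im z)))"
    "\<And>t. x0 \<le> t \<Longrightarrow> t \<le> Re z \<Longrightarrow> norm (dx f (Complex t (Im z))) \<le> B" "x0 \<le> Re z"
  shows "norm (f z - f (Complex x0 (Im z))) \<le> B * (Re z - x0)"
proof -
  have "norm (f (Complex (Re z) (Im z)) - f (Complex x0 (Im z))) \<le> B * norm (Re z - x0)"
  proof (rule differentiable_bound[of "{x0..Re z}" "\<lambda>t. f (Complex t (Im z))" "\<lambda>t h. h *\<^sub>R dx f (Complex t (Im z))"])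
    fix t assume t: "t \<in> {x0..Re z}"
    have "((\<lambda>t. Complex t (Im z)) has_derivative (\<lambda>h. of_real h)) (at t within {x0..Re z})"
      unfolding Complex_eq by (auto intro!: derivative_eq_intros)
    from has_derivative_compose[OF this differentiable_has_derivative_dx_dy[OF assms(1)]] t
    show "((\<lambda>t. f (Complex t (Im z))) has_derivative (\<lambda>h. h *\<^sub>R dx f (Complex t (Im z)))) (at t within {x0..Re z})"
      by (simp add: scaleR_conv_of_real)
    have B0: "B \<ge> 0" using assms(2)[of t] t by (meson atLeastAtMost_iff norm_ge_zero order_trans)
    show "onorm (\<lambda>h. h *\<^sub>R dx f (Complex t (Im z))) \<le> B"
    proof (rule onorm_bound[OF B0])
      fix h :: real
      show "norm (h *\<^sub>R dx f (Complex t (Im z))) \<le> B * norm h"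
        using mult_left_mono[OF assms(2)[of t], of "\<bar>h\<bar>"] t by (simp add: mult.commute)
    qed
  qed (use assms(3) in auto)
  then show ?thesis using assms(3) by simp
qed

lemma norm_diff_le_vertical:
  assumes "\<And>t. y0 \<le> t \<Longrightarrow> t \<le> Im z \<Longrightarrow> f differentiable (at (Complex (Re z) t))"
    "\<And>t. y0 \<le> t \<Longrightarrow> t \<le> Im z \<Longrightarrow> norm (dy f (Complex (Re z) t)) \<le> B" "y0 \<le> Im z"
  shows "norm (f z - f (Complex (Re z) y0)) \<le> B * (Im z - y0)"
proof -
  have "norm (f (Complex (Re z) (Im z)) - f (Complex (Re z) y0)) \<le> B * norm (Im z - y0)"
  proof (rule differentiable_bound[of "{y0..Im z}" "\<lambda>t. f (Complex (Re z) t)" "\<lambda>t h. h *\<^sub>R dy f (Complex (Re z) t)"])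
    fix t assume t: "t \<in> {y0..Im z}"
    have "((\<lambda>t. Complex (Re z) t) has_derivative (\<lambda>h. \<i> * of_real h)) (at t within {y0..Im z})"
      unfolding Complex_eq by (auto intro!: derivative_eq_intros)
    from has_derivative_compose[OF this differentiable_has_derivative_dx_dy[OF assms(1)]] t
    show "((\<lambda>t. f (Complex (Re z) t)) has_derivative (\<lambda>h. h *\<^sub>R dy f (Complex (Re z) t))) (at t within {y0..Im z})"
      by (simp add: scaleR_conv_of_real)
    have B0: "B \<ge> 0" using assms(2)[of t] t by (meson atLeastAtMost_iff norm_ge_zero order_trans)
    show "onorm (\<lambda>h. h *\<^sub>R dy f (Complex (Re z) t)) \<le> B"
    proof (rule onorm_bound[OF B0])
      fix h :: real
      show "norm (h *\<^sub>R dy f (Complex (Re z) t)) \<le> B * norm h"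
        using mult_left_mono[OF assms(2)[of t], of "\<bar>h\<bar>"] t by (simp add: mult.commute)
    qed
  qed (use assms(3) in auto)
  then show ?thesis using assms(3) by simp
qed

text \<open>Approximate the top derivative \<open>pdiff n n \<Psi>\<close> uniformly and integrate from the left and lower edges of a
  square on which \<open>\<Psi>\<close> and the antiderivatives of the approximating polynomial vanish.\<close>

lemma xypoly_dense:
  assumes \<Psi>: "ck n n UNIV \<Psi>" "compact L" "\<And>z. z \<notin> L \<Longrightarrow> \<Psi> z = 0" and e: "e > 0"
  shows "\<exists>R. \<exists>P\<in>xypoly R. \<forall>a\<le>n. \<forall>b\<le>n. \<forall>z\<in>L. norm (pdiff a b (\<lambda>z. P z - \<Psi> z) z) \<le> e"
proof -
  obtain R where R: "R \<ge> 1" "\<And>z. z \<in> L \<Longrightarrow> norm z < R"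
  proof -
    obtain B where B: "\<forall>z\<in>L. norm z \<le> B" using assms(2) compact_imp_bounded bounded_iff by metis
    have "norm z < \<bar>B\<bar> + 1" if "z \<in> L" for z using B that by fastforce
    then show ?thesis by (intro that[of "\<bar>B\<bar> + 1"]) auto
  qed
  define S where "S = cbox (Complex (-R) (-R)) (Complex R R)"
  have S: "z \<in> S \<longleftrightarrow> - R \<le> Re z \<and> Re z \<le> R \<and> - R \<le> Im z \<and> Im z \<le> R" for z
    by (auto simp: S_def in_cbox_complex_iff)
  have LS: "z \<in> S" if "z \<in> L" for z
    using R(2)[OF that] abs_Re_le_cmod[of z] abs_Im_le_cmod[of z] unfolding S by linarith
  have \<Psi>0: "pdiff a b \<Psi> z = 0" if "z \<notin> L" for a b z
  proof -
    have "pdiff a b \<Psi> z = pdiff a b (\<lambda>z. 0) z"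
      using that compact_imp_closed[OF \<Psi>(2)] by (intro pdiff_cong[of "- L"]) (auto simp: \<Psi>(3))
    then show ?thesis by (simp add: pdiff_zero_fun)
  qed
  have edge: "z \<notin> L" if "Re z = - R \<or> Im z = - R" for z
    using R(2)[of z] that abs_Re_le_cmod[of z] abs_Im_le_cmod[of z] by auto
  \<comment> \<open>At most \<open>2 * n\<close> integrations follow, each over a length of at most
    \<open>2 * R\<close>.\<close>
  define \<epsilon> where "\<epsilon> = e / (2 * R) ^ (2 * n)"
  have eps: "\<epsilon> > 0" using e R by (simp add: \<epsilon>_def)
  have "continuous_on S (pdiff n n \<Psi>)" using ck_continuous_on[OF \<Psi>(1), of n n] by (meson continuous_on_subset order_refl subset_UNIV)
  then obtain f where f: "f \<in> xypoly R" "\<And>z. z \<in> S \<Longrightarrow> norm (pdiff n n \<Psi> z - f z) < \<epsilon>"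
    using xypoly_Weierstrass[of S "pdiff n n \<Psi>" \<epsilon> R] eps compact_cbox unfolding S_def by metis
  obtain P where P: "P \<in> xypoly R" "pdiff n n P = f" "\<forall>b<n. \<forall>z. Im z = - R \<longrightarrow> pdiff n b P z = 0"
      "\<forall>a<n. \<forall>b\<le>n. \<forall>z. Re z = - R \<longrightarrow> pdiff a b P z = 0"
    using xypoly_antiderivative[OF f(1), of n] by blast
  define E where "E z = P z - \<Psi> z" for z
  have ckP: "ck n n UNIV P" using xypoly_smooth[OF P(1)] smooth_on_imp_ck by blast
  have ckE: "ck n n UNIV E" unfolding E_def by (intro ck_minus ckP \<Psi> open_UNIV)
  have pE: "pdiff a b E z = pdiff a b P z - pdiff a b \<Psi> z" if "a \<le> n" "b \<le> n" for a b z
    unfolding E_def using ck_mono[OF ckP, of a b UNIV] ck_mono[OF \<Psi>(1), of a b UNIV] that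
    by (intro pdiff_minus[OF open_UNIV]) auto
  \<comment> \<open>The order in \<open>y\<close> is lowered while the order in \<open>x\<close>
    stays at \<open>n\<close>, since the top derivative is the one known to be small; the order in
    \<open>x\<close> is lowered afterwards.\<close>
  have vert: "norm (pdiff n (n - j) E z) \<le> \<epsilon> * (2 * R) ^ j" if "j \<le> n" "z \<in> S" for j z
    using that
  proof (induction j arbitrary: z)
    case 0
    then show ?case using f(2)[of z] pE[of n n z] P(2) by (simp add: norm_minus_commute)
  next
    case (Suc j)
    define b where "b = n - Suc j"
    have b: "Suc b = n - j" "b < n" using Suc.prems by (auto simp: b_def)
    have "norm (pdiff n b E z - pdiff n b E (Complex (Re z) (- R))) \<le> \<epsilon> * (2 * R) ^ j * (Im z - - R)"
    proof (rule norm_diff_le_vertical)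
      fix t assume t: "- R \<le> t" "t \<le> Im z"
      show "pdiff n b E differentiable at (Complex (Re z) t)"
        using ck_imp_differentiable[OF ckE, of n b] b by auto
      have "dy (pdiff n b E) (Complex (Re z) t) = pdiff n (Suc b) E (Complex (Re z) t)"
        using b by (intro dy_pdiff[OF open_UNIV ckE]) auto
      moreover have "norm (pdiff n (n - j) E (Complex (Re z) t)) \<le> \<epsilon> * (2 * R) ^ j"
        using Suc.prems t by (intro Suc.IH) (auto simp: S)
      ultimately show "norm (dy (pdiff n b E) (Complex (Re z) t)) \<le> \<epsilon> * (2 * R) ^ j"
        by (simp only: b(1))
    qed (use Suc.prems in \<open>auto simp: S\<close>)
    moreover have "pdiff n b E (Complex (Re z) (- R)) = 0"
      using pE[of n b] P(3) b \<Psi>0[OF edge] by simp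
    moreover have "\<epsilon> * (2 * R) ^ j * (Im z - - R) \<le> \<epsilon> * (2 * R) ^ j * (2 * R)"
      using eps R Suc.prems by (intro mult_left_mono) (auto simp: S)
    ultimately show ?case by (simp add: b_def mult_ac)
  qed
  have hor: "norm (pdiff (n - i) b E z) \<le> \<epsilon> * (2 * R) ^ (n - b) * (2 * R) ^ i" if "i \<le> n" "b \<le> n" "z \<in> S" for i b z
    using that
  proof (induction i arbitrary: z)
    case 0
    then show ?case using vert[of "n - b" z] by simp
  next
    case (Suc i)
    define a where "a = n - Suc i"
    have a: "Suc a = n - i" "a < n" using Suc.prems by (auto simp: a_def)
    have "norm (pdiff a b E z - pdiff a b E (Complex (- R) (Im z))) \<le> \<epsilon> * (2 * R) ^ (n - b) * (2 * R) ^ i * (Re z - - R)"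
    proof (rule norm_diff_le_horizontal)
      fix t assume t: "- R \<le> t" "t \<le> Re z"
      show "pdiff a b E differentiable at (Complex t (Im z))"
        using ck_imp_differentiable[OF ckE, of a b] a Suc.prems by auto
      show "norm (dx (pdiff a b E) (Complex t (Im z))) \<le> \<epsilon> * (2 * R) ^ (n - b) * (2 * R) ^ i"
        unfolding pdiff_Suc_left[symmetric] a using Suc.prems t by (intro Suc.IH) (auto simp: S)
    qed (use Suc.prems in \<open>auto simp: S\<close>)
    moreover have "pdiff a b E (Complex (- R) (Im z)) = 0"
      using pE[of a b] P(4) a Suc.prems \<Psi>0[OF edge] by simp
    moreover have "\<epsilon> * (2 * R) ^ (n - b) * (2 * R) ^ i * (Re z - - R) \<le> \<epsilon> * (2 * R) ^ (n - b) * (2 * R) ^ i * (2 * R)"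
      using eps R Suc.prems by (intro mult_left_mono) (auto simp: S)
    ultimately show ?case by (simp add: a_def mult_ac)
  qed
  have "norm (pdiff a b E z) \<le> e" if "a \<le> n" "b \<le> n" "z \<in> L" for a b z
  proof -
    have "norm (pdiff a b E z) \<le> \<epsilon> * ((2 * R) ^ (n - b) * (2 * R) ^ (n - a))"
      using hor[of "n - a" b z] that LS by (simp add: mult.assoc)
    also have "(2 * R) ^ (n - b) * (2 * R) ^ (n - a) \<le> (2 * R) ^ (2 * n)"
      unfolding power_add[symmetric] using R by (intro power_increasing) auto
    also have "\<epsilon> * (2 * R) ^ (2 * n) = e" using R by (simp add: \<epsilon>_def)
    finally show ?thesis using eps by simp
  qed
  then show ?thesis using P(1) unfolding E_def by blast
qed

text \<open>The functions on which the action of \<open>F\<close> is expressed through the form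
  \<open>B\<close>.\<close>

inductive_set zpoly :: "(complex \<Rightarrow> complex) set" where
  prod: "(\<lambda>z. poly p z * cnj (poly q z)) \<in> zpoly"
| add: "f \<in> zpoly \<Longrightarrow> g \<in> zpoly \<Longrightarrow> (\<lambda>z. f z + g z) \<in> zpoly"

lemma zpoly_mult:
  assumes "f \<in> zpoly" "g \<in> zpoly"
  shows "(\<lambda>z. f z * g z) \<in> zpoly"
  using assms(1)
proof (induction rule: zpoly.induct)
  case (prod p q)
  show ?case using assms(2)
  proof (induction rule: zpoly.induct)
    case (prod p' q')
    show ?case using zpoly.prod[of "p * p'" "q * q'"] by (simp add: mult_ac)
  next
    case (add f g)
    show ?case using zpoly.add[OF add.IH] by (simp add: algebra_simps)
  qed
next
  case (add f h)
  show ?case using zpoly.add[OF add.IH] by (simp add: algebra_simps)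
qed

lemma zpoly_const: "(\<lambda>z. c) \<in> zpoly"
  using zpoly.prod[of "[:c:]" 1] by simp

lemma zpoly_power: "f \<in> zpoly \<Longrightarrow> (\<lambda>z. f z ^ n) \<in> zpoly"
  by (induction n) (auto intro: zpoly_mult zpoly_const)

lemma zpoly_Re_Im: "(\<lambda>z. of_real (Re z)) \<in> zpoly" "(\<lambda>z. of_real (Im z)) \<in> zpoly"
proof -
  have z: "(\<lambda>z. c * z) \<in> zpoly" "(\<lambda>z. c * cnj z) \<in> zpoly" for c
    using zpoly.prod[of "[:0, c:]" 1] zpoly.prod[of "[:c:]" "[:0, 1:]"] by (auto simp: mult.commute)
  have "(\<lambda>z. 1 / 2 * z + 1 / 2 * cnj z) \<in> zpoly" by (intro zpoly.add z)
  moreover have "(\<lambda>z. 1 / 2 * z + 1 / 2 * cnj z) = (\<lambda>z. of_real (Re z))" by (auto simp: fun_eq_iff complex_eq_iff)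
  ultimately show "(\<lambda>z. of_real (Re z)) \<in> zpoly" by simp
  have "(\<lambda>z. - \<i> / 2 * z + \<i> / 2 * cnj z) \<in> zpoly" by (intro zpoly.add z)
  moreover have "(\<lambda>z. - \<i> / 2 * z + \<i> / 2 * cnj z) = (\<lambda>z. of_real (Im z))" by (auto simp: fun_eq_iff complex_eq_iff)
  ultimately show "(\<lambda>z. of_real (Im z)) \<in> zpoly" by simp
qed

lemma xypoly_subset_zpoly: "f \<in> xypoly R \<Longrightarrow> f \<in> zpoly"
proof (induction rule: xypoly.induct)
  case (monom c j k)
  have "(\<lambda>z. (c / (fact j * fact k)) * ((of_real (Re z) + of_real R) ^ j * (of_real (Im z) + of_real R) ^ k)) \<in> zpoly"
    by (intro zpoly_mult zpoly_power zpoly.add zpoly_const zpoly_Re_Im)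
  moreover have "(\<lambda>z. (c / (fact j * fact k)) * ((of_real (Re z) + of_real R) ^ j * (of_real (Im z) + of_real R) ^ k))
      = (\<lambda>z. c * shifted_monom R j k z)"
    by (auto simp: shifted_monom_def fun_eq_iff)
  ultimately show ?case by simp
next
  case (add f g)
  show ?case using zpoly.add[OF add.IH] .
qed

context compact_dist
begin

text \<open>\<open>\<psi>\<close> is approximated near \<open>K\<close> by polynomials
  \<open>P\<close> in \<open>z\<close> and \<open>cnj z\<close> together with its derivatives up to
  order \<open>N\<close>, and \<open>F\<close> annihilates \<open>g * P\<close>. As \<open>F\<close>
  is controlled to order \<open>N\<close>, a quotient \<open>\<psi>\<close> of finite order is
  enough, although \<open>\<phi>\<close> itself must be a test function.\<close>

lemma zero_on_multiples:
  assumes g: "\<And>p q. B (g * p) q = 0"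
    and \<phi>: "smooth_on \<Omega> \<phi>" "ck N N \<Omega> \<psi>" "\<And>z. z \<in> \<Omega> \<Longrightarrow> \<phi> z = poly g z * \<psi> z"
  shows "F \<phi> = 0"
proof -
  have smg: "smooth_on \<Omega> (poly g)" by (rule smooth_on_poly[OF open_dom])
  have Fz: "smooth_on \<Omega> f \<and> F (\<lambda>z. poly g z * f z) = 0" if "f \<in> zpoly" for f
    using that
  proof (induction rule: zpoly.induct)
    case (prod p q)
    show ?case using g[of p q] smooth_poly_cnj_poly by (simp add: B_def mult.assoc)
  next
    case (add f h)
    have "F (\<lambda>z. poly g z * f z + poly g z * h z) = 0"
      using add.IH smg by (subst compact_dist.add[OF compact_dist_axioms]) (auto intro: smooth_on_mult open_dom)
    then show ?case using add.IH open_dom by (auto simp: distrib_left intro: smooth_on_add)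
  qed
  obtain \<Psi> L U where \<Psi>: "ck N N UNIV \<Psi>" "compact L" "\<forall>z. z \<notin> L \<longrightarrow> \<Psi> z = 0"
    "open U" "K \<subseteq> U" "U \<subseteq> \<Omega>" "\<forall>z\<in>U. \<Psi> z = \<psi> z"
    by (rule ck_extension[OF open_dom compact_K K_subset \<phi>(2)])
  obtain M where M: "M \<ge> 0" "\<forall>a\<le>N. \<forall>b\<le>N. \<forall>z\<in>K. norm (pdiff a b (poly g) z) \<le> M"
    using smooth_on_pdiff_bounded[OF smg compact_K K_subset, of N] by (elim exE conjE)
  have cL: "compact (L \<union> K)" using \<Psi>(2) compact_K by auto
  have le: "norm (F \<phi>) \<le> C * (2 ^ (2 * N) * M * e)" if e: "e > 0" for e
  proof -
    have "\<exists>R. \<exists>P\<in>xypoly R. \<forall>a\<le>N. \<forall>b\<le>N. \<forall>z\<in>L \<union> K. norm (pdiff a b (\<lambda>z. P z - \<Psi> z) z) \<le> e"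
      by (rule xypoly_dense[OF \<Psi>(1) cL _ e]) (use \<Psi>(3) in auto)
    then obtain R P where P: "P \<in> xypoly R"
      "\<And>a b z. a \<le> N \<Longrightarrow> b \<le> N \<Longrightarrow> z \<in> L \<union> K \<Longrightarrow> norm (pdiff a b (\<lambda>z. P z - \<Psi> z) z) \<le> e"
      by blast
    note FP = Fz[OF xypoly_subset_zpoly[OF P(1)]]
    have smP: "smooth_on UNIV P" using xypoly_smooth[OF P(1)] .
    have smgP: "smooth_on \<Omega> (\<lambda>z. poly g z * P z)" using FP smg by (intro smooth_on_mult open_dom) auto
    have ckE: "ck a b U (\<lambda>z. P z - \<Psi> z)" if "a \<le> N" "b \<le> N" for a b
      using ck_mono[OF ck_minus[OF open_UNIV smooth_on_imp_ck[OF smP] \<Psi>(1)], of a b U] that by auto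
    have ckg: "ck a b U (\<lambda>z. - 1 * poly g z)" for a b
      using smooth_on_imp_ck[OF smooth_on_cmult[OF \<Psi>(4) smooth_on_poly[OF \<Psi>(4)]]] .
    have "norm (F (\<lambda>z. \<phi> z - poly g z * P z)) \<le> C * (2 ^ (2 * N) * M * e)"
    proof (rule bound)
      show "smooth_on \<Omega> (\<lambda>z. \<phi> z - poly g z * P z)" by (intro smooth_on_minus open_dom \<phi> smgP)
      show "0 \<le> 2 ^ (2 * N) * M * e" using M e by simp
      fix a b z assume ab: "a \<le> N" "b \<le> N" and z: "z \<in> K"
      have zU: "z \<in> U" using z \<Psi>(5) by blast
      have "pdiff a b (\<lambda>z. \<phi> z - poly g z * P z) z = pdiff a b (\<lambda>z. - 1 * poly g z * (P z - \<Psi> z)) z"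
        using \<phi>(3) \<Psi>(6,7) zU by (intro pdiff_cong[OF \<Psi>(4)]) (auto simp: algebra_simps subset_iff)
      also have "norm \<dots> \<le> 2 ^ (a + b) * M * e"
      proof (rule pdiff_mult_bound[OF \<Psi>(4) ckg ckE[OF ab] zU])
        fix i j assume ij: "i \<le> a" "j \<le> b"
        have "pdiff i j (\<lambda>z. - 1 * poly g z) z = - 1 * pdiff i j (poly g) z"
          by (rule pdiff_cmult[OF \<Psi>(4) smooth_on_imp_ck[OF smooth_on_poly[OF \<Psi>(4)]] zU])
        then show "norm (pdiff i j (\<lambda>z. - 1 * poly g z) z) \<le> M" using M z ij ab by auto
        show "norm (pdiff i j (\<lambda>z. P z - \<Psi> z) z) \<le> e" using P(2)[of i j z] z ij ab by auto
      qed
      also have "\<dots> \<le> 2 ^ (2 * N) * M * e" using ab M e by (intro mult_right_mono power_increasing) auto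
      finally show "norm (pdiff a b (\<lambda>z. \<phi> z - poly g z * P z) z) \<le> 2 ^ (2 * N) * M * e" .
    qed
    moreover have "F (\<lambda>z. \<phi> z - poly g z * P z) = F \<phi>"
      using minus[OF \<phi>(1) smgP] FP by simp
    ultimately show ?thesis by simp
  qed
  have "norm (F \<phi>) \<le> 0"
  proof (rule field_le_epsilon)
    fix e :: real assume e: "e > 0"
    define k where "k = C * (2 ^ (2 * N) * M)"
    have k: "k \<ge> 0" using C_nonneg M by (simp add: k_def)
    have "norm (F \<phi>) \<le> k * (e / (k + 1))"
      using le[of "e / (k + 1)"] e k by (simp add: k_def mult.assoc)
    also have "\<dots> \<le> e" using k e by (simp add: field_simps)
    finally show "norm (F \<phi>) \<le> 0 + e" by simp
  qed
  then show ?thesis by simp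
qed

end

subsection \<open>Division of flat functions\<close>

text \<open>Taylor's estimate by iterating the mean value inequality: a derivative that vanishes at
  \<open>a\<close> and whose own partials are of order \<open>norm (z - a) ^ n\<close> is itself of
  order \<open>norm (z - a) ^ Suc n\<close>.\<close>

lemma flat_bound:
  assumes "open S" "smooth_on S \<phi>" "a \<in> S" and flat: "\<And>i j. i + j \<le> M \<Longrightarrow> pdiff i j \<phi> a = 0"
    and "i + j + n \<le> Suc M"
  shows "\<exists>C\<ge>0. \<exists>d>0. ball a d \<subseteq> S \<and> (\<forall>z\<in>ball a d. norm (pdiff i j \<phi> z) \<le> C * norm (z - a) ^ n)"
  using assms(5)
proof (induction n arbitrary: i j)
  case 0
  have "continuous_on S (pdiff i j \<phi>)"
    by (rule ck_continuous_on[OF smooth_on_imp_ck[OF assms(2), of i j]]) auto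
  then have "isCont (pdiff i j \<phi>) a" using assms(1,3) continuous_on_eq_continuous_at by blast
  then obtain d1 where d1: "d1 > 0" "\<And>z. dist z a < d1 \<Longrightarrow> dist (pdiff i j \<phi> z) (pdiff i j \<phi> a) < 1"
    unfolding continuous_at_eps_delta by (elim allE[of _ "1 :: real"]) auto
  obtain d2 where d2: "d2 > 0" "ball a d2 \<subseteq> S" using assms(1,3) openE by blast
  have "norm (pdiff i j \<phi> z) \<le> norm (pdiff i j \<phi> a) + 1" if "z \<in> ball a (min d1 d2)" for z
    using d1(2)[of z] that norm_triangle_ineq2[of "pdiff i j \<phi> z" "pdiff i j \<phi> a"]
    by (auto simp: dist_norm norm_minus_commute)
  then show ?case using d1 d2
    by (intro exI[of _ "norm (pdiff i j \<phi> a) + 1"] conjI exI[of _ "min d1 d2"]) auto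
next
  case (Suc n)
  obtain C1 d1 where 1: "C1 \<ge> 0" "d1 > 0" "ball a d1 \<subseteq> S"
    "\<forall>z\<in>ball a d1. norm (pdiff (Suc i) j \<phi> z) \<le> C1 * norm (z - a) ^ n"
    using Suc.IH[of "Suc i" j] Suc.prems by auto
  obtain C2 d2 where 2: "C2 \<ge> 0" "d2 > 0" "ball a d2 \<subseteq> S"
    "\<forall>z\<in>ball a d2. norm (pdiff i (Suc j) \<phi> z) \<le> C2 * norm (z - a) ^ n"
    using Suc.IH[of i "Suc j"] Suc.prems by auto
  define d where "d = min d1 d2"
  have ckp: "ck (Suc i) (Suc j) S \<phi>" using smooth_on_imp_ck[OF assms(2)] .
  have "norm (pdiff i j \<phi> z) \<le> (C1 + C2) * norm (z - a) ^ Suc n" if z: "z \<in> ball a d" for z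
  proof -
    let ?r = "norm (z - a)"
    have "norm (pdiff i j \<phi> z - pdiff i j \<phi> a) \<le> (C1 + C2) * ?r ^ n * norm (z - a)"
    proof (rule differentiable_bound[of "cball a ?r" _ "\<lambda>w h. of_real (Re h) * dx (pdiff i j \<phi>) w + of_real (Im h) * dy (pdiff i j \<phi>) w"])
      fix w assume w: "w \<in> cball a ?r"
      have wd: "w \<in> ball a d" using w z by (auto simp: dist_norm norm_minus_commute)
      then have wS: "w \<in> S" using 1(3) by (auto simp: d_def)
      have "pdiff i j \<phi> differentiable (at w)" using ck_imp_differentiable[OF ckp] wS by auto
      then show "(pdiff i j \<phi> has_derivative (\<lambda>h. of_real (Re h) * dx (pdiff i j \<phi>) w + of_real (Im h) * dy (pdiff i j \<phi>) w)) (at w within cball a ?r)"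
        using differentiable_has_derivative_dx_dy has_derivative_at_withinI by blast
      have rn: "norm (w - a) ^ n \<le> ?r ^ n" using w by (intro power_mono) (auto simp: dist_norm norm_minus_commute)
      have "norm (dx (pdiff i j \<phi>) w) \<le> C1 * norm (w - a) ^ n"
        using 1(4) wd by (simp add: d_def pdiff_Suc_left)
      then have b1: "norm (dx (pdiff i j \<phi>) w) \<le> C1 * ?r ^ n"
        using mult_left_mono[OF rn 1(1)] by linarith
      have "norm (dy (pdiff i j \<phi>) w) \<le> C2 * norm (w - a) ^ n"
        using 2(4) wd dy_pdiff[OF assms(1) ckp, of i j w] wS by (simp add: d_def)
      then have b2: "norm (dy (pdiff i j \<phi>) w) \<le> C2 * ?r ^ n"
        using mult_left_mono[OF rn 2(1)] by linarith
      show "onorm (\<lambda>h. of_real (Re h) * dx (pdiff i j \<phi>) w + of_real (Im h) * dy (pdiff i j \<phi>) w) \<le> (C1 + C2) * ?r ^ n"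
      proof (rule onorm_bound)
        fix h :: complex
        have "norm (of_real (Re h) * dx (pdiff i j \<phi>) w + of_real (Im h) * dy (pdiff i j \<phi>) w)
            \<le> \<bar>Re h\<bar> * norm (dx (pdiff i j \<phi>) w) + \<bar>Im h\<bar> * norm (dy (pdiff i j \<phi>) w)"
          by (rule order_trans[OF norm_triangle_ineq]) (simp add: norm_mult)
        also have "\<dots> \<le> norm h * (C1 * ?r ^ n) + norm h * (C2 * ?r ^ n)"
          by (intro add_mono mult_mono b1 b2 abs_Re_le_cmod abs_Im_le_cmod) auto
        finally show "norm (of_real (Re h) * dx (pdiff i j \<phi>) w + of_real (Im h) * dy (pdiff i j \<phi>) w) \<le> (C1 + C2) * ?r ^ n * norm h"
          by (simp add: algebra_simps)
      qed (use 1 2 in auto)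
    qed (auto simp: dist_norm norm_minus_commute)
    moreover have "pdiff i j \<phi> a = 0" using flat Suc.prems by simp
    ultimately show ?thesis by (simp add: mult_ac)
  qed
  then show ?case using 1 2
    by (intro exI[of _ "C1 + C2"] conjI exI[of _ d]) (auto simp: d_def)
qed

text \<open>A quadratic bound makes each difference quotient at \<open>a\<close> of linear size, so
  the derivatives at \<open>a\<close> exist and are \<open>0\<close>, one order after
  another.\<close>

lemma ck_removable:
  assumes S: "open S" "finite Z" "Z \<subseteq> S" and \<psi>: "ck n n (S - Z) \<psi>" "\<And>a. a \<in> Z \<Longrightarrow> \<psi> a = 0"
    and b: "\<And>a. a \<in> Z \<Longrightarrow> \<exists>C. \<exists>d>0. \<forall>i\<le>n. \<forall>j\<le>n. \<forall>z\<in>ball a d - {a}. norm (pdiff i j \<psi> z) \<le> C * norm (z - a) ^ 2"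
  shows "ck n n S \<psi>"
proof -
  have der: "pdiff i j \<psi> a = 0 \<and> pdiff i j \<psi> differentiable (at a)" if a: "a \<in> Z" and ij: "i \<le> n" "j \<le> n" for a i j
  proof -
    obtain C d where d: "d > 0" "\<forall>i\<le>n. \<forall>j\<le>n. \<forall>z\<in>ball a d - {a}. norm (pdiff i j \<psi> z) \<le> C * norm (z - a) ^ 2"
      using b[OF a] by blast
    have hd: "(pdiff i j \<psi> has_derivative (\<lambda>h. 0)) (at a)" if z0: "pdiff i j \<psi> a = 0" and ij: "i \<le> n" "j \<le> n" for i j
    proof -
      have "((\<lambda>z. (pdiff i j \<psi> z - pdiff i j \<psi> a) / (z - a)) \<longlongrightarrow> 0) (at a)"
      proof (rule Lim_null_comparison)
        show "\<forall>\<^sub>F z in at a. norm ((pdiff i j \<psi> z - pdiff i j \<psi> a) / (z - a)) \<le> C * norm (z - a)"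
          unfolding eventually_at
        proof (intro exI[of _ d] conjI ballI impI)
          fix z assume z: "z \<noteq> a \<and> dist z a < d"
          then have "norm (pdiff i j \<psi> z) \<le> C * norm (z - a) ^ 2" using d(2) ij by (auto simp: dist_commute)
          then show "norm ((pdiff i j \<psi> z - pdiff i j \<psi> a) / (z - a)) \<le> C * norm (z - a)"
            using z by (simp add: z0 norm_divide pos_divide_le_eq power2_eq_square mult.assoc)
        qed (rule d(1))
        have "((\<lambda>z. C * norm (z - a)) \<longlongrightarrow> C * norm (a - a)) (at a)" by (intro tendsto_intros)
        then show "((\<lambda>z. C * norm (z - a)) \<longlongrightarrow> 0) (at a)" by simp
      qed
      then have "(pdiff i j \<psi> has_field_derivative 0) (at a)" unfolding has_field_derivative_iff .
      then show ?thesis using has_field_derivative_imp_has_derivative[of "pdiff i j \<psi>" 0 "at a"]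
        by (simp add: lambda_zero)
    qed
    have 0: "pdiff 0 j \<psi> a = 0" if "j \<le> n" for j
      using that
    proof (induction j)
      case (Suc j)
      then show ?case using has_derivative_dx_dy(2)[OF hd[of 0 j]] by (simp add: pdiff_0_Suc)
    qed (simp add: \<psi>(2)[OF a])
    have "pdiff i j \<psi> a = 0" using ij(1)
    proof (induction i)
      case (Suc i)
      then show ?case using has_derivative_dx_dy(1)[OF hd[of i j]] ij by (simp add: pdiff_Suc_left)
    qed (use 0 ij in simp)
    then show ?thesis using hd[OF _ ij] unfolding differentiable_def by blast
  qed
  then have "ck n n Z \<psi>" by (simp add: ck_def)
  then have "ck n n ((S - Z) \<union> Z) \<psi>" by (rule ck_Un[OF \<psi>(1)])
  moreover have "(S - Z) \<union> Z = S" using S by blast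
  ultimately show ?thesis by simp
qed

text \<open>Cauchy's estimate on the circle of radius \<open>norm (z - a) / 2\<close>, on which the
  distance to the pole is still at least that radius.\<close>

lemma higher_deriv_pole_bound:
  assumes "R holomorphic_on ball a d - {a}" "\<And>z. z \<in> ball a d - {a} \<Longrightarrow> norm (R z) \<le> C / norm (z - a) ^ k"
    and z: "z \<noteq> a" "norm (z - a) < d / 2" and C: "C \<ge> 0"
  shows "norm ((deriv ^^ m) R z) \<le> fact m * C * 2 ^ (k + m) / norm (z - a) ^ (k + m)"
proof -
  define r where "r = norm (z - a) / 2"
  have r: "r > 0" using z by (simp add: r_def)
  have sub: "cball z r \<subseteq> ball a d - {a}"
  proof
    fix w assume w: "w \<in> cball z r"
    have "dist a w \<le> dist a z + dist z w" by (rule dist_triangle)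
    moreover have "dist z w \<le> norm (z - a) / 2" using w by (simp add: r_def)
    moreover have "dist a z = norm (z - a)" by (metis dist_commute dist_norm)
    ultimately have "dist a w < d" using z(2) norm_ge_zero[of "z - a"] by linarith
    moreover have "w \<noteq> a" using w r by (auto simp: r_def dist_norm)
    ultimately show "w \<in> ball a d - {a}" by simp
  qed
  have "norm ((deriv ^^ m) R z) \<le> fact m * (C / r ^ k) / r ^ m"
  proof (rule Cauchy_inequality)
    show "R holomorphic_on ball z r" using assms(1) by (rule holomorphic_on_subset) (use order_trans[OF ball_subset_cball sub] in simp)
    show "continuous_on (cball z r) R"
      using holomorphic_on_imp_continuous_on[OF assms(1)] sub by (rule continuous_on_subset)
    fix w assume w: "norm (z - w) = r"
    have "w \<in> ball a d - {a}" using sub w by (auto simp: dist_norm)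
    then have "norm (R w) \<le> C / norm (w - a) ^ k" by (rule assms(2))
    also have "\<dots> \<le> C / r ^ k"
    proof -
      have "norm (w - a) \<ge> r"
        using norm_triangle_ineq2[of "z - a" "z - w"] w by (simp add: r_def)
      then show ?thesis using r C by (intro divide_left_mono power_mono mult_pos_pos zero_less_power) linarith+
    qed
    finally show "norm (R w) \<le> C / r ^ k" .
  qed (rule r)
  also have "\<dots> = fact m * C * 2 ^ (k + m) / norm (z - a) ^ (k + m)"
    by (simp add: r_def power_divide power_add)
  finally show ?thesis .
qed

text \<open>Derivatives of \<open>R\<close> up to order \<open>n\<close> in each direction grow at
  most like the power \<open>k + 2 * n\<close> of \<open>1 / norm (z - a)\<close>. To beat this by a
  square, derivatives of \<open>\<phi>\<close> of total order up to \<open>2 * n\<close> must be of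
  size \<open>norm (z - a) ^ (k + 2 * n + 2)\<close>, which by \<open>flat_bound\<close> takes
  flatness up to \<open>4 * n + k + 1\<close>.\<close>

lemma ck_flat_times_pole:
  assumes S: "open S" "finite Z" "Z \<subseteq> S" and R: "R holomorphic_on S - Z"
    and pole: "\<And>a. a \<in> Z \<Longrightarrow> \<exists>C\<ge>0. \<exists>d>0. \<forall>z\<in>ball a d - {a}. norm (R z) \<le> C / norm (z - a) ^ k"
    and \<phi>: "smooth_on S \<phi>" "\<And>a i j. a \<in> Z \<Longrightarrow> i + j \<le> 4 * n + k + 1 \<Longrightarrow> pdiff i j \<phi> a = 0"
  shows "ck n n S (\<lambda>z. if z \<in> Z then 0 else \<phi> z * R z)"
proof (rule ck_removable[OF S])
  let ?\<psi> = "\<lambda>z. if z \<in> Z then 0 else \<phi> z * R z"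
  have oSZ: "open (S - Z)" using S finite_imp_closed by (intro open_Diff) auto
  have smR: "smooth_on (S - Z) R" by (rule smooth_on_holomorphic[OF oSZ R])
  have sm\<phi>: "smooth_on (S - Z) \<phi>" using smooth_on_subset[OF \<phi>(1)] by blast
  show "ck n n (S - Z) ?\<psi>"
    by (rule ck_cong[OF oSZ _ smooth_on_imp_ck[OF smooth_on_mult[OF oSZ sm\<phi> smR]]]) auto
  show "?\<psi> a = 0" if "a \<in> Z" for a using that by simp
  fix a assume a: "a \<in> Z"
  obtain C0 d0 where C0: "C0 \<ge> 0" "d0 > 0" "\<forall>z\<in>ball a d0 - {a}. norm (R z) \<le> C0 / norm (z - a) ^ k"
    using pole[OF a] by blast
  have "open (S - (Z - {a}))" "a \<in> S - (Z - {a})"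
    using a S(3) open_Diff[OF S(1) finite_imp_closed[OF finite_Diff[OF S(2)]]] by auto
  then obtain d1 where d1: "d1 > 0" "ball a d1 \<subseteq> S - (Z - {a})" using openE by blast
  define s where "s = k + 2 * n + 2"
  have "\<forall>i j. \<exists>C\<ge>0. \<exists>d>0. i \<le> n \<longrightarrow> j \<le> n \<longrightarrow> (\<forall>z\<in>ball a d. norm (pdiff i j \<phi> z) \<le> C * norm (z - a) ^ s)"
  proof (intro allI)
    fix i j
    show "\<exists>C\<ge>0. \<exists>d>0. i \<le> n \<longrightarrow> j \<le> n \<longrightarrow> (\<forall>z\<in>ball a d. norm (pdiff i j \<phi> z) \<le> C * norm (z - a) ^ s)"
    proof (cases "i \<le> n \<and> j \<le> n")
      case True
      then have "i + j + s \<le> Suc (4 * n + k + 1)" by (simp add: s_def)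
      from flat_bound[OF S(1) \<phi>(1) _ \<phi>(2)[OF a] this] a S(3) show ?thesis by blast
    qed (auto intro: exI[of _ 0] exI[of _ 1])
  qed
  then obtain Cf df where f: "\<And>i j. Cf i j \<ge> 0" "\<And>i j. df i j > 0"
    "\<And>i j z. i \<le> n \<Longrightarrow> j \<le> n \<Longrightarrow> z \<in> ball a (df i j) \<Longrightarrow> norm (pdiff i j \<phi> z) \<le> Cf i j * norm (z - a) ^ s"
    by metis
  define C1 where "C1 = (\<Sum>x\<in>{..n} \<times> {..n}. Cf (fst x) (snd x))"
  define d2 where "d2 = Min ((\<lambda>x. df (fst x) (snd x)) ` ({..n} \<times> {..n}))"
  have d2: "d2 > 0" unfolding d2_def using f(2) by (subst Min_gr_iff) auto
  have f1: "norm (pdiff i j \<phi> z) \<le> C1 * norm (z - a) ^ s" if ij: "i \<le> n" "j \<le> n" and z: "z \<in> ball a d2" for i j z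
  proof -
    have "d2 \<le> df i j" unfolding d2_def using ij by (intro Min_le image_eqI[of _ _ "(i, j)"]) auto
    then have "norm (pdiff i j \<phi> z) \<le> Cf i j * norm (z - a) ^ s" using f(3) ij z by auto
    also have "Cf i j \<le> C1"
      unfolding C1_def using ij f(1) member_le_sum[of "(i, j)" "{..n} \<times> {..n}" "\<lambda>x. Cf (fst x) (snd x)"] by auto
    finally show ?thesis by (simp add: mult_right_mono)
  qed
  \<comment> \<open>Half radii leave room for the Cauchy circles, and the bound \<open>1\<close>
    allows powers of \<open>norm (z - a)\<close> to be compared.\<close>
  define d where "d = min (min (d0 / 2) (d1 / 2)) (min d2 1)"
  define D where "D = fact (2 * n) * C0 * 2 ^ (k + 2 * n)"
  have D0: "D \<ge> 0" using C0 by (simp add: D_def)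
  have C10: "C1 \<ge> 0" unfolding C1_def using f(1) by (intro sum_nonneg)
  have Rb: "norm (pdiff i j R z) \<le> D / norm (z - a) ^ (k + 2 * n)"
    if ij: "i \<le> n" "j \<le> n" and z: "z \<in> ball a d - {a}" for i j z
  proof -
    have zr: "norm (z - a) < d" "z \<noteq> a" using z by (auto simp: dist_norm norm_minus_commute)
    have z1: "norm (z - a) \<le> 1" "0 < norm (z - a)" using zr by (auto simp: d_def)
    have sub: "ball a (min d0 d1) - {a} \<subseteq> S - Z" using d1 by auto
    have "z \<in> ball a (min d0 d1) - {a}" using z C0 d1 by (auto simp: d_def)
    then have zSZ: "z \<in> S - Z" using sub by blast
    have "pdiff i j R z = \<i> ^ j * (deriv ^^ (i + j)) R z"
      using pdiff_holomorphic[OF oSZ R zSZ, of i j 1] by simp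
    then have "norm (pdiff i j R z) = norm ((deriv ^^ (i + j)) R z)" by (simp add: norm_mult norm_power)
    also have "\<dots> \<le> fact (i + j) * C0 * 2 ^ (k + (i + j)) / norm (z - a) ^ (k + (i + j))"
    proof (rule higher_deriv_pole_bound[where d = "min d0 d1"])
      show "R holomorphic_on ball a (min d0 d1) - {a}" using R sub by (rule holomorphic_on_subset)
      show "norm (R z) \<le> C0 / norm (z - a) ^ k" if "z \<in> ball a (min d0 d1) - {a}" for z using C0(3) that by auto
      show "norm (z - a) < min d0 d1 / 2" using zr by (auto simp: d_def)
    qed (use zr C0 in auto)
    also have "\<dots> \<le> D / norm (z - a) ^ (k + 2 * n)"
      unfolding D_def using ij z1 C0
      by (intro frac_le mult_mono power_increasing power_decreasing fact_mono zero_less_power) auto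
    finally show ?thesis .
  qed
  have "norm (pdiff i j ?\<psi> z) \<le> 2 ^ (2 * n) * C1 * D * norm (z - a) ^ 2"
    if ij: "i \<le> n" "j \<le> n" and z: "z \<in> ball a d - {a}" for i j z
  proof -
    have zr: "0 < norm (z - a)" using z by auto
    have "z \<in> ball a d1 - {a}" using z d1(1) by (auto simp: d_def)
    then have zSZ: "z \<in> S - Z" using d1(2) by blast
    have "pdiff i j ?\<psi> z = pdiff i j (\<lambda>z. \<phi> z * R z) z" by (rule pdiff_cong[OF oSZ _ zSZ]) auto
    also have "norm \<dots> \<le> 2 ^ (i + j) * (C1 * norm (z - a) ^ s) * (D / norm (z - a) ^ (k + 2 * n))"
    proof (rule pdiff_mult_bound[OF oSZ smooth_on_imp_ck[OF sm\<phi>] smooth_on_imp_ck[OF smR] zSZ])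
      show "norm (pdiff i' j' \<phi> z) \<le> C1 * norm (z - a) ^ s" if "i' \<le> i" "j' \<le> j" for i' j'
        using that ij z by (intro f1) (auto simp: d_def)
      show "norm (pdiff i' j' R z) \<le> D / norm (z - a) ^ (k + 2 * n)" if "i' \<le> i" "j' \<le> j" for i' j'
        using that ij z by (intro Rb) auto
    qed
    also have "\<dots> = 2 ^ (i + j) * (C1 * D * norm (z - a) ^ 2)"
      using zr by (simp add: s_def power_add power2_eq_square field_simps)
    also have "\<dots> \<le> 2 ^ (2 * n) * (C1 * D * norm (z - a) ^ 2)"
      using ij C10 D0 by (intro mult_right_mono power_increasing) auto
    finally show ?thesis by (simp add: mult_ac)
  qed
  moreover have "d > 0" using C0 d1 d2 by (simp add: d_def)
  ultimately show "\<exists>C. \<exists>d>0. \<forall>i\<le>n. \<forall>j\<le>n. \<forall>z\<in>ball a d - {a}. norm (pdiff i j ?\<psi> z) \<le> C * norm (z - a) ^ 2"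
    by blast
qed

subsection \<open>Linear algebra\<close>

text \<open>Induction on the functionals. If some \<open>v0\<close> is annihilated by all of
  \<open>J\<close> but not by \<open>l i0\<close>, it determines the coefficient of
  \<open>l i0\<close>; otherwise \<open>l i0\<close> vanishes wherever the others do, and the
  coefficient \<open>0\<close> serves. Linearity is asked for on \<open>V\<close> only, as
  \<open>F\<close> and \<open>pdiff\<close> are known to be linear only on smooth functions.\<close>

lemma functional_in_span:
  fixes V :: "(complex \<Rightarrow> complex) set" and l :: "'i \<Rightarrow> (complex \<Rightarrow> complex) \<Rightarrow> complex"
  assumes "finite J" and V: "\<And>v w c. v \<in> V \<Longrightarrow> w \<in> V \<Longrightarrow> (\<lambda>z. v z + c * w z) \<in> V"
    and l: "\<And>i v w c. i \<in> J \<Longrightarrow> v \<in> V \<Longrightarrow> w \<in> V \<Longrightarrow> l i (\<lambda>z. v z + c * w z) = l i v + c * l i w"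
    and F: "\<And>v w c. v \<in> V \<Longrightarrow> w \<in> V \<Longrightarrow> F (\<lambda>z. v z + c * w z) = F v + c * F w"
    and ker: "\<And>v. v \<in> V \<Longrightarrow> (\<And>i. i \<in> J \<Longrightarrow> l i v = 0) \<Longrightarrow> F v = 0"
  shows "\<exists>c. \<forall>v\<in>V. F v = (\<Sum>i\<in>J. c i * l i v)"
  using assms(1) l F ker
proof (induction J arbitrary: F rule: finite_induct)
  case empty
  then show ?case by simp
next
  case (insert i0 J)
  show ?case
  proof (cases "\<exists>v0\<in>V. l i0 v0 \<noteq> 0 \<and> (\<forall>i\<in>J. l i v0 = 0)")
    case True
    then obtain v0 where v0: "v0 \<in> V" "l i0 v0 \<noteq> 0" "\<And>i. i \<in> J \<Longrightarrow> l i v0 = 0" by blast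
    define k where "k = F v0 / l i0 v0"
    define F' where "F' v = F v - k * l i0 v" for v
    have "\<exists>c. \<forall>v\<in>V. F' v = (\<Sum>i\<in>J. c i * l i v)"
    proof (rule insert.IH)
      show "l i (\<lambda>z. v z + c * w z) = l i v + c * l i w" if "i \<in> J" "v \<in> V" "w \<in> V" for i v w c
        using insert.prems(1) that by blast
      show "F' (\<lambda>z. v z + c * w z) = F' v + c * F' w" if "v \<in> V" "w \<in> V" for v w c
        using insert.prems(1)[of i0 v w c] insert.prems(2)[of v w c] that by (simp add: F'_def algebra_simps)
      fix v assume v: "v \<in> V" "\<And>i. i \<in> J \<Longrightarrow> l i v = 0"
      define c where "c = - (l i0 v / l i0 v0)"
      define u where "u = (\<lambda>z. v z + c * v0 z)"
      have "F u = 0"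
      proof (rule insert.prems(3))
        show "u \<in> V" unfolding u_def using V v(1) v0(1) by blast
        show "l i u = 0" if "i \<in> insert i0 J" for i
        proof (cases "i = i0")
          case True
          then show ?thesis using insert.prems(1)[of i0 v v0 c] v(1) v0 by (simp add: u_def c_def)
        next
          case False
          then show ?thesis using insert.prems(1)[of i v v0 c] that v v0 by (simp add: u_def)
        qed
      qed
      then have "F v + c * F v0 = 0" using insert.prems(2)[OF v(1) v0(1), of c] by (simp add: u_def)
      then show "F' v = 0" using v0(2) by (simp add: F'_def k_def c_def field_simps)
    qed
    then obtain c where c: "\<And>v. v \<in> V \<Longrightarrow> F' v = (\<Sum>i\<in>J. c i * l i v)" by blast
    have "F v = (\<Sum>i\<in>insert i0 J. (c(i0 := k)) i * l i v)" if "v \<in> V" for v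
    proof -
      have "(\<Sum>i\<in>J. (c(i0 := k)) i * l i v) = (\<Sum>i\<in>J. c i * l i v)"
        using insert.hyps by (intro sum.cong) auto
      moreover have "F v = k * l i0 v + F' v" by (simp add: F'_def)
      ultimately show ?thesis using c[OF that] insert.hyps by simp
    qed
    then show ?thesis by blast
  next
    case False
    have "\<exists>c. \<forall>v\<in>V. F v = (\<Sum>i\<in>J. c i * l i v)"
      by (rule insert.IH) (use insert.prems False in blast)+
    then obtain c where c: "\<And>v. v \<in> V \<Longrightarrow> F v = (\<Sum>i\<in>J. c i * l i v)" by blast
    have "F v = (\<Sum>i\<in>insert i0 J. (c(i0 := 0)) i * l i v)" if "v \<in> V" for v
    proof -
      have "(\<Sum>i\<in>J. (c(i0 := 0)) i * l i v) = (\<Sum>i\<in>J. c i * l i v)"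
        using insert.hyps by (intro sum.cong) auto
      then show ?thesis using c[OF that] insert.hyps by simp
    qed
    then show ?thesis by blast
  qed
qed

text \<open>With \<open>w\<close> the inverse of \<open>poly W a\<close>, the identity
  \<open>w * (W - [:- a, 1:] * W') = 1\<close> is inserted next to the power of
  \<open>[:- a, 1:]\<close> and raises it by one, modulo multiples of \<open>W\<close>.\<close>

lemma bezout_linear_power:
  fixes W :: "'a::field poly"
  assumes "poly W a \<noteq> 0"
  shows "\<exists>u v. u * W + v * [:- a, 1:] ^ n = 1"
proof (induction n)
  case 0
  have "0 * W + 1 * [:- a, 1:] ^ 0 = 1" by simp
  then show ?case by blast
next
  case (Suc n)
  then obtain u v where uv: "u * W + v * [:- a, 1:] ^ n = 1" by blast
  define w where "w = [:1 / poly W a:]"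
  have "[:- a, 1:] dvd W - [:poly W a:]" by (simp add: poly_eq_0_iff_dvd[symmetric])
  then obtain W' where "W - [:poly W a:] = [:- a, 1:] * W'" by blast
  then have W': "[:poly W a:] = W - [:- a, 1:] * W'" by (simp add: algebra_simps)
  have "w * [:poly W a:] = 1" using assms by (simp add: w_def one_pCons)
  then have 1: "w * (W - [:- a, 1:] * W') = 1" by (simp only: W')
  have "1 = u * W + v * [:- a, 1:] ^ n * (w * (W - [:- a, 1:] * W'))" by (simp only: 1 mult_1_right uv)
  also have "\<dots> = (u + v * [:- a, 1:] ^ n * w) * W + (- (v * w * W')) * [:- a, 1:] ^ Suc n"
    unfolding power_Suc by (simp add: algebra_simps del: mult_pCons_left mult_pCons_right)
  finally show ?case by (intro exI) (rule sym)
qed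

lemma higher_deriv_poly: "(deriv ^^ k) (poly p) = poly ((pderiv ^^ k) p)"
proof (induction k)
  case (Suc k)
  have "deriv (poly q) = poly (pderiv q)" for q :: "'a poly"
    by (rule ext) (rule DERIV_imp_deriv[OF poly_DERIV])
  then show ?case using Suc by simp
qed simp

text \<open>Near \<open>a\<close> the polynomial is \<open>z - a\<close> to the exponent
  \<open>order a g\<close> times a factor bounded away from \<open>0\<close>. The exponent is
  enlarged to \<open>degree g\<close>, which distances below \<open>1\<close> permit, so that one
  value serves for all points.\<close>

lemma poly_inverse_pole:
  assumes "(g :: complex poly) \<noteq> 0"
  shows "\<exists>C\<ge>0. \<exists>d>0. \<forall>z\<in>ball a d - {a}. norm (1 / poly g z) \<le> C / norm (z - a) ^ degree g"
proof -
  obtain h where h: "g = [:- a, 1:] ^ order a g * h" using order_1[of a g] by blast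
  have ha: "poly h a \<noteq> 0"
  proof
    assume "poly h a = 0"
    then have "[:- a, 1:] ^ Suc (order a g) dvd g"
      by (subst h) (simp add: poly_eq_0_iff_dvd mult.commute[of "[:- a, 1:]"] del: mult_pCons_left mult_pCons_right)
    then show False using order_2[OF assms] by blast
  qed
  have "isCont (\<lambda>z. norm (poly h z)) a" by (intro continuous_intros)
  then have "\<forall>\<^sub>F z in nhds a. norm (poly h z) > norm (poly h a) / 2"
    unfolding isCont_def by (intro order_tendstoD(1)[of _ "norm (poly h a)"])
      (use ha tendsto_at_iff_tendsto_nhds[of "\<lambda>z. norm (poly h z)" a] in auto)
  then obtain d where d: "d > 0" "\<And>z. dist z a < d \<Longrightarrow> norm (poly h z) > norm (poly h a) / 2"
    unfolding eventually_nhds_metric by blast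
  have "norm (1 / poly g z) \<le> (2 / norm (poly h a)) / norm (z - a) ^ degree g" if z: "z \<in> ball a (min d 1) - {a}" for z
  proof -
    have z1: "norm (z - a) \<le> 1" "0 < norm (z - a)" using z by (auto simp: dist_norm norm_minus_commute)
    have hz: "norm (poly h z) > norm (poly h a) / 2" using d(2)[of z] z by (auto simp: dist_commute)
    have "norm (poly g z) = norm (z - a) ^ order a g * norm (poly h z)"
      by (subst h) (simp add: norm_mult norm_power)
    moreover have "norm (z - a) ^ degree g \<le> norm (z - a) ^ order a g"
      using z1 order_degree[OF assms, of a] by (intro power_decreasing) auto
    ultimately have "norm (poly g z) \<ge> norm (z - a) ^ degree g * (norm (poly h a) / 2)"
      using mult_mono[OF _ less_imp_le[OF hz], of "norm (z - a) ^ degree g" "norm (z - a) ^ order a g"] by simp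
    moreover have "norm (z - a) ^ degree g * (norm (poly h a) / 2) > 0" using z1 ha by simp
    ultimately have "1 / norm (poly g z) \<le> 1 / (norm (z - a) ^ degree g * (norm (poly h a) / 2))"
      by (intro frac_le) auto
    then show ?thesis by (simp add: norm_divide field_simps)
  qed
  then show ?thesis using d(1) by (intro exI[of _ "2 / norm (poly h a)"] conjI exI[of _ "min d 1"]) auto
qed

subsection \<open>Structure of the distribution\<close>

context compact_dist
begin

lemma finite_support_structure:
  assumes rank: "\<And>f :: nat \<Rightarrow> complex poly. \<exists>c. (\<exists>j\<le>m. c j \<noteq> 0) \<and> (\<forall>q. B (\<Sum>j\<le>m. Polynomial.smult (c j) (f j)) q = 0)"
  shows "\<exists>m0 zq (n::nat) (c :: nat \<Rightarrow> nat \<Rightarrow> nat \<Rightarrow> complex).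
           m0 \<le> m \<and> (\<forall>q<m0. zq q \<in> \<Omega>) \<and> inj_on zq {..<m0} \<and>
           (\<forall>\<phi>. smooth_on \<Omega> \<phi> \<longrightarrow>
              F \<phi> = (\<Sum>q<m0. \<Sum>a\<le>n. \<Sum>b\<le>n. c q a b * pdiff a b \<phi> (zq q)))"
proof -
  \<comment> \<open>The polynomials that annihilate the form; a member of least degree loses this
    property when a linear factor is removed.\<close>
  define I where "I = {g. g \<noteq> 0 \<and> (\<forall>p q. B (g * p) q = 0)}"
  obtain g0 where "g0 \<in> I" using ideal_in_kernel[OF rank] unfolding I_def by blast
  then obtain g where g: "g \<in> I" "\<And>h. h \<in> I \<Longrightarrow> degree g \<le> degree h"
    using ex_has_least_nat[of "\<lambda>g. g \<in> I" g0 degree] by blast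
  have gne: "g \<noteq> 0" and gB: "\<And>p q. B (g * p) q = 0" using g(1) by (auto simp: I_def)
  define Z where "Z = {a. poly g a = 0}"
  have finZ: "finite Z" unfolding Z_def by (rule poly_roots_finite[OF gne])
  have "\<exists>h. g = [:- a, 1:] * h" if "a \<in> Z" for a
    using that unfolding Z_def mem_Collect_eq poly_eq_0_iff_dvd dvd_def .
  then obtain ga where ga: "\<And>a. a \<in> Z \<Longrightarrow> g = [:- a, 1:] * ga a" by metis
  have ga_ne: "ga a \<noteq> 0" if "a \<in> Z" for a using ga[OF that] gne by auto
  have ga_notin: "ga a \<notin> I" if "a \<in> Z" for a
  proof
    assume "ga a \<in> I"
    then have "degree g \<le> degree (ga a)" by (rule g(2))
    moreover have "degree g = Suc (degree (ga a))"
      using ga_ne[OF that] by (subst ga[OF that], subst degree_mult_eq) auto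
    ultimately show False by simp
  qed
  have pga: "poly g z = (z - a) * poly (ga a) z" if "a \<in> Z" for a z
    by (subst ga[OF that]) (simp add: algebra_simps)
  \<comment> \<open>For a root outside \<open>\<Omega>\<close> the function
    \<open>1 / (z - a)\<close> is smooth on \<open>\<Omega>\<close>, so the cofactor
    \<open>ga a\<close> would annihilate the form too, against minimality.\<close>
  have Z\<Omega>: "Z \<subseteq> \<Omega>"
  proof
    fix a assume a: "a \<in> Z"
    show "a \<in> \<Omega>"
    proof (rule ccontr)
      assume na: "a \<notin> \<Omega>"
      have "B (ga a * p) q = 0" for p q
        unfolding B_def
      proof (rule zero_on_multiples[OF gB smooth_poly_cnj_poly])
        have "(\<lambda>z. 1 / (z - a)) holomorphic_on \<Omega>" using na by (intro holomorphic_intros) auto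
        then show "ck N N \<Omega> (\<lambda>z. poly p z * cnj (poly q z) * (1 / (z - a)))"
          by (intro smooth_on_imp_ck smooth_on_mult smooth_poly_cnj_poly open_dom smooth_on_holomorphic)
        fix z assume "z \<in> \<Omega>"
        then have "z \<noteq> a" using na by blast
        then show "poly (ga a * p) z * cnj (poly q z) = poly g z * (poly p z * cnj (poly q z) * (1 / (z - a)))"
          by (simp add: pga[OF a])
      qed
      then show False using ga_notin[OF a] ga_ne[OF a] by (simp add: I_def)
    qed
  qed
  \<comment> \<open>Modulo \<open>z - a\<close> every \<open>p\<close> is the constant
    \<open>poly p a\<close>, and \<open>z - a\<close> times the cofactor is \<open>g\<close>; so
    nonvanishing on some multiple of \<open>ga a\<close> shows on \<open>ga a\<close>
    itself.\<close>
  have "\<exists>q. B (ga a) q \<noteq> 0" if a: "a \<in> Z" for a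
  proof -
    obtain p q where pq: "B (ga a * p) q \<noteq> 0" using ga_notin[OF a] ga_ne[OF a] by (auto simp: I_def)
    have "[:- a, 1:] dvd p - [:poly p a:]" by (simp add: poly_eq_0_iff_dvd[symmetric])
    then obtain p1 where "p - [:poly p a:] = [:- a, 1:] * p1" by blast
    then have p: "p = [:poly p a:] + [:- a, 1:] * p1" by (simp only: diff_eq_eq add.commute)
    have "ga a * p = ga a * [:poly p a:] + ([:- a, 1:] * ga a) * p1"
      by (subst p) (simp only: algebra_simps)
    then have "ga a * p = Polynomial.smult (poly p a) (ga a) + g * p1"
      unfolding ga[OF a, symmetric] by simp
    then have "B (ga a * p) q = poly p a * B (ga a) q" by (simp add: B_add_left B_smult_left gB)
    then show ?thesis using pq by auto
  qed
  then obtain qa where qa: "\<And>a. a \<in> Z \<Longrightarrow> B (ga a) (qa a) \<noteq> 0" by metis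
  \<comment> \<open>One more than the flatness \<open>4 * N + 2\<close> that division by a simple
    factor asks for.\<close>
  define M where "M = 4 * N + 3"
  \<comment> \<open>The functional \<open>B (ga a)\<close> is concentrated at \<open>a\<close>: the
    conjugate factor is flat there, so dividing it by \<open>z - a\<close> keeps it of order
    \<open>N\<close>, and the product is a multiple of \<open>g\<close>.\<close>
  have flat0: "B (ga a) ([:- a, 1:] ^ M * s) = 0" if a: "a \<in> Z" for a s
    unfolding B_def
  proof (rule zero_on_multiples[OF gB smooth_poly_cnj_poly])
    let ?P = "[:- a, 1:] ^ M * s"
    show "ck N N \<Omega> (\<lambda>z. if z \<in> {a} then 0 else cnj (poly ?P z) * (1 / (z - a)))"
    proof (rule ck_flat_times_pole[OF open_dom, where k = 1])
      show "(\<lambda>z. 1 / (z - a)) holomorphic_on \<Omega> - {a}" by (intro holomorphic_intros) auto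
      show "\<exists>C\<ge>0. \<exists>d>0. \<forall>z\<in>ball a' d - {a'}. norm (1 / (z - a)) \<le> C / norm (z - a') ^ 1" if "a' \<in> {a}" for a'
        using that by (intro exI[of _ 1] conjI) (auto simp: norm_divide)
      show "smooth_on \<Omega> (\<lambda>z. cnj (poly ?P z))" by (rule smooth_on_cnj_poly[OF open_dom])
      fix a' i j assume "a' \<in> {a}" and ij: "i + j \<le> 4 * N + 1 + 1"
      then have a': "a' = a" by simp
      have "poly ((pderiv ^^ (i + j)) ?P) a = 0"
        by (rule poly_higher_pderiv_root[where m = M]) (use ij in \<open>auto simp: M_def\<close>)
      then show "pdiff i j (\<lambda>z. cnj (poly ?P z)) a' = 0"
        using pdiff_cnj_holomorphic[of UNIV "poly ?P" a i j 1] unfolding a' higher_deriv_poly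
        by (simp add: holomorphic_intros)
    qed (use a Z\<Omega> in auto)
    show "poly (ga a) z * cnj (poly ?P z) = poly g z * (if z \<in> {a} then 0 else cnj (poly ?P z) * (1 / (z - a)))" for z
      by (cases "z = a") (auto simp: pga[OF a] M_def)
  qed
  have cardZ: "card Z \<le> m"
  proof (rule ccontr)
    assume "\<not> card Z \<le> m"
    obtain e where e: "bij_betw e {0..<card Z} Z" using ex_bij_betw_nat_finite[OF finZ] by blast
    have eZ: "e j \<in> Z" if "j \<le> m" for j using e that \<open>\<not> card Z \<le> m\<close> by (auto simp: bij_betw_def)
    have einj: "e j \<noteq> e k" if "j \<le> m" "k \<le> m" "j \<noteq> k" for j k
      using e that \<open>\<not> card Z \<le> m\<close> by (auto simp: bij_betw_def inj_on_def)
    obtain c k where c: "k \<le> m" "c k \<noteq> 0" "\<And>q. B (\<Sum>j\<le>m. Polynomial.smult (c j) (ga (e j))) q = 0"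
      using rank[of "\<lambda>j. ga (e j)"] by blast
    \<comment> \<open>\<open>W\<close> is flat at all chosen roots except \<open>e k\<close>. By
      Bezout's identity \<open>qa (e k)\<close> can be replaced by a multiple \<open>s\<close> of
      \<open>W\<close>, up to a polynomial flat at \<open>e k\<close>; then \<open>s\<close> is seen
      by the functional at \<open>e k\<close> alone and isolates the coefficient
      \<open>c k\<close>.\<close>
    define W where "W = (\<Prod>j\<in>{..m} - {k}. [:- e j, 1:] ^ M)"
    have "poly W (e k) \<noteq> 0" unfolding W_def poly_prod using einj c(1) by (auto simp: prod_zero_iff)
    then obtain u v where uv: "u * W + v * [:- e k, 1:] ^ M = 1" using bezout_linear_power by blast
    define s where "s = qa (e k) * u * W"
    have "qa (e k) = qa (e k) * (u * W + v * [:- e k, 1:] ^ M)" by (simp only: uv mult_1_right)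
    also have "\<dots> = s + [:- e k, 1:] ^ M * (qa (e k) * v)"
      unfolding s_def by (simp only: algebra_simps)
    finally have "B (ga (e k)) (qa (e k)) = B (ga (e k)) s + B (ga (e k)) ([:- e k, 1:] ^ M * (qa (e k) * v))"
      by (metis B_add_right)
    then have Bs: "B (ga (e k)) s \<noteq> 0" using qa[OF eZ[OF c(1)]] flat0[OF eZ[OF c(1)]] by simp
    have "B (ga (e j)) s = 0" if "j \<le> m" "j \<noteq> k" for j
    proof -
      have "W = [:- e j, 1:] ^ M * (\<Prod>j\<in>{..m} - {k} - {j}. [:- e j, 1:] ^ M)"
        unfolding W_def using that by (intro prod.remove) auto
      then have "s = [:- e j, 1:] ^ M * (qa (e k) * u * (\<Prod>j\<in>{..m} - {k} - {j}. [:- e j, 1:] ^ M))"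
        unfolding s_def by (simp only: mult_ac)
      then show ?thesis using flat0[OF eZ[OF that(1)]] by metis
    qed
    then have "(\<Sum>j\<le>m. c j * B (ga (e j)) s) = (\<Sum>j\<le>m. if j = k then c k * B (ga (e k)) s else 0)"
      by (intro sum.cong) auto
    also have "\<dots> = c k * B (ga (e k)) s" using c(1) by simp
    finally have "(\<Sum>j\<le>m. c j * B (ga (e j)) s) = c k * B (ga (e k)) s" .
    moreover have "(\<Sum>j\<le>m. c j * B (ga (e j)) s) = 0" using c(3)[of s] by (simp add: B_sum_left B_smult_left)
    ultimately show False using c(2) Bs by simp
  qed
  \<comment> \<open>The flatness under which division by \<open>g\<close>, with poles of order at
    most \<open>degree g\<close>, leaves a function of order \<open>N\<close>. A smooth function
    this flat at the roots is then a multiple of \<open>g\<close> and is annihilated by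
    \<open>F\<close>.\<close>
  define n where "n = 4 * N + degree g + 1"
  define J where "J = Z \<times> {..n} \<times> {..n}"
  define l where "l = (\<lambda>(a, i, j) \<phi>. pdiff i j \<phi> (a :: complex))"
  have "\<exists>c. \<forall>\<phi>\<in>Collect (smooth_on \<Omega>). F \<phi> = (\<Sum>x\<in>J. c x * l x \<phi>)"
  proof (rule functional_in_span)
    show "finite J" using finZ by (simp add: J_def)
    fix v w c assume vw: "v \<in> Collect (smooth_on \<Omega>)" "w \<in> Collect (smooth_on \<Omega>)"
    then have cw: "smooth_on \<Omega> (\<lambda>z. c * w z)" by (simp add: smooth_on_cmult open_dom)
    then show "(\<lambda>z. v z + c * w z) \<in> Collect (smooth_on \<Omega>)" using vw by (simp add: smooth_on_add open_dom)
    show "F (\<lambda>z. v z + c * w z) = F v + c * F w" using vw cw add scale by simp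
    fix x assume "x \<in> J"
    then obtain a i j where x: "x = (a, i, j)" "a \<in> \<Omega>" using Z\<Omega> by (auto simp: J_def)
    show "l x (\<lambda>z. v z + c * w z) = l x v + c * l x w"
      using vw cw x(2) pdiff_add[OF open_dom, of i j v "\<lambda>z. c * w z" a] pdiff_cmult[OF open_dom, of i j w a c]
      by (simp add: l_def x(1) smooth_on_imp_ck)
  next
    fix \<phi> assume \<phi>: "\<phi> \<in> Collect (smooth_on \<Omega>)" "\<And>x. x \<in> J \<Longrightarrow> l x \<phi> = 0"
    have flat: "pdiff i j \<phi> a = 0" if "a \<in> Z" "i + j \<le> n" for a i j
      using \<phi>(2)[of "(a, i, j)"] that by (simp add: J_def l_def)
    have "ck N N \<Omega> (\<lambda>z. if z \<in> Z then 0 else \<phi> z * (1 / poly g z))"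
    proof (rule ck_flat_times_pole[OF open_dom finZ Z\<Omega>, where k = "degree g"])
      show "(\<lambda>z. 1 / poly g z) holomorphic_on \<Omega> - Z" by (intro holomorphic_intros) (auto simp: Z_def)
      show "\<exists>C\<ge>0. \<exists>d>0. \<forall>z\<in>ball a d - {a}. norm (1 / poly g z) \<le> C / norm (z - a) ^ degree g" for a
        by (rule poly_inverse_pole[OF gne])
    qed (use \<phi> flat in \<open>auto simp: n_def\<close>)
    then show "F \<phi> = 0"
    proof (rule zero_on_multiples[OF gB, rotated])
      show "smooth_on \<Omega> \<phi>" using \<phi> by simp
      show "\<phi> z = poly g z * (if z \<in> Z then 0 else \<phi> z * (1 / poly g z))" for z
        using flat[of z 0 0] by (auto simp: Z_def)
    qed
  qed
  then obtain c where c: "\<And>\<phi>. smooth_on \<Omega> \<phi> \<Longrightarrow> F \<phi> = (\<Sum>x\<in>J. c x * l x \<phi>)" by auto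
  obtain zq where zq: "bij_betw zq {..<card Z} Z"
    using ex_bij_betw_nat_finite[OF finZ] by (auto simp: atLeast0LessThan)
  have "F \<phi> = (\<Sum>q<card Z. \<Sum>a\<le>n. \<Sum>b\<le>n. c (zq q, a, b) * pdiff a b \<phi> (zq q))" if "smooth_on \<Omega> \<phi>" for \<phi>
  proof -
    have "F \<phi> = (\<Sum>z\<in>Z. \<Sum>a\<le>n. \<Sum>b\<le>n. c (z, a, b) * pdiff a b \<phi> z)"
      unfolding c[OF that] J_def sum.cartesian_product l_def by (intro sum.cong) auto
    also have "\<dots> = (\<Sum>q<card Z. \<Sum>a\<le>n. \<Sum>b\<le>n. c (zq q, a, b) * pdiff a b \<phi> (zq q))"
      by (rule sum.reindex_bij_betw[OF zq, symmetric])
    finally show ?thesis .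
  qed
  moreover have "\<forall>q<card Z. zq q \<in> \<Omega>" using zq Z\<Omega> by (auto simp: bij_betw_def)
  moreover have "inj_on zq {..<card Z}" using zq by (simp add: bij_betw_def)
  ultimately show ?thesis using cardZ
    by (intro exI[of _ "card Z"] exI[of _ zq] exI[of _ n] exI[of _ "\<lambda>q a b. c (zq q, a, b)"]) auto
qed

end

text \<open>Derivatives of point masses are expressed by their action: the signs
  \<open>(-1) ^ (a + b)\<close> from moving derivatives to the test function are absorbed in the
  coefficients \<open>c q a b\<close>, and one bound \<open>N\<close> for the orders serves all
  points.\<close>

theorem theorem3p1:
  fixes \<Omega> :: "complex set" and \<tau> :: "complex measure"
    and P :: "complex \<Rightarrow> complex \<Rightarrow> complex"
    and F :: "(complex \<Rightarrow> complex) \<Rightarrow> complex" and m :: nat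
  assumes domain: "open \<Omega>" "connected \<Omega>" "\<Omega> \<noteq> {}"
    and meas: "sets \<tau> = sets (restrict_space borel \<Omega>)"
    and poly_int: "\<And>p :: complex poly. p \<noteq> 0 \<Longrightarrow>
        0 < (\<integral>\<^sup>+ z. ennreal (norm (poly p z)) \<partial>\<tau>) \<and> (\<integral>\<^sup>+ z. ennreal (norm (poly p z)) \<partial>\<tau>) < \<infinity>"
    and kernel: "reproducing_kernel \<Omega> \<tau> P"
    and F: "compact_distribution \<Omega> F"
    and rank: "toeplitz_rank \<Omega> \<tau> F P m"
  shows "\<exists>m0 zq (N::nat) (c :: nat \<Rightarrow> nat \<Rightarrow> nat \<Rightarrow> complex).
           m0 \<le> m \<and> (\<forall>q<m0. zq q \<in> \<Omega>) \<and> inj_on zq {..<m0} \<and>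
           (\<forall>\<phi>. smooth_on \<Omega> \<phi> \<longrightarrow>
              F \<phi> = (\<Sum>q<m0. \<Sum>a\<le>N. \<Sum>b\<le>N. c q a b * pdiff a b \<phi> (zq q)))"
proof -
  obtain K N C where cd: "compact_dist \<Omega> F K N C"
    using compact_distribution_imp_compact_dist[OF domain(1) F] by blast
  have ks: "kernel_space \<Omega> \<tau> P" by unfold_locales (use domain meas kernel in auto)
  have poly: "(\<lambda>z. poly p z) \<in> analytic_L2 \<Omega> \<tau>" for p
  proof -
    have "(\<integral>\<^sup>+ z. ennreal ((norm (poly p z))\<^sup>2) \<partial>\<tau>) < \<infinity>"
    proof (cases "p = 0")
      case False
      \<comment> \<open>The square of \<open>norm (poly p z)\<close> is the modulus of the
        polynomial \<open>p * p\<close>, so integrability of the moduli of all polynomials gives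
        square integrability.\<close>
      have "(\<integral>\<^sup>+ z. ennreal (norm (poly (p * p) z)) \<partial>\<tau>) < \<infinity>" using poly_int[of "p * p"] False by simp
      then show ?thesis by (simp add: norm_mult power2_eq_square)
    qed simp
    moreover have "(\<lambda>z. poly p z) holomorphic_on \<Omega>" by (intro holomorphic_intros)
    ultimately show ?thesis by (simp add: analytic_L2_def)
  qed
  show ?thesis
  proof (rule compact_dist.finite_support_structure[OF cd])
    show "\<exists>c. (\<exists>j\<le>m. c j \<noteq> 0) \<and> (\<forall>q. compact_dist.B F (\<Sum>j\<le>m. Polynomial.smult (c j) (f j)) q = 0)" for f
      using finite_rank_kernel[OF cd ks rank poly, of f] unfolding compact_dist.B_def[OF cd] .
  qed
qed

end
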